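(* Let $(\mathbf{H},\varphi)$ be a linearized combinatorial Hopf monoid in which $\varphi$ is a balanced convex character. Let $\mathbf{h}\in\mathbf{H}[N]$ for a finite set $N$, and let $\mathfrak{G}\subseteq\mathrm{Aut}(\mathbf{h})$. Then: \begin{enumerate} \item $\Psi_{\mathbf{H},\varphi}(\mathbf{h},\mathfrak{G},\mathbf{x})$ and $\Psi^O_{\mathbf{H},\varphi}(\mathbf{h},\mathfrak{G},\mathbf{x})$ are $M$-increasing; \item $\Psi_{\mathbf{H},\varphi}(\mathbf{h},\mathfrak{G},x)$ is effectively flawless, and for all $i$, $(|N|-i)f_i\le_{\mathfrak{G}} i f_{i+1}$, where $f_i=f_i(\Psi_{\mathbf{H},\varphi}(\mathbf{h},\mathfrak{G},x))$; \item $\Psi^O_{\mathbf{H},\varphi}(\mathbf{h},\mathfrak{G},x)$ is strongly flawless, and for all $i$, $(|N|-i)f_i\le i f_{i+1}$, where $f_i=f_i(\Psi^O_{\mathbf{H},\varphi}(\mathbf{h},\mathfrak{G},x))$. \end{enumerate}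
   Context: $\mathbb{N}=\{0,1,2,\dots\}$, $[x]=\{1,\dots,x\}$, $\mathbf{x}=x_1,x_2,\dots$. A set species $\mathbf{H}$ assigns to each finite set $N$ a finite set $\mathbf{H}[N]$ and to each bijection $\sigma$ a bijection $\mathbf{H}[\sigma]$, functorially. A linearized Hopf monoid: a set species with $|\mathbf{H}[\emptyset]|=1$ and maps $\mu_{M,N}:\mathbf{H}[M]\times\mathbf{H}[N]\to\mathbf{H}[M\sqcup N]$ ($(x,y)\mapsto x\cdot y$) and $\Delta_{M,N}:\mathbf{H}[M\sqcup N]\to(\mathbf{H}[M]\times\mathbf{H}[N])\sqcup\{0\}$ (write $\Delta_{M,N}(\mathbf{h})=(\mathbf{h}|_M,\mathbf{h}/M)$ when nonzero) for disjoint finite $M,N$, whose linear extensions make the linearization a connected Hopf monoid in linear species. A linearized character: maps $\varphi_N:\mathbf{H}[N]\to\{0,1\}$ natural in bijections with $\varphi(x\cdot y)=\varphi(x)\varphi(y)$. $\varphi$ is a balanced convex character if for every finite $N$ and $\mathbf{h}\in\mathbf{H}[N]$: (1) if $|N|=1$ then $\varphi(\mathbf{h})=1$; (2) if $|N|>1$ there is a nonempty $S\subsetneq N$ with $\Delta_{S,N\setminus S}(\mathbf{h})\neq0$; (3) if $\varphi(\mathbf{h})=1$ and $\Delta_{S,N\setminus S}(\mathbf{h})\ne0$ then $\varphi(\mathbf{h}|_S)=\varphi(\mathbf{h}/S)=1$. For a set composition $C=C_1|\cdots|C_k\models N$, $\Delta_C(\mathbf{h})$ is $\mathbf{h}$ if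 $k=1$, otherwise $0$ if $\Delta_{C_1,N\setminus C_1}(\mathbf{h})=0$ and else $(\mathbf{h}|_{C_1},\Delta_{C_2|\cdots|C_k}(\mathbf{h}/C_1))$; $\varphi_C(\mathbf{h})=\prod\varphi(\mathbf{h}_i)$ if $\Delta_C(\mathbf{h})=(\mathbf{h}_1,\dots,\mathbf{h}_k)$, else $0$. For $f:N\to\mathbb{N}$ with values $i_1<\cdots<i_k$, $C(f)=f^{-1}(i_1)|\cdots|f^{-1}(i_k)$; $f$ is $\varphi$-proper iff $\varphi_{C(f)}(\mathbf{h})=1$; $F_\varphi(\mathbf{h})$ is their set. $\mathfrak{S}_N$ acts on $\mathbf{H}[N]$ via $\mathbf{H}[\mathfrak{g}]$, $\mathrm{Aut}(\mathbf{h})$ is the stabilizer, and $\mathfrak{g}f=f\circ\mathfrak{g}^{-1}$. $\Psi_{\mathbf{H},\varphi}(\mathbf{h},\mathfrak{G},\mathbf{x};\mathfrak{g})=\sum_{f\in F_\varphi(\mathbf{h}),\mathfrak{g}f=f}\prod_{v}x_{f(v)}$ (a class function on $\mathfrak{G}$ with quasisymmetric values); $\Psi_{\mathbf{H},\varphi}(\mathbf{h},\mathfrak{G},x;\mathfrak{g})$ counts those $f$ with additionally $f(N)\subseteq[x]$ (a polynomial class function). $\Psi^O_{\mathbf{H},\varphi}(\mathbf{h},\mathfrak{G},\mathbf{x})=\sum_O\mathbf{x}^O$ over $\mathfrak{G}$-orbits $O$ of $F_\varphi(\mathbf{h})$ with $\mathbf{x}^O=\prod_vx_{f(v)}$ for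 $f\in O$; $\Psi^O_{\mathbf{H},\varphi}(\mathbf{h},\mathfrak{G},x)$ is the number of orbits of $\varphi$-proper $f$ with $f(N)\subseteq[x]$. Characters: an effective character of $\mathfrak{G}$ is a nonnegative integer combination of irreducible complex characters; $\chi\le_{\mathfrak{G}}\psi$ means $\psi-\chi$ is effective. Integer compositions of $n$ are ordered by $\alpha\le\beta$ iff $\beta$ refines $\alpha$. $M_\alpha$ is the monomial quasisymmetric function. A quasisymmetric class function $F=\sum_\alpha f_\alpha M_\alpha$ ($f_\alpha$ complex class functions on $\mathfrak{G}$) is $M$-increasing if $f_\alpha\le_{\mathfrak{G}} f_\beta$ for all $\alpha\le\beta$ (an ordinary quasisymmetric function is treated with trivial group, i.e. $[M_\alpha]F\le[M_\beta]F$). For a polynomial (class function) $p$ of degree $d$, its $f$-vector is defined by $p=\sum_{i=0}^d f_i\binom{x}{i}$. A polynomial is strongly flawless if $f_i\le f_{i+1}$ for $0\le i\le\frac{d-1}{2}$ and $f_i\le f_{d-i}$ for $0\le i\le\frac d2$; a polynomial class function is effectively flawless if the same inequalities hold with $\le_{\mathfrak{G}}$. *)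

theory Defs
  imports
    Jordan_Normal_Form.VS_Connect
    "HOL-Algebra.Bij"
    "HOL-Algebra.Group_Action"
    "HOL-Library.Multiset"
begin

section \<open>Linearized combinatorial Hopf monoids\<close>

text \<open>
  A species is given on the finite subsets of a type. Structures on different label sets may
  share the same representation in the type of structures, so every operation takes its label
  sets as arguments. A bijection between finite sets is given by a function that is injective on
  its source, and relabelling depends only on the values of this function on the source.
\<close>

locale set_species =
  fixes H :: "'a set \<Rightarrow> 'h set"
    and relabel :: "'a set \<Rightarrow> ('a \<Rightarrow> 'a) \<Rightarrow> 'h \<Rightarrow> 'h"
  assumes finite_structures: "finite N \<Longrightarrow> finite (H N)"
    and relabel_bij: "finite N \<Longrightarrow> inj_on \<sigma> N \<Longrightarrow> bij_betw (relabel N \<sigma>) (H N) (H (\<sigma> ` N))"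
    and relabel_cong: "finite N \<Longrightarrow> inj_on \<sigma> N \<Longrightarrow> h \<in> H N \<Longrightarrow> (\<And>v. v \<in> N \<Longrightarrow> \<sigma> v = \<tau> v)
          \<Longrightarrow> relabel N \<sigma> h = relabel N \<tau> h"
    and relabel_id: "finite N \<Longrightarrow> h \<in> H N \<Longrightarrow> relabel N id h = h"
    and relabel_comp: "finite N \<Longrightarrow> inj_on \<sigma> N \<Longrightarrow> inj_on \<tau> (\<sigma> ` N) \<Longrightarrow> h \<in> H N
          \<Longrightarrow> relabel N (\<tau> \<circ> \<sigma>) h = relabel (\<sigma> ` N) \<tau> (relabel N \<sigma> h)"

text \<open>
  In \<open>\<Delta> M N h\<close>, the value \<open>None\<close> stands for \<open>0\<close> and \<open>Some (x, y)\<close> for the basis element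
  \<open>x \<otimes> y\<close>, with \<open>x\<close> the restriction to \<open>M\<close> and \<open>y\<close> the contraction by \<open>M\<close>.
  All maps in the Hopf monoid axioms are linear extensions of maps that send each basis element
  to a basis element or to \<open>0\<close>, so the axioms of the linearization are exactly the equations
  below between the values on basis elements. The unit and counit are the isomorphism of the
  linear span of the one-element set \<open>H {}\<close> with the ground field. A connected bimonoid has an
  antipode, which therefore is not a further datum or axiom.
\<close>

locale linearized_hopf_monoid = set_species H relabel
  for H :: "'a set \<Rightarrow> 'h set"
    and relabel :: "'a set \<Rightarrow> ('a \<Rightarrow> 'a) \<Rightarrow> 'h \<Rightarrow> 'h" +
  fixes \<mu> :: "'a set \<Rightarrow> 'a set \<Rightarrow> 'h \<Rightarrow> 'h \<Rightarrow> 'h"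
    and \<Delta> :: "'a set \<Rightarrow> 'a set \<Rightarrow> 'h \<Rightarrow> ('h \<times> 'h) option"
  assumes connected: "card (H {}) = 1"
    and product_closed: "finite M \<Longrightarrow> finite N \<Longrightarrow> M \<inter> N = {} \<Longrightarrow> x \<in> H M \<Longrightarrow> y \<in> H N
          \<Longrightarrow> \<mu> M N x y \<in> H (M \<union> N)"
    and coproduct_closed: "finite M \<Longrightarrow> finite N \<Longrightarrow> M \<inter> N = {} \<Longrightarrow> h \<in> H (M \<union> N)
          \<Longrightarrow> \<Delta> M N h = Some (x, y) \<Longrightarrow> x \<in> H M \<and> y \<in> H N"
    and product_natural: "finite M \<Longrightarrow> finite N \<Longrightarrow> M \<inter> N = {} \<Longrightarrow> inj_on \<sigma> (M \<union> N)
          \<Longrightarrow> x \<in> H M \<Longrightarrow> y \<in> H N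
          \<Longrightarrow> relabel (M \<union> N) \<sigma> (\<mu> M N x y) = \<mu> (\<sigma> ` M) (\<sigma> ` N) (relabel M \<sigma> x) (relabel N \<sigma> y)"
    and coproduct_natural: "finite M \<Longrightarrow> finite N \<Longrightarrow> M \<inter> N = {} \<Longrightarrow> inj_on \<sigma> (M \<union> N)
          \<Longrightarrow> h \<in> H (M \<union> N)
          \<Longrightarrow> \<Delta> (\<sigma> ` M) (\<sigma> ` N) (relabel (M \<union> N) \<sigma> h)
              = map_option (map_prod (relabel M \<sigma>) (relabel N \<sigma>)) (\<Delta> M N h)"
    and associative: "finite L \<Longrightarrow> finite M \<Longrightarrow> finite N
          \<Longrightarrow> L \<inter> M = {} \<Longrightarrow> L \<inter> N = {} \<Longrightarrow> M \<inter> N = {} \<Longrightarrow> x \<in> H L \<Longrightarrow> y \<in> H M \<Longrightarrow> z \<in> H N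
          \<Longrightarrow> \<mu> (L \<union> M) N (\<mu> L M x y) z = \<mu> L (M \<union> N) x (\<mu> M N y z)"
    and left_unit: "finite N \<Longrightarrow> e \<in> H {} \<Longrightarrow> x \<in> H N \<Longrightarrow> \<mu> {} N e x = x"
    and right_unit: "finite N \<Longrightarrow> e \<in> H {} \<Longrightarrow> x \<in> H N \<Longrightarrow> \<mu> N {} x e = x"
    and coassociative: "finite L \<Longrightarrow> finite M \<Longrightarrow> finite N
          \<Longrightarrow> L \<inter> M = {} \<Longrightarrow> L \<inter> N = {} \<Longrightarrow> M \<inter> N = {} \<Longrightarrow> h \<in> H (L \<union> M \<union> N)
          \<Longrightarrow> Option.bind (\<Delta> (L \<union> M) N h) (\<lambda>(u, z). map_option (\<lambda>(x, y). (x, y, z)) (\<Delta> L M u))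
              = Option.bind (\<Delta> L (M \<union> N) h) (\<lambda>(x, v). map_option (\<lambda>(y, z). (x, y, z)) (\<Delta> M N v))"
    and left_counit: "finite N \<Longrightarrow> e \<in> H {} \<Longrightarrow> h \<in> H N \<Longrightarrow> \<Delta> {} N h = Some (e, h)"
    and right_counit: "finite N \<Longrightarrow> e \<in> H {} \<Longrightarrow> h \<in> H N \<Longrightarrow> \<Delta> N {} h = Some (h, e)"
    and compatible: "finite A \<Longrightarrow> finite B \<Longrightarrow> finite C \<Longrightarrow> finite D
          \<Longrightarrow> A \<inter> B = {} \<Longrightarrow> A \<inter> C = {} \<Longrightarrow> A \<inter> D = {} \<Longrightarrow> B \<inter> C = {} \<Longrightarrow> B \<inter> D = {} \<Longrightarrow> C \<inter> D = {}
          \<Longrightarrow> x \<in> H (A \<union> B) \<Longrightarrow> y \<in> H (C \<union> D)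
          \<Longrightarrow> \<Delta> (A \<union> C) (B \<union> D) (\<mu> (A \<union> B) (C \<union> D) x y)
              = Option.bind (\<Delta> A B x) (\<lambda>(x1, x2).
                  map_option (\<lambda>(y1, y2). (\<mu> A C x1 y1, \<mu> B D x2 y2)) (\<Delta> C D y))"

locale linearized_combinatorial_hopf_monoid = linearized_hopf_monoid H relabel \<mu> \<Delta>
  for H :: "'a set \<Rightarrow> 'h set"
    and relabel :: "'a set \<Rightarrow> ('a \<Rightarrow> 'a) \<Rightarrow> 'h \<Rightarrow> 'h"
    and \<mu> :: "'a set \<Rightarrow> 'a set \<Rightarrow> 'h \<Rightarrow> 'h \<Rightarrow> 'h"
    and \<Delta> :: "'a set \<Rightarrow> 'a set \<Rightarrow> 'h \<Rightarrow> ('h \<times> 'h) option" +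
  fixes \<phi> :: "'a set \<Rightarrow> 'h \<Rightarrow> nat"
  assumes character_values: "finite N \<Longrightarrow> h \<in> H N \<Longrightarrow> \<phi> N h \<in> {0, 1}"
    and character_natural: "finite N \<Longrightarrow> inj_on \<sigma> N \<Longrightarrow> h \<in> H N
          \<Longrightarrow> \<phi> (\<sigma> ` N) (relabel N \<sigma> h) = \<phi> N h"
    and character_mult: "finite M \<Longrightarrow> finite N \<Longrightarrow> M \<inter> N = {} \<Longrightarrow> x \<in> H M \<Longrightarrow> y \<in> H N
          \<Longrightarrow> \<phi> (M \<union> N) (\<mu> M N x y) = \<phi> M x * \<phi> N y"

locale balanced_convex_character = linearized_combinatorial_hopf_monoid H relabel \<mu> \<Delta> \<phi>
  for H :: "'a set \<Rightarrow> 'h set"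
    and relabel :: "'a set \<Rightarrow> ('a \<Rightarrow> 'a) \<Rightarrow> 'h \<Rightarrow> 'h"
    and \<mu> :: "'a set \<Rightarrow> 'a set \<Rightarrow> 'h \<Rightarrow> 'h \<Rightarrow> 'h"
    and \<Delta> :: "'a set \<Rightarrow> 'a set \<Rightarrow> 'h \<Rightarrow> ('h \<times> 'h) option"
    and \<phi> :: "'a set \<Rightarrow> 'h \<Rightarrow> nat" +
  assumes singleton: "finite N \<Longrightarrow> h \<in> H N \<Longrightarrow> card N = 1 \<Longrightarrow> \<phi> N h = 1"
    and balanced: "finite N \<Longrightarrow> h \<in> H N \<Longrightarrow> card N > 1
          \<Longrightarrow> \<exists>S. S \<noteq> {} \<and> S \<subset> N \<and> \<Delta> S (N - S) h \<noteq> None"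
    and convex: "finite N \<Longrightarrow> h \<in> H N \<Longrightarrow> \<phi> N h = 1 \<Longrightarrow> S \<subseteq> N \<Longrightarrow> \<Delta> S (N - S) h = Some (x, y)
          \<Longrightarrow> \<phi> S x = 1 \<and> \<phi> (N - S) y = 1"

section \<open>Proper functions\<close>

text \<open>
  Set compositions are lists of blocks. The first argument \<open>N\<close> is the set that the list
  composes. The empty list is the only set composition of the empty set; its iterated coproduct
  is the empty tuple, so that the corresponding product of characters is \<open>1\<close>.
\<close>

fun iterated_coproduct ::
  "('a set \<Rightarrow> 'a set \<Rightarrow> 'h \<Rightarrow> ('h \<times> 'h) option) \<Rightarrow> 'a set \<Rightarrow> 'a set list \<Rightarrow> 'h \<Rightarrow> 'h list option"
where
  "iterated_coproduct \<Delta> N [] h = Some []"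
| "iterated_coproduct \<Delta> N [B] h = Some [h]"
| "iterated_coproduct \<Delta> N (B # B' # C) h =
     (case \<Delta> B (N - B) h of
        None \<Rightarrow> None
      | Some (x, y) \<Rightarrow> map_option (Cons x) (iterated_coproduct \<Delta> (N - B) (B' # C) y))"

definition composition_character ::
  "('a set \<Rightarrow> 'a set \<Rightarrow> 'h \<Rightarrow> ('h \<times> 'h) option) \<Rightarrow> ('a set \<Rightarrow> 'h \<Rightarrow> nat)
     \<Rightarrow> 'a set \<Rightarrow> 'a set list \<Rightarrow> 'h \<Rightarrow> nat"
where
  "composition_character \<Delta> \<phi> N C h =
     (case iterated_coproduct \<Delta> N C h of
        None \<Rightarrow> 0
      | Some hs \<Rightarrow> (\<Prod>i<length C. \<phi> (C ! i) (hs ! i)))"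

definition level_composition :: "'a set \<Rightarrow> ('a \<Rightarrow> nat) \<Rightarrow> 'a set list" where
  "level_composition N f = map (\<lambda>i. {v \<in> N. f v = i}) (sorted_list_of_set (f ` N))"

definition proper_functions ::
  "('a set \<Rightarrow> 'a set \<Rightarrow> 'h \<Rightarrow> ('h \<times> 'h) option) \<Rightarrow> ('a set \<Rightarrow> 'h \<Rightarrow> nat)
     \<Rightarrow> 'a set \<Rightarrow> 'h \<Rightarrow> ('a \<Rightarrow> nat) set"
where
  "proper_functions \<Delta> \<phi> N h =
     {f \<in> N \<rightarrow>\<^sub>E UNIV. composition_character \<Delta> \<phi> N (level_composition N f) h = 1}"

section \<open>Group actions\<close>

definition Aut :: "('a set \<Rightarrow> ('a \<Rightarrow> 'a) \<Rightarrow> 'h \<Rightarrow> 'h) \<Rightarrow> 'a set \<Rightarrow> 'h \<Rightarrow> ('a \<Rightarrow> 'a) set" where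
  "Aut relabel N h = stabilizer (BijGroup N) (relabel N) h"

definition function_action :: "'a set \<Rightarrow> ('a \<Rightarrow> 'a) \<Rightarrow> ('a \<Rightarrow> nat) \<Rightarrow> ('a \<Rightarrow> nat)" where
  "function_action N g f = compose N f (inv\<^bsub>BijGroup N\<^esub> g)"

section \<open>Effective characters\<close>

text \<open>\<open>units_of (ring_mat TYPE(complex) n ())\<close> is the group of invertible complex
  \<open>n \<times> n\<close> matrices.\<close>

definition representation :: "'g monoid \<Rightarrow> nat \<Rightarrow> ('g \<Rightarrow> complex mat) \<Rightarrow> bool" where
  "representation G n \<rho> \<longleftrightarrow> \<rho> \<in> hom G (units_of (ring_mat TYPE(complex) n ()))"

definition irreducible_representation :: "'g monoid \<Rightarrow> nat \<Rightarrow> ('g \<Rightarrow> complex mat) \<Rightarrow> bool" where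
  "irreducible_representation G n \<rho> \<longleftrightarrow>
     representation G n \<rho> \<and> n > 0 \<and>
     (\<forall>W. VectorSpace.subspace class_ring W (module_vec TYPE(complex) n) \<and>
          (\<forall>g\<in>carrier G. \<forall>w\<in>W. \<rho> g *\<^sub>v w \<in> W)
          \<longrightarrow> W = {0\<^sub>v n} \<or> W = carrier_vec n)"

definition irreducible_character :: "'g monoid \<Rightarrow> ('g \<Rightarrow> complex) \<Rightarrow> bool" where
  "irreducible_character G \<chi> \<longleftrightarrow>
     (\<exists>n \<rho>. irreducible_representation G n \<rho> \<and> (\<forall>g\<in>carrier G. \<chi> g = (\<Sum>i<n. \<rho> g $$ (i, i))))"

definition effective_character :: "'g monoid \<Rightarrow> ('g \<Rightarrow> complex) \<Rightarrow> bool" where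
  "effective_character G \<chi> \<longleftrightarrow>
     (\<exists>X c. finite X \<and> (\<forall>\<theta>\<in>X. irreducible_character G \<theta>) \<and>
        (\<forall>g\<in>carrier G. \<chi> g = (\<Sum>\<theta>\<in>X. of_nat (c \<theta>) * \<theta> g)))"

definition character_le :: "'g monoid \<Rightarrow> ('g \<Rightarrow> complex) \<Rightarrow> ('g \<Rightarrow> complex) \<Rightarrow> bool" where
  "character_le G \<chi> \<psi> \<longleftrightarrow> effective_character G (\<lambda>g. \<psi> g - \<chi> g)"

definition class_function :: "'g monoid \<Rightarrow> ('g \<Rightarrow> 'b) \<Rightarrow> bool" where
  "class_function G \<chi> \<longleftrightarrow>
     (\<forall>g\<in>carrier G. \<forall>k\<in>carrier G. \<chi> (k \<otimes>\<^bsub>G\<^esub> g \<otimes>\<^bsub>G\<^esub> inv\<^bsub>G\<^esub> k) = \<chi> g)"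

section \<open>Quasisymmetric functions\<close>

definition compositions :: "nat \<Rightarrow> nat list set" where
  "compositions n = {\<alpha>. (\<forall>a\<in>set \<alpha>. a > 0) \<and> sum_list \<alpha> = n}"

definition refined_by :: "nat list \<Rightarrow> nat list \<Rightarrow> bool" where
  "refined_by \<alpha> \<beta> \<longleftrightarrow> (\<exists>\<gamma>s. concat \<gamma>s = \<beta> \<and> map sum_list \<gamma>s = \<alpha>)"

text \<open>
  A multiset of natural numbers is a monomial in variables indexed by the natural numbers (the
  codomain of the functions above), and a power series is its coefficient function on monomials.
\<close>

definition monomial_qsym :: "nat list \<Rightarrow> nat multiset \<Rightarrow> 'r :: comm_ring_1" where
  "monomial_qsym \<alpha> m =
     (if \<exists>is. length is = length \<alpha> \<and> sorted_wrt (<) is \<and>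
           m = (\<Sum>j<length \<alpha>. replicate_mset (\<alpha> ! j) (is ! j))
      then 1 else 0)"

text \<open>The expansion \<open>F = (\<Sum>\<alpha>. c \<alpha> M\<^sub>\<alpha>)\<close>, compared at each monomial \<open>m\<close>; only
  compositions of the degree of \<open>m\<close> can contribute to its coefficient.\<close>

definition qsym_expansion :: "(nat multiset \<Rightarrow> 'r :: comm_ring_1) \<Rightarrow> (nat list \<Rightarrow> 'r) \<Rightarrow> bool" where
  "qsym_expansion F c \<longleftrightarrow> (\<forall>m. F m = (\<Sum>\<alpha>\<in>compositions (size m). c \<alpha> * monomial_qsym \<alpha> m))"

definition M_increasing :: "(nat multiset \<Rightarrow> real) \<Rightarrow> bool" where
  "M_increasing F \<longleftrightarrow>
     (\<exists>c. qsym_expansion F c \<and>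
        (\<forall>n. \<forall>\<alpha>\<in>compositions n. \<forall>\<beta>\<in>compositions n. refined_by \<alpha> \<beta> \<longrightarrow> c \<alpha> \<le> c \<beta>))"

definition M_increasing_class :: "'g monoid \<Rightarrow> ('g \<Rightarrow> nat multiset \<Rightarrow> complex) \<Rightarrow> bool" where
  "M_increasing_class G F \<longleftrightarrow>
     (\<exists>c. (\<forall>g\<in>carrier G. qsym_expansion (F g) (\<lambda>\<alpha>. c \<alpha> g)) \<and>
        (\<forall>\<alpha>. class_function G (c \<alpha>)) \<and>
        (\<forall>n. \<forall>\<alpha>\<in>compositions n. \<forall>\<beta>\<in>compositions n.
           refined_by \<alpha> \<beta> \<longrightarrow> character_le G (c \<alpha>) (c \<beta>)))"

section \<open>f-vectors\<close>

text \<open>Padded with zeros beyond the degree. For a polynomial class function \<open>P\<close> this makes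
  \<open>\<lambda>g. f_vector (P g) i\<close> the \<open>i\<close>-th entry of the f-vector, although the
  degree of \<open>P g\<close> may vary with \<open>g\<close>.\<close>

definition f_vector :: "'r :: field_char_0 poly \<Rightarrow> nat \<Rightarrow> 'r" where
  "f_vector p = (THE f. (\<forall>x. poly p x = (\<Sum>i\<le>degree p. f i * (x gchoose i))) \<and>
                        (\<forall>i>degree p. f i = 0))"

definition strongly_flawless :: "real poly \<Rightarrow> bool" where
  "strongly_flawless p \<longleftrightarrow>
     (\<forall>i. real i \<le> (real (degree p) - 1) / 2 \<longrightarrow> f_vector p i \<le> f_vector p (i + 1)) \<and>
     (\<forall>i. real i \<le> real (degree p) / 2 \<longrightarrow> f_vector p i \<le> f_vector p (degree p - i))"

definition class_degree :: "'g monoid \<Rightarrow> ('g \<Rightarrow> complex poly) \<Rightarrow> nat" where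
  "class_degree G P = Max ((\<lambda>g. degree (P g)) ` carrier G)"

definition effectively_flawless :: "'g monoid \<Rightarrow> ('g \<Rightarrow> complex poly) \<Rightarrow> bool" where
  "effectively_flawless G P \<longleftrightarrow>
     class_function G P \<and>
     (\<forall>i. real i \<le> (real (class_degree G P) - 1) / 2 \<longrightarrow>
        character_le G (\<lambda>g. f_vector (P g) i) (\<lambda>g. f_vector (P g) (i + 1))) \<and>
     (\<forall>i. real i \<le> real (class_degree G P) / 2 \<longrightarrow>
        character_le G (\<lambda>g. f_vector (P g) i) (\<lambda>g. f_vector (P g) (class_degree G P - i)))"

section \<open>The invariants\<close>

definition function_monomial :: "'a set \<Rightarrow> ('a \<Rightarrow> nat) \<Rightarrow> nat multiset" where
  "function_monomial N f = image_mset f (mset_set N)"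

text \<open>In each of the following, the argument \<open>F\<close> is the set of proper functions on \<open>N\<close>.\<close>

definition Psi_qsym :: "'a set \<Rightarrow> ('a \<Rightarrow> nat) set \<Rightarrow> ('a \<Rightarrow> 'a) \<Rightarrow> nat multiset \<Rightarrow> complex" where
  "Psi_qsym N F g m =
     of_nat (card {f \<in> invariants F (function_action N) g. function_monomial N f = m})"

definition Psi_count :: "'a set \<Rightarrow> ('a \<Rightarrow> nat) set \<Rightarrow> ('a \<Rightarrow> 'a) \<Rightarrow> nat \<Rightarrow> nat" where
  "Psi_count N F g x = card {f \<in> invariants F (function_action N) g. f ` N \<subseteq> {1..x}}"

text \<open>All functions in an orbit have the same monomial.\<close>

definition orbit_Psi_qsym ::
  "('a \<Rightarrow> 'a) monoid \<Rightarrow> 'a set \<Rightarrow> ('a \<Rightarrow> nat) set \<Rightarrow> nat multiset \<Rightarrow> real"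
where
  "orbit_Psi_qsym G N F m =
     of_nat (card {Ob \<in> orbits G F (function_action N). \<exists>f\<in>Ob. function_monomial N f = m})"

definition orbit_Psi_count ::
  "('a \<Rightarrow> 'a) monoid \<Rightarrow> 'a set \<Rightarrow> ('a \<Rightarrow> nat) set \<Rightarrow> nat \<Rightarrow> nat"
where
  "orbit_Psi_count G N F x = card (orbits G {f \<in> F. f ` N \<subseteq> {1..x}} (function_action N))"

end

theory Submission
  imports Defs
begin

text \<open>
  Let \<open>X\<^sub>\<alpha>\<close> be the set of proper set compositions of type \<open>\<alpha>\<close>, with the action of the group on
  blocks. The proper functions with a given monomial correspond to \<open>X\<^sub>\<alpha>\<close>, where \<open>\<alpha>\<close> lists
  the exponents of the monomial, so the coefficient of \<open>M\<^sub>\<alpha>\<close> is the permutation character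
  \<open>f\<^sub>\<alpha>\<close> of \<open>X\<^sub>\<alpha>\<close>, or its number of orbits. If \<open>\<beta>\<close> arises from \<open>\<alpha>\<close> by splitting one part,
  merging the two blocks maps an invariant subset of \<open>X\<^sub>\<beta>\<close> equivariantly to \<open>X\<^sub>\<alpha>\<close>. This map is
  onto: balancedness and coassociativity give a nonzero coproduct for every size of the first
  factor, and convexity keeps the refined composition proper. Hence \<open>f\<^sub>\<alpha> \<le> f\<^sub>\<beta>\<close>; for
  characters, the difference is afforded by the complement of an invariant idempotent, and
  Maschke's theorem decomposes it into irreducible characters.

  The \<open>i\<close>-th entry of the f-vector is the sum of \<open>f\<^sub>\<alpha>\<close> over the compositions with \<open>i\<close> parts.
  Identifying compositions of \<open>n\<close> with subsets of \<open>{..<n - 1}\<close>, the inequality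
  \<open>(n - i) f\<^sub>i \<le> i f\<^sub>i\<^sub>+\<^sub>1\<close> counts the pairs of a subset and a new element, and flawlessness
  follows from an injection between levels of the Boolean lattice that enlarges sets, given by
  a symmetric chain decomposition.
\<close>

section \<open>Idempotent matrices and invariant subspaces\<close>

text \<open>Merging two blocks of a proper composition need not give a proper one: convexity passes
  from a structure to its pieces and not back. Hence merging is restricted to those compositions
  whose merge is again proper. Balancedness alone offers a cut of unknown size, while a refinement
  of types prescribes the sizes of both pieces; this is what forces cuts of every size. The order on
  class functions asks for a decomposition into irreducibles, so comparing values is not enough and
  each difference must be afforded by a representation. The comparison of levels uses only that
  effective elements contain 0 and are closed under addition: multiples are never cancelled, and
  terms are matched along inclusions of sets. The same argument then serves characters and orbit
  counts.\<close>

definition mat_trace :: "'r :: comm_ring_1 mat \<Rightarrow> 'r" where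
  "mat_trace A = (\<Sum>i<dim_row A. A $$ (i, i))"

text \<open>Stated for rectangular factors: for \<open>A * B = P\<close> and
  \<open>B * A = 1\<^sub>m r\<close> it equates the trace of an idempotent with its rank.\<close>

lemma mat_trace_comm:
  assumes "A \<in> carrier_mat n m" and "B \<in> carrier_mat m n"
  shows "mat_trace (A * B) = mat_trace (B * A)"
proof -
  have "mat_trace (A * B) = (\<Sum>i<n. \<Sum>j<m. A $$ (i, j) * B $$ (j, i))"
    using assms by (simp add: mat_trace_def scalar_prod_def atLeast0LessThan)
  also have "\<dots> = (\<Sum>j<m. \<Sum>i<n. B $$ (j, i) * A $$ (i, j))"
    by (subst sum.swap) (simp add: mult.commute)
  also have "\<dots> = mat_trace (B * A)"
    using assms by (simp add: mat_trace_def scalar_prod_def atLeast0LessThan)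
  finally show ?thesis .
qed

lemma mat_trace_add:
  assumes "A \<in> carrier_mat n n" and "B \<in> carrier_mat n n"
  shows "mat_trace (A + B) = mat_trace A + mat_trace B"
  using assms by (simp add: mat_trace_def sum.distrib)

lemma mat_trace_one: "mat_trace (1\<^sub>m n) = of_nat n"
  by (simp add: mat_trace_def)

text \<open>Padding \<open>A\<close> with zero rows and \<open>B\<close> with zero columns makes
  both square without changing \<open>B * A\<close>. A one-sided inverse of a square matrix is
  two-sided, but if \<open>n < r\<close> the padded \<open>A' * B'\<close> has a zero on its
  diagonal.\<close>

lemma left_inverse_rank_le:
  fixes A :: "'r :: field mat"
  assumes A: "A \<in> carrier_mat n r" and B: "B \<in> carrier_mat r n" and BA: "B * A = 1\<^sub>m r"
  shows "r \<le> n"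
proof (rule ccontr)
  assume "\<not> r \<le> n"
  then have nr: "n < r" by simp
  define A' where "A' = mat r r (\<lambda>(i, j). if i < n then A $$ (i, j) else 0)"
  define B' where "B' = mat r r (\<lambda>(i, j). if j < n then B $$ (i, j) else 0)"
  have "B' * A' = B * A"
  proof (rule eq_matI)
    fix i j assume "i < dim_row (B * A)" "j < dim_col (B * A)"
    then have ij: "i < r" "j < r" using A B by auto
    have "(B' * A') $$ (i, j) = (\<Sum>k<r. B' $$ (i, k) * A' $$ (k, j))"
      using ij by (simp add: A'_def B'_def scalar_prod_def atLeast0LessThan)
    also have "\<dots> = (\<Sum>k<n. B $$ (i, k) * A $$ (k, j))"
      using nr ij by (intro sum.mono_neutral_cong_right) (auto simp: A'_def B'_def)
    finally show "(B' * A') $$ (i, j) = (B * A) $$ (i, j)"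
      using A B ij by (simp add: scalar_prod_def atLeast0LessThan)
  qed (use A B in \<open>auto simp: A'_def B'_def\<close>)
  then have "A' * B' = 1\<^sub>m r"
    using BA by (intro mat_mult_left_right_inverse[of B' r A']) (auto simp: A'_def B'_def)
  then have "(A' * B') $$ (n, n) = 1" using nr by simp
  moreover have "(A' * B') $$ (n, n) = 0"
    using nr by (simp add: A'_def B'_def scalar_prod_def)
  ultimately show False by simp
qed

text \<open>The closure conditions are stated on vectors directly, so that ranges of matrices and
  invariant subspaces are handled alike.\<close>

definition linear_subspace :: "nat \<Rightarrow> 'r :: comm_ring_1 vec set \<Rightarrow> bool" where
  "linear_subspace n W \<longleftrightarrow> W \<subseteq> carrier_vec n \<and> 0\<^sub>v n \<in> W \<and>
     (\<forall>v\<in>W. \<forall>w\<in>W. v + w \<in> W) \<and> (\<forall>c. \<forall>w\<in>W. c \<cdot>\<^sub>v w \<in> W)"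

lemma linear_subspace_of_subspace:
  "VectorSpace.subspace class_ring W (module_vec TYPE('r :: field) n) \<Longrightarrow> linear_subspace n W"
  unfolding VectorSpace.subspace_def submodule_def linear_subspace_def
  by (simp add: module_vec_simps)

lemma linear_subspace_range:
  assumes "P \<in> carrier_mat n m"
  shows "linear_subspace n ((*\<^sub>v) P ` carrier_vec m)"
  unfolding linear_subspace_def
proof (intro conjI allI ballI)
  show "0\<^sub>v n \<in> (*\<^sub>v) P ` carrier_vec m"
    by (rule image_eqI[of _ _ "0\<^sub>v m"]) (use assms in auto)
next
  fix v w assume "v \<in> (*\<^sub>v) P ` carrier_vec m" "w \<in> (*\<^sub>v) P ` carrier_vec m"
  then obtain x y where "v = P *\<^sub>v x" "w = P *\<^sub>v y" "x \<in> carrier_vec m" "y \<in> carrier_vec m"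
    by auto
  then show "v + w \<in> (*\<^sub>v) P ` carrier_vec m"
    by (intro image_eqI[of _ _ "x + y"]) (use assms in \<open>auto simp: mult_add_distrib_mat_vec\<close>)
next
  fix c w assume "w \<in> (*\<^sub>v) P ` carrier_vec m"
  then obtain y where "w = P *\<^sub>v y" "y \<in> carrier_vec m" by auto
  then show "c \<cdot>\<^sub>v w \<in> (*\<^sub>v) P ` carrier_vec m"
    by (intro image_eqI[of _ _ "c \<cdot>\<^sub>v y"]) (use assms in \<open>auto simp: mult_mat_vec\<close>)
qed (use assms in auto)

text \<open>The columns of \<open>A\<close> are vectors in \<open>W\<close> and the rows of
  \<open>B\<close> are functionals dual to them, so \<open>A * B\<close> projects onto their span. A
  vector of \<open>W\<close> that is moved by this projection yields one more dual pair.\<close>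

lemma biorthogonal_extend:
  fixes A :: "'r :: field mat"
  assumes W: "linear_subspace n W"
    and A: "A \<in> carrier_mat n r" and B: "B \<in> carrier_mat r n" and BA: "B * A = 1\<^sub>m r"
    and AW: "\<forall>v\<in>carrier_vec r. A *\<^sub>v v \<in> W"
    and w: "w \<in> W" and ne: "A *\<^sub>v (B *\<^sub>v w) \<noteq> w"
  shows "\<exists>A' \<in> carrier_mat n (Suc r). \<exists>B' \<in> carrier_mat (Suc r) n. B' * A' = 1\<^sub>m (Suc r) \<and>
           (\<forall>v\<in>carrier_vec (Suc r). A' *\<^sub>v v \<in> W)"
proof -
  have wn: "w \<in> carrier_vec n" using W w by (auto simp: linear_subspace_def)
  \<comment> \<open>The component of \<open>w\<close> outside the span: it stays in \<open>W\<close>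
    and is killed by every row of \<open>B\<close>.\<close>
  define u where "u = w + (- 1) \<cdot>\<^sub>v (A *\<^sub>v (B *\<^sub>v w))"
  have un: "u \<in> carrier_vec n" using wn A B by (simp add: u_def)
  have uW: "u \<in> W"
    unfolding u_def using W w AW B wn by (auto simp: linear_subspace_def)
  have "B *\<^sub>v u = B *\<^sub>v w + (- 1) \<cdot>\<^sub>v (B *\<^sub>v (A *\<^sub>v (B *\<^sub>v w)))"
    unfolding u_def using A B wn by (simp add: mult_add_distrib_mat_vec[of _ r n] mult_mat_vec[of _ r n])
  also have "B *\<^sub>v (A *\<^sub>v (B *\<^sub>v w)) = (B * A) *\<^sub>v (B *\<^sub>v w)"
    using A B wn by (simp add: assoc_mult_mat_vec[of B r n A r])
  finally have Bu: "B *\<^sub>v u = 0\<^sub>v r" using B wn by (auto simp: BA)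
  have "\<exists>i<n. u $ i \<noteq> 0"
  proof (rule ccontr)
    assume "\<not> ?thesis"
    then have "\<And>i. i < n \<Longrightarrow> w $ i = (A *\<^sub>v (B *\<^sub>v w)) $ i"
      using A B wn by (simp add: u_def)
    then have "A *\<^sub>v (B *\<^sub>v w) = w" using A B wn by (intro eq_vecI) auto
    with ne show False by simp
  qed
  then obtain k where k: "k < n" "u $ k \<noteq> 0" by blast
  \<comment> \<open>The \<open>k\<close>-th coordinate after applying \<open>1 - A * B\<close>,
    divided by \<open>u $ k\<close>: this functional kills the columns of \<open>A\<close> and sends
    \<open>u\<close> to 1.\<close>
  define y where "y = vec n (\<lambda>j. ((if j = k then 1 else 0) - (A * B) $$ (k, j)) / u $ k)"
  have y_prod: "y \<bullet> v = (v $ k - ((A * B) *\<^sub>v v) $ k) / u $ k" if "v \<in> carrier_vec n" for v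
  proof -
    define C where "C = A * B"
    have Cn: "C \<in> carrier_mat n n" using A B by (simp add: C_def)
    have "y \<bullet> v = (\<Sum>j<n. ((if j = k then v $ j else 0) - C $$ (k, j) * v $ j) / u $ k)"
      using that unfolding y_def C_def[symmetric] scalar_prod_def
      by (intro sum.cong) (auto simp: field_simps)
    also have "\<dots> = ((\<Sum>j<n. if j = k then v $ j else 0) - (\<Sum>j<n. C $$ (k, j) * v $ j)) / u $ k"
      by (simp add: sum_divide_distrib[symmetric] sum_subtractf)
    also have "(\<Sum>j<n. C $$ (k, j) * v $ j) = (C *\<^sub>v v) $ k"
      using that Cn k by (simp add: scalar_prod_def atLeast0LessThan)
    finally show ?thesis using k by (simp add: C_def)
  qed
  define A' where "A' = mat n (Suc r) (\<lambda>(i, j). if j < r then A $$ (i, j) else u $ i)"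
  define B' where "B' = mat (Suc r) n (\<lambda>(i, j). if i < r then B $$ (i, j) else y $ j)"
  have colA: "col A' j = (if j < r then col A j else u)" if "j < Suc r" for j
    using that A un by (intro eq_vecI) (auto simp: A'_def)
  have rowB: "row B' j = (if j < r then row B j else y)" if "j < Suc r" for j
    using that B by (intro eq_vecI) (auto simp: B'_def y_def)
  have "B' * A' = 1\<^sub>m (Suc r)"
  proof (rule eq_matI)
    fix i j assume "i < dim_row (1\<^sub>m (Suc r) :: 'r mat)" "j < dim_col (1\<^sub>m (Suc r) :: 'r mat)"
    then have ij: "i < Suc r" "j < Suc r" by auto
    have e: "(B' * A') $$ (i, j) = row B' i \<bullet> col A' j"
      using ij by (simp add: A'_def B'_def)
    have 1: "row B i \<bullet> col A j = (if i = j then 1 else 0)" if "i < r" "j < r"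
      using arg_cong[OF BA, of "\<lambda>M. M $$ (i, j)"] that A B by simp
    have 2: "row B i \<bullet> u = 0" if "i < r"
      using arg_cong[OF Bu, of "\<lambda>v. v $ i"] that B by simp
    have 3: "y \<bullet> col A j = 0" if "j < r"
    proof -
      have "(A * B) *\<^sub>v col A j = col (A * B * A) j"
        using A B that by (intro col_mult2[of "A * B" n n A r, symmetric]) auto
      also have "A * B * A = A"
        using A B BA by (simp add: assoc_mult_mat[of A n r B n A r])
      finally show ?thesis using y_prod[of "col A j"] A by auto
    qed
    have 4: "y \<bullet> u = 1"
    proof -
      have "(A * B) *\<^sub>v u = 0\<^sub>v n"
        using A B un Bu by (simp add: assoc_mult_mat_vec[of A n r B n u]) (auto simp: scalar_prod_def)
      then show ?thesis using y_prod[OF un] k by simp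
    qed
    show "(B' * A') $$ (i, j) = 1\<^sub>m (Suc r) $$ (i, j)"
      unfolding e colA[OF ij(2)] rowB[OF ij(1)] using ij 1 2 3 4 by auto
  qed (auto simp: A'_def B'_def)
  moreover have "A' *\<^sub>v v \<in> W" if v: "v \<in> carrier_vec (Suc r)" for v
  proof -
    have "A' *\<^sub>v v = A *\<^sub>v vec r (($) v) + v $ r \<cdot>\<^sub>v u"
      using A v un by (intro eq_vecI) (auto simp: A'_def scalar_prod_def)
    then show ?thesis using AW[rule_format, of "vec r (($) v)"] uW W by (auto simp: linear_subspace_def)
  qed
  ultimately show ?thesis
    by (intro bexI[of _ A'] bexI[of _ B']) (auto simp: A'_def B'_def)
qed

text \<open>A dual pair inside \<open>W\<close> has at most \<open>n\<close> members, so one of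
  maximal size exists. It cannot be extended, hence \<open>A * B\<close> fixes \<open>W\<close>
  pointwise.\<close>

lemma linear_subspace_coordinates:
  fixes W :: "'r :: field vec set"
  assumes W: "linear_subspace n W"
  obtains r A B where "A \<in> carrier_mat n r" "B \<in> carrier_mat r n" "B * A = 1\<^sub>m r"
    "\<forall>v\<in>carrier_vec r. A *\<^sub>v v \<in> W" "\<forall>w\<in>W. A *\<^sub>v (B *\<^sub>v w) = w"
proof -
  define Q where "Q r \<longleftrightarrow> (\<exists>A\<in>carrier_mat n r. \<exists>B\<in>carrier_mat r n. B * A = 1\<^sub>m r \<and>
           (\<forall>v\<in>carrier_vec r. A *\<^sub>v v \<in> W))" for r
  have Q0: "Q 0"
    unfolding Q_def
  proof (intro bexI conjI ballI)
    show "0\<^sub>m 0 n * 0\<^sub>m n 0 = (1\<^sub>m 0 :: 'r mat)" by auto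
    fix v :: "'r vec" assume v: "v \<in> carrier_vec 0"
    have "0\<^sub>m n 0 *\<^sub>v v = 0\<^sub>v n" using v by (intro eq_vecI) (auto simp: scalar_prod_def)
    then show "0\<^sub>m n 0 *\<^sub>v v \<in> W" using W by (simp add: linear_subspace_def)
  qed auto
  have bound: "\<And>r. Q r \<Longrightarrow> r \<le> n" using left_inverse_rank_le unfolding Q_def by blast
  define r where "r = Greatest Q"
  have "Q r" unfolding r_def using Q0 bound by (rule GreatestI_nat)
  then obtain A B where AB: "A \<in> carrier_mat n r" "B \<in> carrier_mat r n" "B * A = 1\<^sub>m r"
    "\<forall>v\<in>carrier_vec r. A *\<^sub>v v \<in> W" unfolding Q_def by (elim bexE conjE)
  have "\<forall>w\<in>W. A *\<^sub>v (B *\<^sub>v w) = w"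
  proof (rule ballI, rule ccontr)
    fix w assume w: "w \<in> W"
    assume "A *\<^sub>v (B *\<^sub>v w) \<noteq> w"
    from biorthogonal_extend[OF W AB w this] have "Q (Suc r)" unfolding Q_def by blast
    then have "Suc r \<le> r" unfolding r_def using bound by (rule Greatest_le_nat)
    then show False by simp
  qed
  with AB show thesis by (rule that)
qed

lemma mult_mat_vec_eq_imp_eq:
  fixes P :: "'r :: comm_ring_1 mat"
  assumes P: "P \<in> carrier_mat n m" and Q: "Q \<in> carrier_mat n m"
    and eq: "\<And>v. v \<in> carrier_vec m \<Longrightarrow> P *\<^sub>v v = Q *\<^sub>v v"
  shows "P = Q"
proof (rule eq_matI)
  fix i j assume ij: "i < dim_row Q" "j < dim_col Q"
  then have "(P *\<^sub>v unit_vec m j) $ i = (Q *\<^sub>v unit_vec m j) $ i" using Q eq by simp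
  then show "P $$ (i, j) = Q $$ (i, j)" using ij P Q by simp
qed (use P Q in auto)

text \<open>Coordinates on the range of \<open>P\<close> give a projection \<open>A * B\<close> with
  the right range but possibly the wrong kernel. Replacing \<open>B\<close> by \<open>B * P\<close>
  corrects the kernel and, since \<open>P * A = A\<close>, keeps the left inverse.\<close>

lemma idempotent_factorization:
  fixes P :: "'r :: field mat"
  assumes P: "P \<in> carrier_mat n n" and idem: "P * P = P"
  obtains r A B where "A \<in> carrier_mat n r" "B \<in> carrier_mat r n" "B * A = 1\<^sub>m r" "A * B = P"
proof -
  obtain r A B where AB: "A \<in> carrier_mat n r" "B \<in> carrier_mat r n" "B * A = 1\<^sub>m r"
    and AW: "\<forall>v\<in>carrier_vec r. A *\<^sub>v v \<in> (*\<^sub>v) P ` carrier_vec n"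
    and fix': "\<forall>w\<in>(*\<^sub>v) P ` carrier_vec n. A *\<^sub>v (B *\<^sub>v w) = w"
    by (rule linear_subspace_coordinates[OF linear_subspace_range[OF P]])
  have Pfix: "P *\<^sub>v w = w" if "w \<in> (*\<^sub>v) P ` carrier_vec n" for w
  proof -
    from that obtain v where v: "v \<in> carrier_vec n" and w: "w = P *\<^sub>v v" by auto
    have "P *\<^sub>v (P *\<^sub>v v) = (P * P) *\<^sub>v v" using P v by simp
    then show ?thesis by (simp add: idem w)
  qed
  have PA: "P * A = A"
  proof (rule mult_mat_vec_eq_imp_eq[of _ n r])
    fix v :: "'r vec" assume v: "v \<in> carrier_vec r"
    have "P * A *\<^sub>v v = P *\<^sub>v (A *\<^sub>v v)" by (rule assoc_mult_mat_vec[OF P AB(1) v])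
    also have "\<dots> = A *\<^sub>v v" by (rule Pfix[OF AW[rule_format, OF v]])
    finally show "P * A *\<^sub>v v = A *\<^sub>v v" .
  qed (use P AB in auto)
  have "A * (B * P) = P"
  proof (rule mult_mat_vec_eq_imp_eq[of _ n n])
    fix v :: "'r vec" assume v: "v \<in> carrier_vec n"
    have "A * (B * P) *\<^sub>v v = A *\<^sub>v (B * P *\<^sub>v v)"
      using P AB v by (intro assoc_mult_mat_vec[of A n r]) auto
    also have "B * P *\<^sub>v v = B *\<^sub>v (P *\<^sub>v v)"
      using P AB v by (intro assoc_mult_mat_vec[of B r n]) auto
    also have "A *\<^sub>v (B *\<^sub>v (P *\<^sub>v v)) = P *\<^sub>v v" using v by (intro fix'[rule_format] imageI)
    finally show "A * (B * P) *\<^sub>v v = P *\<^sub>v v" .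
  qed (use P AB in auto)
  moreover have "B * P * A = 1\<^sub>m r"
    using P AB PA by (simp add: assoc_mult_mat[of B r n P n A r])
  moreover have "B * P \<in> carrier_mat r n" using AB(2) P by (rule mult_carrier_mat)
  ultimately show thesis by (intro that[OF AB(1)])
qed

section \<open>Representations of finite groups\<close>

lemma zero_mult_mat_vec:
  "v \<in> carrier_vec m \<Longrightarrow> 0\<^sub>m n m *\<^sub>v v = (0\<^sub>v n :: 'r :: comm_ring_1 vec)"
  by (intro eq_vecI) (auto simp: scalar_prod_def)

lemma representation_carrier:
  "representation G n \<rho> \<Longrightarrow> g \<in> carrier G \<Longrightarrow> \<rho> g \<in> carrier_mat n n"
  by (auto simp: representation_def hom_def units_of_def Units_def ring_mat_simps)

lemma representation_mult:
  "representation G n \<rho> \<Longrightarrow> g \<in> carrier G \<Longrightarrow> k \<in> carrier G \<Longrightarrow> \<rho> (g \<otimes>\<^bsub>G\<^esub> k) = \<rho> g * \<rho> k"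
  by (auto simp: representation_def hom_def units_of_def Units_def ring_mat_simps)

lemma representation_one:
  assumes "group G" and "representation G n \<rho>"
  shows "\<rho> \<one>\<^bsub>G\<^esub> = 1\<^sub>m n"
proof -
  interpret R: ring "ring_mat TYPE(complex) n ()" by (rule ring_mat)
  have "\<rho> \<one>\<^bsub>G\<^esub> = \<one>\<^bsub>units_of (ring_mat TYPE(complex) n ())\<^esub>"
    using assms R.units_group by (intro hom_one) (auto simp: representation_def)
  then show ?thesis by (simp add: units_of_def ring_mat_simps)
qed

text \<open>Invertibility comes for free, with \<open>\<rho> (inv g)\<close> as the inverse of
  \<open>\<rho> g\<close>.\<close>

lemma representationI:
  fixes G :: "'g monoid" (structure)
  assumes G: "group G"
    and carr: "\<And>g. g \<in> carrier G \<Longrightarrow> \<rho> g \<in> carrier_mat n n"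
    and mult: "\<And>g k. g \<in> carrier G \<Longrightarrow> k \<in> carrier G \<Longrightarrow> \<rho> (g \<otimes>\<^bsub>G\<^esub> k) = \<rho> g * \<rho> k"
    and one: "\<rho> \<one>\<^bsub>G\<^esub> = 1\<^sub>m n"
  shows "representation G n \<rho>"
proof -
  interpret group G by fact
  have "\<rho> g \<in> Units (ring_mat TYPE(complex) n ())" if g: "g \<in> carrier G" for g
  proof -
    have "\<rho> g * \<rho> (inv g) = 1\<^sub>m n" "\<rho> (inv g) * \<rho> g = 1\<^sub>m n"
      using g mult[of g "inv g"] mult[of "inv g" g] one by simp_all
    then show ?thesis using g carr by (auto simp: Units_def ring_mat_simps)
  qed
  then show ?thesis
    using mult by (auto simp: representation_def hom_def units_of_def ring_mat_simps)
qed

text \<open>Entrywise with the size fixed in advance, so that the average is an \<open>n\<close> by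
  \<open>n\<close> matrix without conditions on \<open>Q\<close>.\<close>

definition mat_average :: "nat \<Rightarrow> 'g set \<Rightarrow> ('g \<Rightarrow> complex mat) \<Rightarrow> complex mat" where
  "mat_average n S Q = mat n n (\<lambda>(i, j). (\<Sum>g\<in>S. Q g $$ (i, j)) / of_nat (card S))"

lemma mat_average_carrier [simp]: "mat_average n S Q \<in> carrier_mat n n"
  by (simp add: mat_average_def)

lemma mat_average_cong:
  "(\<And>g. g \<in> S \<Longrightarrow> Q g = R g) \<Longrightarrow> mat_average n S Q = mat_average n S R"
  by (simp add: mat_average_def cong: sum.cong)

lemma mat_average_const:
  "finite S \<Longrightarrow> S \<noteq> {} \<Longrightarrow> A \<in> carrier_mat n n \<Longrightarrow> mat_average n S (\<lambda>_. A) = A"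
  by (auto simp: mat_average_def)

lemma mult_mat_average:
  assumes "A \<in> carrier_mat n n" and "\<And>g. g \<in> S \<Longrightarrow> Q g \<in> carrier_mat n n"
  shows "A * mat_average n S Q = mat_average n S (\<lambda>g. A * Q g)"
proof (rule eq_matI)
  fix i j assume "i < dim_row (mat_average n S (\<lambda>g. A * Q g))" "j < dim_col (mat_average n S (\<lambda>g. A * Q g))"
  then have ij: "i < n" "j < n" by (auto simp: mat_average_def)
  have "(A * mat_average n S Q) $$ (i, j) = (\<Sum>k<n. \<Sum>g\<in>S. A $$ (i, k) * Q g $$ (k, j) / of_nat (card S))"
    using assms(1) ij by (simp add: mat_average_def scalar_prod_def atLeast0LessThan sum_divide_distrib sum_distrib_left)
  also have "\<dots> = (\<Sum>g\<in>S. (\<Sum>k<n. A $$ (i, k) * Q g $$ (k, j))) / of_nat (card S)"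
    by (subst sum.swap) (simp add: sum_divide_distrib)
  also have "\<dots> = (\<Sum>g\<in>S. (A * Q g) $$ (i, j)) / of_nat (card S)"
  proof -
    have "(\<Sum>k<n. A $$ (i, k) * Q g $$ (k, j)) = (A * Q g) $$ (i, j)" if "g \<in> S" for g
      using assms(1) assms(2)[OF that] ij by (simp add: scalar_prod_def atLeast0LessThan)
    then show ?thesis by simp
  qed
  finally show "(A * mat_average n S Q) $$ (i, j) = mat_average n S (\<lambda>g. A * Q g) $$ (i, j)"
    using ij by (simp add: mat_average_def)
qed (use assms in \<open>auto simp: mat_average_def\<close>)

lemma mat_average_mult:
  assumes "A \<in> carrier_mat n n" and "\<And>g. g \<in> S \<Longrightarrow> Q g \<in> carrier_mat n n"
  shows "mat_average n S Q * A = mat_average n S (\<lambda>g. Q g * A)"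
proof (rule eq_matI)
  fix i j assume "i < dim_row (mat_average n S (\<lambda>g. Q g * A))" "j < dim_col (mat_average n S (\<lambda>g. Q g * A))"
  then have ij: "i < n" "j < n" by (auto simp: mat_average_def)
  have "(mat_average n S Q * A) $$ (i, j) = (\<Sum>k<n. \<Sum>g\<in>S. Q g $$ (i, k) * A $$ (k, j) / of_nat (card S))"
    using assms(1) ij by (simp add: mat_average_def scalar_prod_def atLeast0LessThan sum_divide_distrib sum_distrib_right)
  also have "\<dots> = (\<Sum>g\<in>S. (\<Sum>k<n. Q g $$ (i, k) * A $$ (k, j))) / of_nat (card S)"
    by (subst sum.swap) (simp add: sum_divide_distrib)
  also have "\<dots> = (\<Sum>g\<in>S. (Q g * A) $$ (i, j)) / of_nat (card S)"
  proof -
    have "(\<Sum>k<n. Q g $$ (i, k) * A $$ (k, j)) = (Q g * A) $$ (i, j)" if "g \<in> S" for g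
      using assms(1) assms(2)[OF that] ij by (simp add: scalar_prod_def atLeast0LessThan)
    then show ?thesis by simp
  qed
  finally show "(mat_average n S Q * A) $$ (i, j) = mat_average n S (\<lambda>g. Q g * A) $$ (i, j)"
    using ij by (simp add: mat_average_def)
qed (use assms in \<open>auto simp: mat_average_def\<close>)

text \<open>Start from a projection \<open>P0\<close> onto \<open>W\<close> and average its
  conjugates \<open>Q g\<close>. Since \<open>W\<close> is invariant, each conjugate maps into
  \<open>W\<close> and fixes it pointwise, and the average inherits both properties; it is therefore
  an idempotent with range \<open>W\<close>. Stating the result as a commuting idempotent lets
  \<open>P\<close> and \<open>1\<^sub>m n - P\<close> be treated in the same way later.\<close>

lemma maschke:
  fixes G :: "'g monoid" (structure)
  assumes G: "group G" and fin: "finite (carrier G)" and \<rho>: "representation G n \<rho>"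
    and W: "linear_subspace n W" and W_inv: "\<forall>g\<in>carrier G. \<forall>w\<in>W. \<rho> g *\<^sub>v w \<in> W"
    and nz: "W \<noteq> {0\<^sub>v n}" and nall: "W \<noteq> carrier_vec n"
  shows "\<exists>P\<in>carrier_mat n n. P * P = P \<and> P \<noteq> 0\<^sub>m n n \<and> P \<noteq> 1\<^sub>m n \<and>
           (\<forall>g\<in>carrier G. \<rho> g * P = P * \<rho> g)"
proof -
  interpret group G by fact
  note [simp] = representation_carrier[OF \<rho>] mult_carrier_mat[of _ n n _ n] mult_mat_vec_carrier[of _ n n]
  obtain r A B where AB: "A \<in> carrier_mat n r" "B \<in> carrier_mat r n" "B * A = 1\<^sub>m r"
    "\<forall>v\<in>carrier_vec r. A *\<^sub>v v \<in> W" "\<forall>w\<in>W. A *\<^sub>v (B *\<^sub>v w) = w"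
    by (rule linear_subspace_coordinates[OF W])
  define P0 where "P0 = A * B"
  have P0c [simp]: "P0 \<in> carrier_mat n n" using AB by (simp add: P0_def)
  have P0W: "P0 *\<^sub>v v \<in> W" if "v \<in> carrier_vec n" for v
    using AB that by (simp add: P0_def)
  have Wn: "w \<in> carrier_vec n" if "w \<in> W" for w using W that by (auto simp: linear_subspace_def)
  have P0fix: "P0 *\<^sub>v w = w" if "w \<in> W" for w
    using AB that Wn[OF that] by (simp add: P0_def)
  define Q where "Q g = \<rho> g * (P0 * \<rho> (inv g))" for g
  have Qc [simp]: "g \<in> carrier G \<Longrightarrow> Q g \<in> carrier_mat n n" for g by (auto simp: Q_def)
  have P0Q: "P0 * Q g = Q g" if g: "g \<in> carrier G" for g
  proof (rule mult_mat_vec_eq_imp_eq[of _ n n])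
    fix v :: "complex vec" assume v: "v \<in> carrier_vec n"
    have "Q g *\<^sub>v v = \<rho> g *\<^sub>v (P0 *\<^sub>v (\<rho> (inv g) *\<^sub>v v))"
      using g v by (simp add: Q_def assoc_mult_mat_vec[of _ n n _ n])
    also have "\<dots> \<in> W" using g v by (intro W_inv[rule_format] P0W) auto
    finally show "(P0 * Q g) *\<^sub>v v = Q g *\<^sub>v v"
      using g v by (simp add: assoc_mult_mat_vec[of _ n n _ n] P0fix)
  qed (rule mult_carrier_mat[OF P0c Qc[OF g]], rule Qc[OF g])
  have QP0: "Q g * P0 = P0" if g: "g \<in> carrier G" for g
  proof (rule mult_mat_vec_eq_imp_eq[of _ n n])
    fix v :: "complex vec" assume v: "v \<in> carrier_vec n"
    define w where "w = P0 *\<^sub>v v"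
    have w: "w \<in> W" "w \<in> carrier_vec n" using v P0W Wn by (auto simp: w_def)
    have "Q g *\<^sub>v w = \<rho> g *\<^sub>v (P0 *\<^sub>v (\<rho> (inv g) *\<^sub>v w))"
      using g w by (simp add: Q_def assoc_mult_mat_vec[of _ n n _ n])
    also have "P0 *\<^sub>v (\<rho> (inv g) *\<^sub>v w) = \<rho> (inv g) *\<^sub>v w"
      using g w by (intro P0fix W_inv[rule_format]) auto
    also have "\<rho> g *\<^sub>v (\<rho> (inv g) *\<^sub>v w) = (\<rho> g * \<rho> (inv g)) *\<^sub>v w"
      using g w by (simp add: assoc_mult_mat_vec[of _ n n _ n])
    also have "\<rho> g * \<rho> (inv g) = 1\<^sub>m n"
      using g representation_mult[OF \<rho>, of g "inv g"] representation_one[OF G \<rho>] by simp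
    finally show "(Q g * P0) *\<^sub>v v = P0 *\<^sub>v v"
      using g v w by (simp add: assoc_mult_mat_vec[of _ n n _ n] w_def)
  qed (rule mult_carrier_mat[OF Qc[OF g] P0c], rule P0c)
  define P where "P = mat_average n (carrier G) Q"
  have Pc [simp]: "P \<in> carrier_mat n n" by (simp add: P_def)
  have ne: "carrier G \<noteq> {}" by auto
  have P0P: "P0 * P = P"
    unfolding P_def by (subst mult_mat_average) (auto simp: P0Q intro: mat_average_cong)
  have "P * P0 = mat_average n (carrier G) (\<lambda>_. P0)"
    unfolding P_def by (subst mat_average_mult) (auto simp: QP0 intro: mat_average_cong)
  then have PP0: "P * P0 = P0" using fin ne by (simp add: mat_average_const)
  have "P * P = P * (P0 * P)" by (simp add: P0P)
  also have "\<dots> = P * P0 * P" by (simp add: assoc_mult_mat[of P n n P0 n P n])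
  finally have idem: "P * P = P" by (simp add: PP0 P0P)
  \<comment> \<open>Conjugating \<open>Q g\<close> by \<open>\<rho> k\<close> gives
    \<open>Q (k \<otimes> g)\<close>, so commuting reduces to a translation of the summation
    index.\<close>
  have comm: "\<rho> k * P = P * \<rho> k" if k: "k \<in> carrier G" for k
  proof -
    have eq: "\<rho> k * Q g = Q (k \<otimes> g) * \<rho> k" if g: "g \<in> carrier G" for g
    proof -
      have "Q (k \<otimes> g) * \<rho> k = \<rho> (k \<otimes> g) * (P0 * (\<rho> (inv (k \<otimes> g)) * \<rho> k))"
        using k g by (simp add: Q_def assoc_mult_mat[of _ n n _ n _ n])
      also have "\<rho> (inv (k \<otimes> g)) * \<rho> k = \<rho> (inv g)"
        using k g by (simp add: representation_mult[OF \<rho>, symmetric] inv_mult_group m_assoc)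
      also have "\<rho> (k \<otimes> g) = \<rho> k * \<rho> g" using k g by (simp add: representation_mult[OF \<rho>])
      finally show ?thesis using k g by (simp add: Q_def assoc_mult_mat[of _ n n _ n _ n])
    qed
    have "\<rho> k * P = mat_average n (carrier G) (\<lambda>g. Q (k \<otimes> g) * \<rho> k)"
      unfolding P_def using k by (subst mult_mat_average) (auto simp: eq intro: mat_average_cong)
    also have "\<dots> = mat_average n (carrier G) (\<lambda>g. Q (k \<otimes> g)) * \<rho> k"
      using k by (subst mat_average_mult) auto
    also have "mat_average n (carrier G) (\<lambda>g. Q (k \<otimes> g)) = P"
    proof -
      have bij: "bij_betw (\<lambda>g. k \<otimes> g) (carrier G) (carrier G)"
        using k by (auto simp: bij_betw_def inj_on_cmult surj_const_mult)
      have "(\<Sum>g\<in>carrier G. Q (k \<otimes> g) $$ (i, j)) = (\<Sum>g\<in>carrier G. Q g $$ (i, j))" for i j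
        by (rule sum.reindex_bij_betw[OF bij])
      then show ?thesis by (simp add: P_def mat_average_def)
    qed
    finally show ?thesis .
  qed
  \<comment> \<open>The two extremes would make \<open>P0\<close> zero or the identity, hence
    \<open>W\<close> zero or everything.\<close>
  have "P \<noteq> 0\<^sub>m n n"
  proof
    assume "P = 0\<^sub>m n n"
    then have "P0 = 0\<^sub>m n n" using PP0 left_mult_zero_mat[OF P0c] by metis
    then have "w = 0\<^sub>v n" if "w \<in> W" for w
      using P0fix[OF that] zero_mult_mat_vec[OF Wn[OF that], of n] by simp
    moreover have "0\<^sub>v n \<in> W" using W by (simp add: linear_subspace_def)
    ultimately show False using nz by blast
  qed
  moreover have "P \<noteq> 1\<^sub>m n"
  proof
    assume "P = 1\<^sub>m n"
    then have "P0 = 1\<^sub>m n" using right_mult_one_mat[OF P0c] P0P by simp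
    then have "v \<in> W" if "v \<in> carrier_vec n" for v using P0W[OF that] that by simp
    then show False using Wn nall by blast
  qed
  ultimately show ?thesis using idem comm by (intro bexI[of _ P]) auto
qed

text \<open>The action on the range of \<open>P\<close>, written in the coordinates given by
  \<open>P = A * B\<close>: \<open>\<sigma> g = B * (\<rho> g * A)\<close>. It is multiplicative
  because \<open>P\<close> commutes with the action. The last two clauses keep track of the
  dimension for the induction on it.\<close>

lemma representation_compress:
  fixes G :: "'g monoid" (structure)
  assumes G: "group G" and \<rho>: "representation G n \<rho>"
    and P: "P \<in> carrier_mat n n" "P * P = P" and comm: "\<And>g. g \<in> carrier G \<Longrightarrow> \<rho> g * P = P * \<rho> g"
  obtains r \<sigma> where "representation G r \<sigma>" "\<forall>g\<in>carrier G. mat_trace (\<sigma> g) = mat_trace (\<rho> g * P)"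
    "of_nat r = mat_trace P" "r = 0 \<longrightarrow> P = 0\<^sub>m n n"
proof -
  interpret group G by fact
  note [simp] = representation_carrier[OF \<rho>]
  obtain r A B where AB [simp]: "A \<in> carrier_mat n r" "B \<in> carrier_mat r n"
    and BA: "B * A = 1\<^sub>m r" and ABP: "A * B = P"
    by (rule idempotent_factorization[OF P])
  note [simp] = mult_carrier_mat[of _ n n _ r] mult_carrier_mat[of _ r n _ r] mult_carrier_mat[of _ r n _ n] mult_carrier_mat[of _ n r _ n]
  define \<sigma> where "\<sigma> g = B * (\<rho> g * A)" for g
  have "representation G r \<sigma>"
  proof (rule representationI[OF G])
    fix g k assume g: "g \<in> carrier G" and k: "k \<in> carrier G"
    have PA: "P * A = A"
      unfolding ABP[symmetric] using BA by (simp add: assoc_mult_mat[of A n r B n A r] right_mult_one_mat[OF AB(1)])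
    have "\<sigma> g * \<sigma> k = B * (\<rho> g * ((A * B) * (\<rho> k * A)))"
      using g k by (simp add: \<sigma>_def assoc_mult_mat[of B r n _ r _ r] assoc_mult_mat[of "\<rho> g" n n _ r _ r] assoc_mult_mat[of A n r _ n _ r])
    also have "(A * B) * (\<rho> k * A) = (P * \<rho> k) * A"
      unfolding ABP using P k by (simp add: assoc_mult_mat[of P n n "\<rho> k" n A r])
    also have "\<dots> = \<rho> k * (P * A)"
      using P k by (simp add: comm[symmetric] assoc_mult_mat[of "\<rho> k" n n P n A r])
    also have "\<rho> g * (\<rho> k * (P * A)) = \<rho> (g \<otimes> k) * A"
      using g k by (simp add: PA representation_mult[OF \<rho>] assoc_mult_mat[of "\<rho> g" n n "\<rho> k" n A r])
    finally show "\<sigma> (g \<otimes> k) = \<sigma> g * \<sigma> k" by (simp add: \<sigma>_def)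
  next
    show "\<sigma> \<one> = 1\<^sub>m r" using BA by (simp add: \<sigma>_def representation_one[OF G \<rho>] left_mult_one_mat[of A n r])
  qed (simp add: \<sigma>_def mult_carrier_mat[of B r n _ r] mult_carrier_mat[of _ n n A r])
  moreover have "\<forall>g\<in>carrier G. mat_trace (\<sigma> g) = mat_trace (\<rho> g * P)"
  proof
    fix g assume g: "g \<in> carrier G"
    have "mat_trace (\<sigma> g) = mat_trace ((\<rho> g * A) * B)"
      unfolding \<sigma>_def using g by (intro mat_trace_comm[of B r n]) (auto intro: mult_carrier_mat)
    also have "(\<rho> g * A) * B = \<rho> g * P"
      using g by (simp add: ABP[symmetric] assoc_mult_mat[of "\<rho> g" n n A r B n])
    finally show "mat_trace (\<sigma> g) = mat_trace (\<rho> g * P)" .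
  qed
  moreover have "of_nat r = mat_trace P"
    using mat_trace_comm[OF AB] by (simp add: ABP BA mat_trace_one)
  moreover have "r = 0 \<longrightarrow> P = 0\<^sub>m n n"
    unfolding ABP[symmetric] using carrier_matD[OF AB(1)] carrier_matD[OF AB(2)]
    by (intro impI eq_matI) (auto simp: scalar_prod_def)
  ultimately show thesis by (rule that)
qed

section \<open>Effective characters and complete reducibility\<close>

lemma effective_character_cong:
  "(\<And>g. g \<in> carrier G \<Longrightarrow> \<chi> g = \<psi> g) \<Longrightarrow> effective_character G \<chi> \<longleftrightarrow> effective_character G \<psi>"
  by (simp add: effective_character_def)

lemma effective_character_zero: "effective_character G (\<lambda>_. 0)"
  unfolding effective_character_def by (intro exI[of _ "{}"]) auto

lemma effective_character_add:
  assumes "effective_character G \<chi>" and "effective_character G \<psi>"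
  shows "effective_character G (\<lambda>g. \<chi> g + \<psi> g)"
proof -
  from assms(1)[unfolded effective_character_def]
  obtain X c where X: "finite X" "\<forall>\<theta>\<in>X. irreducible_character G \<theta>"
    "\<forall>g\<in>carrier G. \<chi> g = (\<Sum>\<theta>\<in>X. of_nat (c \<theta>) * \<theta> g)"
    by (elim exE conjE)
  from assms(2)[unfolded effective_character_def]
  obtain Y d where Y: "finite Y" "\<forall>\<theta>\<in>Y. irreducible_character G \<theta>"
    "\<forall>g\<in>carrier G. \<psi> g = (\<Sum>\<theta>\<in>Y. of_nat (d \<theta>) * \<theta> g)"
    by (elim exE conjE)
  \<comment> \<open>Multiplicity 0 outside \<open>X\<close> or \<open>Y\<close> lets both sums run
    over the union, where the two sets of irreducible characters may overlap.\<close>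
  define e where "e \<theta> = (if \<theta> \<in> X then c \<theta> else 0) + (if \<theta> \<in> Y then d \<theta> else 0)" for \<theta>
  have "\<forall>g\<in>carrier G. \<chi> g + \<psi> g = (\<Sum>\<theta>\<in>X \<union> Y. of_nat (e \<theta>) * \<theta> g)"
  proof
    fix g assume g: "g \<in> carrier G"
    have "\<chi> g = (\<Sum>\<theta>\<in>X \<union> Y. of_nat (if \<theta> \<in> X then c \<theta> else 0) * \<theta> g)"
      unfolding X(3)[rule_format, OF g] using X(1) Y(1) by (intro sum.mono_neutral_cong_left) auto
    moreover have "\<psi> g = (\<Sum>\<theta>\<in>X \<union> Y. of_nat (if \<theta> \<in> Y then d \<theta> else 0) * \<theta> g)"
      unfolding Y(3)[rule_format, OF g] using X(1) Y(1) by (intro sum.mono_neutral_cong_left) auto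
    ultimately show "\<chi> g + \<psi> g = (\<Sum>\<theta>\<in>X \<union> Y. of_nat (e \<theta>) * \<theta> g)"
      by (simp only: e_def of_nat_add distrib_right sum.distrib)
  qed
  moreover have "finite (X \<union> Y)" "\<forall>\<theta>\<in>X \<union> Y. irreducible_character G \<theta>"
    using X(1,2) Y(1,2) by auto
  ultimately show ?thesis unfolding effective_character_def
    by (intro exI[of _ "X \<union> Y"] exI[of _ e] conjI)
qed

lemma idempotent_complement:
  fixes P :: "'r :: comm_ring_1 mat"
  assumes P: "P \<in> carrier_mat n n" "P * P = P"
  shows "(1\<^sub>m n - P) * (1\<^sub>m n - P) = 1\<^sub>m n - P"
proof -
  have P': "1\<^sub>m n - P \<in> carrier_mat n n" using P by (simp add: minus_carrier_mat)
  have minus_zero: "X - 0\<^sub>m n n = X" if "X \<in> carrier_mat n n" for X :: "'r mat"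
    using that by (intro eq_matI) auto
  have "(1\<^sub>m n - P) * (1\<^sub>m n - P) = (1\<^sub>m n - P) * 1\<^sub>m n - (1\<^sub>m n - P) * P"
    by (rule mult_minus_distrib_mat[OF P' one_carrier_mat P(1)])
  also have "(1\<^sub>m n - P) * P = 1\<^sub>m n * P - P * P"
    by (rule minus_mult_distrib_mat[OF one_carrier_mat P(1) P(1)])
  also have "\<dots> = 0\<^sub>m n n" using P by (simp add: left_mult_one_mat[OF P(1)] minus_r_inv_mat[OF P(1)])
  also have "(1\<^sub>m n - P) * 1\<^sub>m n - 0\<^sub>m n n = 1\<^sub>m n - P"
    unfolding right_mult_one_mat[OF P'] by (rule minus_zero[OF P'])
  finally show ?thesis .
qed

text \<open>Complete reducibility by induction on the dimension: a reducible representation splits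
  along a commuting idempotent \<open>P\<close> and its complement, and the traces of the two
  compressions add up to the original trace.\<close>

theorem effective_character_of_representation:
  fixes G :: "'g monoid" (structure)
  assumes G: "group G" and fin: "finite (carrier G)" and \<rho>: "representation G n \<rho>"
  shows "effective_character G (\<lambda>g. mat_trace (\<rho> g))"
  using \<rho>
proof (induction n arbitrary: \<rho> rule: less_induct)
  case (less n)
  note \<rho> = less.prems
  interpret group G by fact
  note [simp] = representation_carrier[OF \<rho>]
  consider "n = 0" | "n \<noteq> 0" "irreducible_representation G n \<rho>" | "n \<noteq> 0" "\<not> irreducible_representation G n \<rho>"
    by blast
  then show ?case
  proof cases
    \<comment> \<open>Dimension 0 is not irreducible by definition; its character is the empty
      sum.\<close>
    case 1
    have "0 = mat_trace (\<rho> g)" if "g \<in> carrier G" for g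
    proof -
      have "dim_row (\<rho> g) = 0" using representation_carrier[OF \<rho> that] 1 by auto
      then show ?thesis by (simp add: mat_trace_def)
    qed
    then show ?thesis
      by (rule effective_character_cong[THEN iffD1, OF _ effective_character_zero])
  next
    case 2
    have "irreducible_character G (\<lambda>g. mat_trace (\<rho> g))"
      unfolding irreducible_character_def
    proof (intro exI conjI ballI)
      show "irreducible_representation G n \<rho>" by fact
      fix g assume "g \<in> carrier G"
      then have "dim_row (\<rho> g) = n" using representation_carrier[OF \<rho>] by blast
      then show "mat_trace (\<rho> g) = (\<Sum>i<n. \<rho> g $$ (i, i))" by (simp add: mat_trace_def)
    qed
    then show ?thesis unfolding effective_character_def
      by (intro exI[of _ "{\<lambda>g. mat_trace (\<rho> g)}"] exI[of _ "\<lambda>_. 1"]) auto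
  next
    case 3
    then obtain W where W: "VectorSpace.subspace class_ring W (module_vec TYPE(complex) n)"
      "\<forall>g\<in>carrier G. \<forall>w\<in>W. \<rho> g *\<^sub>v w \<in> W" "W \<noteq> {0\<^sub>v n}" "W \<noteq> carrier_vec n"
      using \<rho> by (auto simp: irreducible_representation_def)
    obtain P where P [simp]: "P \<in> carrier_mat n n" and idem: "P * P = P" and P01: "P \<noteq> 0\<^sub>m n n" "P \<noteq> 1\<^sub>m n"
      and comm: "\<And>g. g \<in> carrier G \<Longrightarrow> \<rho> g * P = P * \<rho> g"
    proof -
      from maschke[OF G fin \<rho> linear_subspace_of_subspace[OF W(1)] W(2-4)]
      obtain P where "P \<in> carrier_mat n n" "P * P = P" "P \<noteq> 0\<^sub>m n n" "P \<noteq> 1\<^sub>m n"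
        "\<forall>g\<in>carrier G. \<rho> g * P = P * \<rho> g" by (elim bexE conjE)
      then show thesis by (intro that[of P]) simp_all
    qed
    define P' where "P' = 1\<^sub>m n - P"
    have P' [simp]: "P' \<in> carrier_mat n n" by (simp add: P'_def minus_carrier_mat)
    have comm': "\<rho> g * P' = P' * \<rho> g" if g: "g \<in> carrier G" for g
    proof -
      have c: "\<rho> g \<in> carrier_mat n n" using g by simp
      have "\<rho> g * P' = \<rho> g * 1\<^sub>m n - \<rho> g * P"
        unfolding P'_def by (rule mult_minus_distrib_mat[OF c one_carrier_mat P])
      moreover have "P' * \<rho> g = 1\<^sub>m n * \<rho> g - P * \<rho> g"
        unfolding P'_def by (rule minus_mult_distrib_mat[OF one_carrier_mat P c])
      ultimately show ?thesis
        unfolding right_mult_one_mat[OF c] left_mult_one_mat[OF c] comm[OF g] by (rule trans[OF _ sym])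
    qed
    have PP': "P + P' = 1\<^sub>m n" unfolding P'_def using carrier_matD[OF P] by (intro eq_matI) auto
    obtain r \<sigma> where \<sigma>: "representation G r \<sigma>" "\<forall>g\<in>carrier G. mat_trace (\<sigma> g) = mat_trace (\<rho> g * P)"
      "of_nat r = mat_trace P" "r = 0 \<longrightarrow> P = 0\<^sub>m n n"
      by (rule representation_compress[OF G \<rho> P idem comm])
    obtain r' \<sigma>' where \<sigma>': "representation G r' \<sigma>'" "\<forall>g\<in>carrier G. mat_trace (\<sigma>' g) = mat_trace (\<rho> g * P')"
      "of_nat r' = mat_trace P'" "r' = 0 \<longrightarrow> P' = 0\<^sub>m n n"
      by (rule representation_compress[OF G \<rho> P' idempotent_complement[OF P idem, folded P'_def] comm'])
    \<comment> \<open>Dimensions are compared through traces, which are complex numbers; the cast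
      from the naturals is injective.\<close>
    have "of_nat (r + r') = (of_nat n :: complex)"
      using mat_trace_add[OF P P'] by (simp add: PP' mat_trace_one \<sigma>(3) \<sigma>'(3))
    then have rr': "r + r' = n" by (simp only: of_nat_eq_iff)
    have "r \<noteq> 0" using \<sigma>(4) P01(1) by blast
    moreover have "r' \<noteq> 0"
    proof
      assume "r' = 0"
      then have "P' = 0\<^sub>m n n" using \<sigma>'(4) by blast
      then have "P = 1\<^sub>m n" using PP' right_add_zero_mat[OF P] by simp
      then show False using P01(2) by blast
    qed
    ultimately have "r < n" "r' < n" using rr' by auto
    then have "effective_character G (\<lambda>g. mat_trace (\<sigma> g) + mat_trace (\<sigma>' g))"
      using less.IH \<sigma>(1) \<sigma>'(1) by (intro effective_character_add) auto
    moreover have "mat_trace (\<sigma> g) + mat_trace (\<sigma>' g) = mat_trace (\<rho> g)" if g: "g \<in> carrier G" for g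
    proof -
      have "mat_trace (\<sigma> g) + mat_trace (\<sigma>' g) = mat_trace (\<rho> g * P + \<rho> g * P')"
        using g mat_trace_add[of "\<rho> g * P" n "\<rho> g * P'"]
        by (simp add: \<sigma>(2) \<sigma>'(2) mult_carrier_mat[of _ n n])
      also have "\<rho> g * P + \<rho> g * P' = \<rho> g * (P + P')"
        using g P P' by (intro mult_add_distrib_mat[of _ n n _ n, symmetric]) auto
      finally show ?thesis using g by (simp add: PP' right_mult_one_mat[of _ n n])
    qed
    ultimately show ?thesis by (rule effective_character_cong[THEN iffD1, rotated])
  qed
qed

section \<open>Permutation characters\<close>

text \<open>The laws are required on \<open>Z\<close> only, so that maps defined beyond
  \<open>Z\<close>, where the laws may fail, can serve as actions.\<close>

locale finite_action = group G for G :: "'g monoid" (structure) +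
  fixes Z :: "'z set" and act :: "'g \<Rightarrow> 'z \<Rightarrow> 'z"
  assumes finite_carrier: "finite (carrier G)"
    and finite_points: "finite Z"
    and act_closed: "g \<in> carrier G \<Longrightarrow> z \<in> Z \<Longrightarrow> act g z \<in> Z"
    and act_one: "z \<in> Z \<Longrightarrow> act \<one> z = z"
    and act_mult: "g \<in> carrier G \<Longrightarrow> k \<in> carrier G \<Longrightarrow> z \<in> Z \<Longrightarrow> act (g \<otimes> k) z = act g (act k z)"
begin

lemma act_inv_act: "g \<in> carrier G \<Longrightarrow> z \<in> Z \<Longrightarrow> act (inv g) (act g z) = z"
  using act_mult[of "inv g" g z] by (simp add: act_one)

lemma act_act_inv: "g \<in> carrier G \<Longrightarrow> z \<in> Z \<Longrightarrow> act g (act (inv g) z) = z"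
  using act_mult[of g "inv g" z] by (simp add: act_one)

lemma act_eq_iff:
  "g \<in> carrier G \<Longrightarrow> z \<in> Z \<Longrightarrow> w \<in> Z \<Longrightarrow> act g w = z \<longleftrightarrow> w = act (inv g) z"
  using act_inv_act act_act_inv by metis

definition enum :: "nat \<Rightarrow> 'z" where
  "enum = (SOME e. bij_betw e {..<card Z} Z)"

lemma bij_enum: "bij_betw enum {..<card Z} Z"
proof -
  have "\<exists>e. bij_betw e {..<card Z} Z"
    using ex_bij_betw_nat_finite[OF finite_points] by (auto simp: atLeast0LessThan)
  then show ?thesis unfolding enum_def by (rule someI_ex)
qed

text \<open>Matrices indexed by the points of \<open>Z\<close> through the arbitrary numbering
  \<open>enum\<close>; products and traces then become sums over \<open>Z\<close>, in which the
  numbering no longer appears.\<close>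

definition kernel_mat :: "('z \<Rightarrow> 'z \<Rightarrow> complex) \<Rightarrow> complex mat" where
  "kernel_mat f = mat (card Z) (card Z) (\<lambda>(i, j). f (enum i) (enum j))"

lemma kernel_mat_carrier: "kernel_mat f \<in> carrier_mat (card Z) (card Z)"
  by (simp add: kernel_mat_def)

lemma enum_mem: "i < card Z \<Longrightarrow> enum i \<in> Z"
  using bij_enum by (auto dest: bij_betwE)

lemma kernel_mat_cong:
  "(\<And>a b. a \<in> Z \<Longrightarrow> b \<in> Z \<Longrightarrow> f a b = h a b) \<Longrightarrow> kernel_mat f = kernel_mat h"
  by (auto simp: kernel_mat_def enum_mem)

lemma kernel_mat_mult:
  "kernel_mat f * kernel_mat h = kernel_mat (\<lambda>a b. \<Sum>c\<in>Z. f a c * h c b)"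
proof (rule eq_matI)
  fix i j assume "i < dim_row (kernel_mat (\<lambda>a b. \<Sum>c\<in>Z. f a c * h c b))"
    "j < dim_col (kernel_mat (\<lambda>a b. \<Sum>c\<in>Z. f a c * h c b))"
  then have ij: "i < card Z" "j < card Z" by (auto simp: kernel_mat_def)
  have "(\<Sum>k<card Z. f (enum i) (enum k) * h (enum k) (enum j)) = (\<Sum>c\<in>Z. f (enum i) c * h c (enum j))"
    by (rule sum.reindex_bij_betw[OF bij_enum])
  then show "(kernel_mat f * kernel_mat h) $$ (i, j) = kernel_mat (\<lambda>a b. \<Sum>c\<in>Z. f a c * h c b) $$ (i, j)"
    using ij by (simp add: kernel_mat_def scalar_prod_def atLeast0LessThan)
qed (auto simp: kernel_mat_def)

lemma kernel_mat_trace: "mat_trace (kernel_mat f) = (\<Sum>a\<in>Z. f a a)"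
proof -
  have "mat_trace (kernel_mat f) = (\<Sum>i<card Z. f (enum i) (enum i))"
    by (simp add: mat_trace_def kernel_mat_def)
  also have "\<dots> = (\<Sum>a\<in>Z. f a a)" by (rule sum.reindex_bij_betw[OF bij_enum])
  finally show ?thesis .
qed

lemma kernel_mat_one: "kernel_mat (\<lambda>a b. if a = b then 1 else 0) = 1\<^sub>m (card Z)"
  using bij_betw_imp_inj_on[OF bij_enum]
  by (intro eq_matI) (auto simp: kernel_mat_def inj_on_eq_iff)

definition perm_mat :: "'g \<Rightarrow> complex mat" where
  "perm_mat g = kernel_mat (\<lambda>a b. if act g b = a then 1 else 0)"

lemma perm_mat_mult_kernel:
  assumes g: "g \<in> carrier G"
  shows "perm_mat g * kernel_mat h = kernel_mat (\<lambda>a b. h (act (inv g) a) b)"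
  unfolding perm_mat_def kernel_mat_mult
proof (rule kernel_mat_cong)
  fix a b assume a: "a \<in> Z"
  have "(\<Sum>c\<in>Z. (if act g c = a then 1 else 0) * h c b) = (\<Sum>c\<in>Z. if c = act (inv g) a then h c b else 0)"
    using a g by (intro sum.cong) (auto simp: act_eq_iff)
  also have "\<dots> = h (act (inv g) a) b" using a g finite_points act_closed[of "inv g" a] by simp
  finally show "(\<Sum>c\<in>Z. (if act g c = a then 1 else 0) * h c b) = h (act (inv g) a) b" .
qed

lemma kernel_mult_perm_mat:
  assumes g: "g \<in> carrier G"
  shows "kernel_mat h * perm_mat g = kernel_mat (\<lambda>a b. h a (act g b))"
  unfolding perm_mat_def kernel_mat_mult
proof (rule kernel_mat_cong)
  fix a b assume b: "b \<in> Z"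
  have "(\<Sum>c\<in>Z. h a c * (if act g b = c then 1 else 0)) = (\<Sum>c\<in>Z. if act g b = c then h a c else 0)"
    by (intro sum.cong) auto
  also have "\<dots> = h a (act g b)" using b g finite_points act_closed[of g b] by simp
  finally show "(\<Sum>c\<in>Z. h a c * (if act g b = c then 1 else 0)) = h a (act g b)" .
qed

lemma perm_mat_representation: "representation G (card Z) perm_mat"
proof (rule representationI)
  show "group G" by unfold_locales
  show "perm_mat g \<in> carrier_mat (card Z) (card Z)" for g
    by (simp add: perm_mat_def kernel_mat_carrier)
  show "perm_mat (g \<otimes> k) = perm_mat g * perm_mat k" if "g \<in> carrier G" "k \<in> carrier G" for g k
    unfolding perm_mat_mult_kernel[OF that(1)] perm_mat_def[of k] perm_mat_def[of "g \<otimes> k"]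
  proof (rule kernel_mat_cong)
    fix a b assume ab: "a \<in> Z" "b \<in> Z"
    show "(if act (g \<otimes> k) b = a then 1 else (0 :: complex)) = (if act k b = act (inv g) a then 1 else 0)"
      using that ab act_closed by (simp add: act_mult act_eq_iff)
  qed
  have "perm_mat \<one> = kernel_mat (\<lambda>a b. if a = b then 1 else 0)"
    unfolding perm_mat_def by (rule kernel_mat_cong) (auto simp: act_one)
  then show "perm_mat \<one> = 1\<^sub>m (card Z)" by (simp add: kernel_mat_one)
qed

lemma perm_mat_trace:
  "g \<in> carrier G \<Longrightarrow> mat_trace (perm_mat g) = of_nat (card {z \<in> Z. act g z = z})"
  using finite_points by (simp add: perm_mat_def kernel_mat_trace sum.If_cases Int_def)

text \<open>Averaging over the fibres of \<open>p\<close> is an invariant idempotent whose range is the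
  permutation representation on \<open>X\<close>; the complementary idempotent affords the difference.\<close>

theorem permutation_character_le:
  assumes Y: "Y \<subseteq> Z" and Y_act: "\<And>g y. g \<in> carrier G \<Longrightarrow> y \<in> Y \<Longrightarrow> act g y \<in> Y"
    and X: "p ` Y = X" and equiv: "\<And>g y. g \<in> carrier G \<Longrightarrow> y \<in> Y \<Longrightarrow> p (act g y) = act' g (p y)"
  shows "character_le G (\<lambda>g. of_nat (card {x \<in> X. act' g x = x})) (\<lambda>g. of_nat (card {z \<in> Z. act g z = z}))"
proof -
  have finY: "finite Y" using Y finite_points by (rule finite_subset)
  define c where "c a = card {y \<in> Y. p y = p a}" for a
  have c_pos: "c a > 0" if "a \<in> Y" for a
    unfolding c_def using that finY by (subst card_gt_0_iff) auto
  \<comment> \<open>The averaging matrix: it maps a function on \<open>Z\<close> to its mean over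
    the fibre of \<open>p\<close> through the point, and to 0 outside \<open>Y\<close>. Division by
    the size of the fibre makes it idempotent.\<close>
  define q where "q a b = (if a \<in> Y \<and> b \<in> Y \<and> p a = p b then 1 / of_nat (c a) else 0 :: complex)" for a b
  \<comment> \<open>Invariance under inverses makes the complement of \<open>Y\<close> invariant
    too, so that \<open>q\<close> is compatible with the action on all of \<open>Z\<close>.\<close>
  have Y_act_iff: "act g y \<in> Y \<longleftrightarrow> y \<in> Y" if "g \<in> carrier G" "y \<in> Z" for g y
    using Y_act[of "inv g" "act g y"] Y_act[of g y] that by (auto simp: act_inv_act)
  have p_act: "p (act g a) = p (act g b) \<longleftrightarrow> p a = p b"
    if "g \<in> carrier G" "a \<in> Y" "b \<in> Y" for g a b
  proof
    assume "p a = p b" then show "p (act g a) = p (act g b)" using that by (simp add: equiv)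
  next
    assume "p (act g a) = p (act g b)"
    then have "p (act (inv g) (act g a)) = p (act (inv g) (act g b))"
      using that Y_act by (simp add: equiv)
    then show "p a = p b" using that Y by (simp add: act_inv_act subsetD)
  qed
  have c_act: "c (act g a) = c a" if g: "g \<in> carrier G" and a: "a \<in> Y" for g a
  proof -
    have "bij_betw (act g) {y \<in> Y. p y = p a} {y \<in> Y. p y = p (act g a)}"
    proof (rule bij_betw_byWitness[where f' = "act (inv g)"])
      show "act g ` {y \<in> Y. p y = p a} \<subseteq> {y \<in> Y. p y = p (act g a)}"
        using g a Y_act p_act by auto
      show "act (inv g) ` {y \<in> Y. p y = p (act g a)} \<subseteq> {y \<in> Y. p y = p a}"
      proof
        fix w assume "w \<in> act (inv g) ` {y \<in> Y. p y = p (act g a)}"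
        then obtain y where y: "y \<in> Y" "p y = p (act g a)" "w = act (inv g) y" by auto
        have "p w = p (act (inv g) (act g a))" using y g a Y_act p_act[of "inv g" y "act g a"] by simp
        then show "w \<in> {y \<in> Y. p y = p a}" using y g a Y Y_act by (auto simp: act_inv_act)
      qed
    qed (use g Y in \<open>auto simp: act_inv_act act_act_inv\<close>)
    then show ?thesis by (simp only: c_def bij_betw_same_card)
  qed
  have q_act: "q (act g a) (act g b) = q a b" if "g \<in> carrier G" "a \<in> Z" "b \<in> Z" for g a b
    using that by (auto simp: q_def Y_act_iff p_act c_act)
  define Q where "Q = kernel_mat q"
  have Q: "Q \<in> carrier_mat (card Z) (card Z)" unfolding Q_def by (rule kernel_mat_carrier)
  have idem: "Q * Q = Q"
    unfolding Q_def kernel_mat_mult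
  proof (rule kernel_mat_cong)
    fix a b assume "a \<in> Z" "b \<in> Z"
    show "(\<Sum>c\<in>Z. q a c * q c b) = q a b"
    proof (cases "a \<in> Y \<and> b \<in> Y \<and> p a = p b")
      case True
      have "(\<Sum>d\<in>Z. q a d * q d b) = (\<Sum>d\<in>{y \<in> Y. p y = p a}. 1 / of_nat (c a) * (1 / of_nat (c a)))"
        using True Y finite_points by (intro sum.mono_neutral_cong_right) (auto simp: q_def c_def)
      also have "\<dots> = of_nat (c a) * (1 / of_nat (c a) * (1 / of_nat (c a)))" by (simp add: c_def)
      also have "\<dots> = q a b" using True c_pos[of a] by (simp add: q_def)
      finally show ?thesis .
    next
      case False
      then have "q a d * q d b = 0" for d by (auto simp: q_def)
      then show ?thesis using False by (auto simp: q_def)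
    qed
  qed
  have comm: "perm_mat g * Q = Q * perm_mat g" if g: "g \<in> carrier G" for g
    unfolding Q_def perm_mat_mult_kernel[OF g] kernel_mult_perm_mat[OF g]
  proof (rule kernel_mat_cong)
    fix a b assume ab: "a \<in> Z" "b \<in> Z"
    then have "q (act g (act (inv g) a)) (act g b) = q (act (inv g) a) b"
      using g by (intro q_act act_closed) auto
    then show "q (act (inv g) a) b = q a (act g b)" using g ab by (simp add: act_act_inv)
  qed
  \<comment> \<open>A point \<open>a\<close> of \<open>Y\<close> contributes exactly if
    \<open>act g a\<close> stays in its fibre, that is, if \<open>p a\<close> is fixed by
    \<open>act' g\<close>. Over a fixed \<open>x\<close> there are as many contributions as points
    in its fibre, each the inverse of that number.\<close>
  have trQ: "mat_trace (perm_mat g * Q) = of_nat (card {x \<in> X. act' g x = x})" if g: "g \<in> carrier G" for g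
  proof -
    have "mat_trace (perm_mat g * Q) = (\<Sum>a\<in>Z. q a (act g a))"
      unfolding comm[OF g] by (simp add: Q_def kernel_mult_perm_mat[OF g] kernel_mat_trace)
    also have "\<dots> = (\<Sum>a\<in>{y \<in> Y. act' g (p y) = p y}. 1 / of_nat (c a))"
      using Y g finite_points by (intro sum.mono_neutral_cong_right) (auto simp: q_def Y_act_iff equiv)
    also have "\<dots> = (\<Sum>x\<in>{x \<in> X. act' g x = x}. \<Sum>a\<in>{y \<in> {y \<in> Y. act' g (p y) = p y}. p y = x}. 1 / of_nat (c a))"
      using finY X by (intro sum.group[symmetric]) auto
    also have "\<dots> = (\<Sum>x\<in>{x \<in> X. act' g x = x}. 1)"
    proof (rule sum.cong)
      fix x assume x: "x \<in> {x \<in> X. act' g x = x}"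
      then obtain y where y: "y \<in> Y" "p y = x" using X by auto
      have "(\<Sum>a\<in>{y \<in> {y \<in> Y. act' g (p y) = p y}. p y = x}. 1 / complex_of_nat (c a))
          = (\<Sum>a\<in>{a \<in> Y. p a = p y}. 1 / of_nat (c y))"
        using x y by (intro sum.cong) (auto simp: c_def)
      also have "\<dots> = of_nat (c y) * (1 / of_nat (c y))" by (simp add: c_def)
      also have "\<dots> = 1" using c_pos[OF y(1)] by simp
      finally show "(\<Sum>a\<in>{y \<in> {y \<in> Y. act' g (p y) = p y}. p y = x}. 1 / complex_of_nat (c a)) = 1" .
    qed simp
    finally show ?thesis by simp
  qed
  let ?n = "card Z"
  have G: "group G" by unfold_locales
  have P: "1\<^sub>m ?n - Q \<in> carrier_mat ?n ?n" using Q by (simp add: minus_carrier_mat)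
  have R: "perm_mat g \<in> carrier_mat ?n ?n" for g by (simp add: perm_mat_def kernel_mat_carrier)
  have split: "perm_mat g * (1\<^sub>m ?n - Q) = perm_mat g - perm_mat g * Q" for g
    using mult_minus_distrib_mat[OF R one_carrier_mat Q] right_mult_one_mat[OF R] by simp
  have "perm_mat g * (1\<^sub>m ?n - Q) = (1\<^sub>m ?n - Q) * perm_mat g" if g: "g \<in> carrier G" for g
    unfolding split minus_mult_distrib_mat[OF one_carrier_mat Q R] left_mult_one_mat[OF R] comm[OF g] ..
  then obtain r \<sigma> where \<sigma>: "representation G r \<sigma>"
    and tr: "\<forall>g\<in>carrier G. mat_trace (\<sigma> g) = mat_trace (perm_mat g * (1\<^sub>m ?n - Q))"
    by (rule representation_compress[OF G perm_mat_representation P idempotent_complement[OF Q idem]])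
  have "mat_trace (\<sigma> g) = of_nat (card {z \<in> Z. act g z = z}) - of_nat (card {x \<in> X. act' g x = x})"
    if g: "g \<in> carrier G" for g
  proof -
    have "mat_trace (\<sigma> g) = mat_trace (perm_mat g - perm_mat g * Q)" using tr g by (simp add: split)
    also have "\<dots> = mat_trace (perm_mat g) - mat_trace (perm_mat g * Q)"
      using carrier_matD[OF R[of g]] carrier_matD[OF Q] by (simp add: mat_trace_def sum_subtractf)
    finally show ?thesis by (simp only: perm_mat_trace[OF g] trQ[OF g])
  qed
  then show ?thesis unfolding character_le_def
    by (rule effective_character_cong[THEN iffD1, OF _ effective_character_of_representation[OF G finite_carrier \<sigma>]])
qed

text \<open>The comparison with the zero character, as the case of empty \<open>X\<close> and
  \<open>Y\<close>.\<close>

corollary permutation_character_effective: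
  "effective_character G (\<lambda>g. of_nat (card {z \<in> Z. act g z = z}))"
  using permutation_character_le[of "{}" "\<lambda>z. z" "{}" act] by (simp add: character_le_def)

end

section \<open>The type of a monomial\<close>

text \<open>The exponents in increasing order of their variables. This is the only composition
  \<alpha> for which \<open>m\<close> occurs in \<open>M\<^sub>\<alpha>\<close>.\<close>

definition monomial_type :: "nat multiset \<Rightarrow> nat list" where
  "monomial_type m = map (count m) (sorted_list_of_set (set_mset m))"

lemma finite_compositions: "finite (compositions n)"
proof -
  have "compositions n \<subseteq> {xs. set xs \<subseteq> {..n} \<and> length xs \<le> n}"
  proof
    fix xs assume "xs \<in> compositions n"
    then have pos: "\<forall>a\<in>set xs. a > 0" and sum: "sum_list xs = n" by (auto simp: compositions_def)
    have "length xs \<le> sum_list xs" using pos by (induction xs) auto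
    moreover have "\<And>a. a \<in> set xs \<Longrightarrow> a \<le> n" using sum member_le_sum_list by blast
    ultimately show "xs \<in> {xs. set xs \<subseteq> {..n} \<and> length xs \<le> n}" using sum by auto
  qed
  then show ?thesis by (rule finite_subset) (rule finite_lists_length_le, simp)
qed

lemma monomial_type_compositions: "monomial_type m \<in> compositions (size m)"
proof -
  have "sum_list (monomial_type m) = (\<Sum>x\<in>set_mset m. count m x)"
    unfolding monomial_type_def by (subst sum_list_distinct_conv_sum_set) auto
  then show ?thesis
    by (auto simp: compositions_def monomial_type_def size_multiset_overloaded_eq)
qed

lemma count_sum_replicate:
  assumes "distinct is" and "length is = length \<alpha>" and "j < length \<alpha>"
  shows "count (\<Sum>j<length \<alpha>. replicate_mset (\<alpha> ! j) (is ! j)) (is ! j) = \<alpha> ! j"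
proof -
  have "count (\<Sum>j<length \<alpha>. replicate_mset (\<alpha> ! j) (is ! j)) (is ! j)
      = (\<Sum>k<length \<alpha>. if k = j then \<alpha> ! k else 0)"
    unfolding count_sum using assms by (intro sum.cong) (auto simp: nth_eq_iff_index_eq)
  then show ?thesis using assms by simp
qed

text \<open>Positive parts ensure that every listed variable occurs, so the support recovers the
  variables and the exponents then recover \<alpha>.\<close>

lemma monomial_type_sum_replicate:
  assumes sorted: "sorted_wrt (<) is" and len: "length is = length \<alpha>" and pos: "\<forall>a\<in>set \<alpha>. a > 0"
  defines "m \<equiv> \<Sum>j<length \<alpha>. replicate_mset (\<alpha> ! j) (is ! j)"
  shows "set_mset m = set is" and "monomial_type m = \<alpha>"
proof -
  have dist: "distinct is" using sorted strict_sorted_iff by blast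
  have "set_mset m = (\<Union>j<length \<alpha>. set_mset (replicate_mset (\<alpha> ! j) (is ! j)))"
    unfolding m_def by (induction "length \<alpha>") (auto simp: set_mset_sum)
  also have "\<dots> = (\<Union>j<length \<alpha>. {is ! j})"
    using pos by (intro SUP_cong) (auto simp: set_mset_replicate_mset_subset)
  also have "\<dots> = set is" using len by (auto simp: in_set_conv_nth)
  finally show set: "set_mset m = set is" .
  have "sorted_list_of_set (set is) = is"
    using sorted by (simp add: sorted_list_of_set.idem_if_sorted_distinct strict_sorted_iff)
  then show "monomial_type m = \<alpha>"
    unfolding monomial_type_def set
    using count_sum_replicate[OF dist len] len by (intro nth_equalityI) (auto simp: m_def)
qed

lemma monomial_as_sum_replicate:
  "m = (\<Sum>j<length (monomial_type m).
          replicate_mset (monomial_type m ! j) (sorted_list_of_set (set_mset m) ! j))"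
  (is "m = ?s")
proof (rule multiset_eqI)
  fix x
  let ?is = "sorted_list_of_set (set_mset m)"
  have pos: "\<forall>a\<in>set (monomial_type m). a > 0"
    using monomial_type_compositions[of m] by (simp add: compositions_def)
  have len: "length ?is = length (monomial_type m)" by (simp add: monomial_type_def)
  have sorted: "sorted_wrt (<) ?is" by simp
  have set: "set_mset ?s = set_mset m"
    using monomial_type_sum_replicate(1)[OF sorted len pos] by simp
  show "count m x = count ?s x"
  proof (cases "x \<in># m")
    case True
    then obtain j where j: "j < length ?is" "x = ?is ! j" by (metis finite_set_mset in_set_conv_nth set_sorted_list_of_set)
    have "count ?s x = monomial_type m ! j"
      unfolding j(2) using j(1) len by (intro count_sum_replicate) auto
    then show ?thesis using j by (simp add: monomial_type_def)
  next
    case False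
    then have "x \<notin># ?s" by (simp only: set not_False_eq_True)
    with False show ?thesis by (simp only: not_in_iff)
  qed
qed

lemma monomial_qsym_eq:
  assumes "\<alpha> \<in> compositions n"
  shows "monomial_qsym \<alpha> m = (if monomial_type m = \<alpha> then 1 else 0)"
proof -
  have "(\<exists>is. length is = length \<alpha> \<and> sorted_wrt (<) is \<and>
          m = (\<Sum>j<length \<alpha>. replicate_mset (\<alpha> ! j) (is ! j))) \<longleftrightarrow> monomial_type m = \<alpha>"
  proof
    assume "\<exists>is. length is = length \<alpha> \<and> sorted_wrt (<) is \<and>
          m = (\<Sum>j<length \<alpha>. replicate_mset (\<alpha> ! j) (is ! j))"
    then show "monomial_type m = \<alpha>"
      using monomial_type_sum_replicate(2) assms by (auto simp: compositions_def)
  next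
    assume eq: "monomial_type m = \<alpha>"
    show "\<exists>is. length is = length \<alpha> \<and> sorted_wrt (<) is \<and>
          m = (\<Sum>j<length \<alpha>. replicate_mset (\<alpha> ! j) (is ! j))"
      using monomial_as_sum_replicate[of m]
      by (intro exI[of _ "sorted_list_of_set (set_mset m)"] conjI)
         (simp_all add: eq, simp add: monomial_type_def eq[symmetric])
  qed
  then show ?thesis by (simp add: monomial_qsym_def)
qed

text \<open>The functions \<open>M\<^sub>\<alpha>\<close> have disjoint supports, so at each
  monomial a single term of the expansion remains. Having an expansion thus means that coefficients
  depend on the exponent sequence alone.\<close>

lemma qsym_expansion_iff:
  "qsym_expansion F c \<longleftrightarrow> (\<forall>m. F m = c (monomial_type m))"
proof -
  have "(\<Sum>\<alpha>\<in>compositions (size m). c \<alpha> * monomial_qsym \<alpha> m) = c (monomial_type m)" for m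
  proof -
    have "(\<Sum>\<alpha>\<in>compositions (size m). c \<alpha> * monomial_qsym \<alpha> m)
        = (\<Sum>\<alpha>\<in>compositions (size m). if \<alpha> = monomial_type m then c \<alpha> else 0)"
      by (intro sum.cong) (auto simp: monomial_qsym_eq)
    also have "\<dots> = c (monomial_type m)"
      by (simp add: finite_compositions monomial_type_compositions)
    finally show ?thesis .
  qed
  then show ?thesis by (simp add: qsym_expansion_def)
qed

lemma monomial_determined:
  assumes "set_mset m = set_mset m'" and "monomial_type m = monomial_type m'"
  shows "m = m'"
  using monomial_as_sum_replicate[of m] monomial_as_sum_replicate[of m'] assms by simp

text \<open>Given \<alpha>, a monomial is determined by its support, which may be any set of
  \<open>length \<alpha>\<close> variables.\<close>

lemma card_monomials_of_type:
  assumes pos: "\<forall>a\<in>set \<alpha>. a > 0"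
  shows "card {m. monomial_type m = \<alpha> \<and> set_mset m \<subseteq> {1..x}} = x choose length \<alpha>"
proof -
  have "bij_betw set_mset {m. monomial_type m = \<alpha> \<and> set_mset m \<subseteq> {1..x}}
          {S. S \<subseteq> {1..x} \<and> card S = length \<alpha>}"
    unfolding bij_betw_def
  proof (intro conjI inj_onI equalityI subsetI)
    fix S assume "S \<in> {S. S \<subseteq> {1..x} \<and> card S = length \<alpha>}"
    then have S: "S \<subseteq> {1..x}" "card S = length \<alpha>" "finite S" by (auto intro: finite_subset)
    define m where "m = (\<Sum>j<length \<alpha>. replicate_mset (\<alpha> ! j) (sorted_list_of_set S ! j))"
    have "set_mset m = S" "monomial_type m = \<alpha>"
      unfolding m_def using monomial_type_sum_replicate[of "sorted_list_of_set S" \<alpha>] S pos by auto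
    then show "S \<in> set_mset ` {m. monomial_type m = \<alpha> \<and> set_mset m \<subseteq> {1..x}}"
      using S by blast
  qed (auto intro: monomial_determined simp: monomial_type_def)
  then have "card {m. monomial_type m = \<alpha> \<and> set_mset m \<subseteq> {1..x}} = card {S. S \<subseteq> {1..x} \<and> card S = length \<alpha>}"
    by (rule bij_betw_same_card)
  then show ?thesis by (simp add: n_subsets)
qed

lemma finite_monomials_of_type: "finite {m. monomial_type m = \<alpha> \<and> set_mset m \<subseteq> {1..x}}"
proof (rule inj_on_finite[of set_mset _ "Pow {1..x}"])
  show "inj_on set_mset {m. monomial_type m = \<alpha> \<and> set_mset m \<subseteq> {1..x}}"
    by (intro inj_onI monomial_determined) auto
qed auto

lemma monomials_eq_UN_types:
  "{m. size m = n \<and> set_mset m \<subseteq> {1..x}}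
     = (\<Union>\<alpha>\<in>compositions n. {m. monomial_type m = \<alpha> \<and> set_mset m \<subseteq> {1..x}})"
  using monomial_type_compositions by (force simp: compositions_def)

lemma finite_monomials: "finite {m :: nat multiset. size m = n \<and> set_mset m \<subseteq> {1..x}}"
  unfolding monomials_eq_UN_types by (intro finite_UN_I finite_compositions finite_monomials_of_type)

text \<open>Setting the variables 1 to \<open>x\<close> to 1 and the others to 0 turns
  \<open>M\<^sub>\<alpha>\<close> into the binomial coefficient of \<open>x\<close> over the number
  of parts. This is how quasisymmetric coefficients become f-vector entries.\<close>

lemma sum_over_monomials:
  fixes c :: "nat list \<Rightarrow> 'r :: comm_ring_1"
  shows "(\<Sum>m | size m = n \<and> set_mset m \<subseteq> {1..x}. c (monomial_type m))
       = (\<Sum>\<alpha>\<in>compositions n. of_nat (x choose length \<alpha>) * c \<alpha>)"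
proof -
  have "(\<Sum>m | size m = n \<and> set_mset m \<subseteq> {1..x}. c (monomial_type m))
      = (\<Sum>\<alpha>\<in>compositions n. \<Sum>m | monomial_type m = \<alpha> \<and> set_mset m \<subseteq> {1..x}. c (monomial_type m))"
    unfolding monomials_eq_UN_types using finite_compositions finite_monomials_of_type
    by (intro sum.UNION_disjoint) auto
  also have "\<dots> = (\<Sum>\<alpha>\<in>compositions n. of_nat (x choose length \<alpha>) * c \<alpha>)"
    using card_monomials_of_type by (intro sum.cong) (auto simp: compositions_def)
  finally show ?thesis .
qed

section \<open>Newton expansions\<close>

definition binomial_poly :: "nat \<Rightarrow> 'r :: field_char_0 poly" where
  "binomial_poly i = Polynomial.smult (1 / fact i) (\<Prod>j<i. [:- of_nat j, 1:])"

lemma poly_binomial_poly: "poly (binomial_poly i) x = x gchoose i"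
  by (simp add: binomial_poly_def poly_prod gbinomial_prod_rev atLeast0LessThan)

lemma degree_binomial_poly: "degree (binomial_poly i :: 'r :: field_char_0 poly) = i"
  by (simp add: binomial_poly_def degree_prod_eq_sum_degree)

lemma coeff_binomial_poly: "coeff (binomial_poly i :: 'r :: field_char_0 poly) i \<noteq> 0"
proof (cases "i = 0")
  case False
  then show ?thesis
    using degree_binomial_poly[of i, where 'r = 'r] by (metis degree_0 leading_coeff_0_iff)
qed (simp add: binomial_poly_def)

definition newton_poly :: "nat \<Rightarrow> (nat \<Rightarrow> 'r :: field_char_0) \<Rightarrow> 'r poly" where
  "newton_poly n c = (\<Sum>i\<le>n. Polynomial.smult (c i) (binomial_poly i))"

lemma poly_newton_poly: "poly (newton_poly n c) x = (\<Sum>i\<le>n. c i * (x gchoose i))"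
  by (simp add: newton_poly_def poly_sum poly_binomial_poly)

lemma poly_newton_poly_by_length:
  fixes c :: "nat list \<Rightarrow> 'r :: field_char_0"
  assumes "\<And>\<alpha>. \<alpha> \<in> A \<Longrightarrow> length \<alpha> \<le> n" and "finite A"
  shows "poly (newton_poly n (\<lambda>i. \<Sum>\<alpha> | \<alpha> \<in> A \<and> length \<alpha> = i. c \<alpha>)) (of_nat x)
       = (\<Sum>\<alpha>\<in>A. of_nat (x choose length \<alpha>) * c \<alpha>)"
proof -
  have "poly (newton_poly n (\<lambda>i. \<Sum>\<alpha> | \<alpha> \<in> A \<and> length \<alpha> = i. c \<alpha>)) (of_nat x)
      = (\<Sum>i\<le>n. \<Sum>\<alpha> | \<alpha> \<in> A \<and> length \<alpha> = i. of_nat (x choose length \<alpha>) * c \<alpha>)"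
    unfolding poly_newton_poly binomial_gbinomial[symmetric]
  proof (rule sum.cong)
    fix i
    have "(\<Sum>\<alpha> | \<alpha> \<in> A \<and> length \<alpha> = i. of_nat (x choose length \<alpha>) * c \<alpha>)
        = (\<Sum>\<alpha> | \<alpha> \<in> A \<and> length \<alpha> = i. of_nat (x choose i) * c \<alpha>)"
      by (intro sum.cong) auto
    then show "(\<Sum>\<alpha> | \<alpha> \<in> A \<and> length \<alpha> = i. c \<alpha>) * of_nat (x choose i)
        = (\<Sum>\<alpha> | \<alpha> \<in> A \<and> length \<alpha> = i. of_nat (x choose length \<alpha>) * c \<alpha>)"
      by (simp only: mult.commute[of "sum c _"] sum_distrib_left)
  qed simp
  also have "\<dots> = (\<Sum>\<alpha>\<in>A. of_nat (x choose length \<alpha>) * c \<alpha>)"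
    using assms by (intro sum.group) auto
  finally show ?thesis .
qed

lemma coeff_newton_poly_top:
  fixes c :: "nat \<Rightarrow> 'r :: field_char_0"
  assumes "k \<le> n" and "\<And>i. i > k \<Longrightarrow> c i = 0"
  shows "coeff (newton_poly n c) k = c k * coeff (binomial_poly k) k"
proof -
  have "coeff (newton_poly n c) k = (\<Sum>i\<le>n. c i * coeff (binomial_poly i) k)"
    by (simp add: newton_poly_def coeff_sum)
  also have "\<dots> = (\<Sum>i\<in>{k}. c i * coeff (binomial_poly i) k)"
  proof (rule sum.mono_neutral_right)
    show "\<forall>i\<in>{..n} - {k}. c i * coeff (binomial_poly i) k = 0"
    proof
      fix i assume i: "i \<in> {..n} - {k}"
      show "c i * coeff (binomial_poly i) k = 0"
        using i assms(2)[of i] coeff_eq_0[of "binomial_poly i :: 'r poly" k]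
        by (cases "i < k") (auto simp: degree_binomial_poly)
    qed
  qed (use assms in auto)
  finally show ?thesis by simp
qed

text \<open>Binomial polynomials have distinct degrees, so leading terms do not cancel: the largest
  index with a nonzero coefficient is at most the degree. This matters because
  \<open>f_vector\<close> cuts off at the true degree, which may lie below the bound
  \<open>n\<close>.\<close>

lemma newton_coeff_zero:
  fixes c :: "nat \<Rightarrow> 'r :: field_char_0"
  assumes c: "\<And>i. i > n \<Longrightarrow> c i = 0" and i: "i > degree (newton_poly n c)"
  shows "c i = 0"
proof (rule ccontr)
  assume "c i \<noteq> 0"
  define k where "k = Greatest (\<lambda>i. c i \<noteq> 0)"
  have bound: "c j \<noteq> 0 \<Longrightarrow> j \<le> n" for j using c by (meson not_le)
  have k: "c k \<noteq> 0" unfolding k_def using \<open>c i \<noteq> 0\<close> bound by (rule GreatestI_nat)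
  have ik: "j \<le> k" if "c j \<noteq> 0" for j unfolding k_def using that bound by (rule Greatest_le_nat)
  have "coeff (newton_poly n c) k = c k * coeff (binomial_poly k) k"
    using bound[OF k] ik by (intro coeff_newton_poly_top) (auto simp: not_le[symmetric])
  then have "coeff (newton_poly n c) k \<noteq> 0" using k coeff_binomial_poly[of k, where 'r = 'r] by simp
  then have "k \<le> degree (newton_poly n c)" by (rule le_degree)
  then show False using ik[OF \<open>c i \<noteq> 0\<close>] i by simp
qed

lemma degree_newton_poly:
  fixes c :: "nat \<Rightarrow> 'r :: field_char_0"
  assumes "c n \<noteq> 0"
  shows "degree (newton_poly n c) = n"
proof (rule antisym)
  show "degree (newton_poly n c) \<le> n"
    unfolding newton_poly_def
    by (intro degree_sum_le) (auto intro: order.trans[OF degree_smult_le] simp: degree_binomial_poly)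
  define c' where "c' i = (if i \<le> n then c i else 0)" for i
  have eq: "newton_poly n c = newton_poly n c'" by (simp add: newton_poly_def c'_def)
  have "coeff (newton_poly n c') n = c n * coeff (binomial_poly n) n"
    by (subst coeff_newton_poly_top) (auto simp: c'_def)
  then show "n \<le> degree (newton_poly n c)"
    unfolding eq using assms coeff_binomial_poly[of n, where 'r = 'r] by (intro le_degree) simp
qed

lemma degree_newton_poly_le: "degree (newton_poly n c) \<le> n"
  unfolding newton_poly_def
  by (intro degree_sum_le) (auto intro: order.trans[OF degree_smult_le] simp: degree_binomial_poly)

text \<open>Evaluation at \<open>k\<close> kills all terms beyond \<open>k\<close> and gives the
  \<open>k\<close>-th coefficient the factor 1: a triangular system, solved from below.\<close>

lemma newton_expansion_unique:
  fixes f f' :: "nat \<Rightarrow> 'r :: field_char_0"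
  assumes eq: "\<And>x. (\<Sum>i\<le>d. f i * (x gchoose i)) = (\<Sum>i\<le>d. f' i * (x gchoose i))" and "k \<le> d"
  shows "f k = f' k"
  using \<open>k \<le> d\<close>
proof (induction k rule: less_induct)
  case (less k)
  have split: "(\<Sum>i\<le>d. f i * (of_nat k gchoose i)) = (\<Sum>i<k. f i * (of_nat k gchoose i)) + f k" for f :: "nat \<Rightarrow> 'r"
  proof -
    have "(\<Sum>i\<le>d. f i * (of_nat k gchoose i)) = (\<Sum>i\<le>k. f i * (of_nat k gchoose i))"
      using less.prems by (intro sum.mono_neutral_right) (auto simp: binomial_gbinomial[symmetric])
    then show ?thesis by (simp add: lessThan_Suc_atMost[symmetric] binomial_gbinomial[symmetric])
  qed
  have "(\<Sum>i<k. f i * (of_nat k gchoose i)) = (\<Sum>i<k. f' i * (of_nat k gchoose i))"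
    using less by (intro sum.cong) auto
  then show ?case using eq[of "of_nat k"] by (simp add: split)
qed

lemma f_vector_newton_poly:
  fixes c :: "nat \<Rightarrow> 'r :: field_char_0"
  assumes c: "\<And>i. i > n \<Longrightarrow> c i = 0"
  shows "f_vector (newton_poly n c) = c"
  unfolding f_vector_def
proof (rule the_equality)
  let ?p = "newton_poly n c"
  have zero: "\<forall>i>degree ?p. c i = 0" using newton_coeff_zero[of n c] c by blast
  have exp: "poly ?p x = (\<Sum>i\<le>degree ?p. c i * (x gchoose i))" for x
    unfolding poly_newton_poly
    using zero degree_newton_poly_le[of n c] by (intro sum.mono_neutral_right) auto
  show "(\<forall>x. poly ?p x = (\<Sum>i\<le>degree ?p. c i * (x gchoose i))) \<and> (\<forall>i>degree ?p. c i = 0)"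
    using zero exp by blast
  fix f assume f: "(\<forall>x. poly ?p x = (\<Sum>i\<le>degree ?p. f i * (x gchoose i))) \<and> (\<forall>i>degree ?p. f i = 0)"
  show "f = c"
  proof
    fix k show "f k = c k"
    proof (cases "k \<le> degree ?p")
      case True
      have "(\<Sum>i\<le>degree ?p. f i * (x gchoose i)) = (\<Sum>i\<le>degree ?p. c i * (x gchoose i))" for x
        by (rule trans[OF f[THEN conjunct1, rule_format, of x, symmetric] exp[of x]])
      then show ?thesis using True by (rule newton_expansion_unique)
    qed (use f zero in auto)
  qed
qed

section \<open>Compositions as subsets\<close>

text \<open>An element \<open>j\<close> of \<open>S\<close> stands for a cut in front of the last
  \<open>j + 1\<close> units. Counting from the right end lets the recursion act on the head of the
  list. The result composes \<open>Suc m\<close>, which has \<open>m\<close> places for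
  cuts.\<close>

primrec subset_composition :: "nat \<Rightarrow> nat set \<Rightarrow> nat list" where
  "subset_composition 0 S = [1]"
| "subset_composition (Suc m) S =
     (let \<alpha> = subset_composition m S in if m \<in> S then 1 # \<alpha> else Suc (hd \<alpha>) # tl \<alpha>)"

lemma subset_composition_cong:
  "S \<inter> {..<m} = T \<inter> {..<m} \<Longrightarrow> subset_composition m S = subset_composition m T"
proof (induction m)
  case (Suc m)
  then have "S \<inter> {..<m} = T \<inter> {..<m}" "m \<in> S \<longleftrightarrow> m \<in> T"
    by (auto simp: set_eq_iff less_Suc_eq)
  with Suc.IH show ?case by simp
qed simp

lemma subset_composition_compositions: "subset_composition m S \<in> compositions (Suc m)"
proof (induction m)
  case (Suc m)
  then obtain a \<alpha> where "subset_composition m S = a # \<alpha>"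
    by (cases "subset_composition m S") (auto simp: compositions_def)
  with Suc show ?case by (auto simp: compositions_def Let_def split: if_splits)
qed (simp add: compositions_def)

lemma subset_composition_Cons: "\<exists>a \<alpha>. subset_composition m S = a # \<alpha> \<and> a > 0"
  using subset_composition_compositions[of m S]
  by (cases "subset_composition m S") (auto simp: compositions_def)

lemma length_subset_composition: "length (subset_composition m S) = Suc (card (S \<inter> {..<m}))"
proof (induction m)
  case (Suc m)
  obtain a \<alpha> where eq: "subset_composition m S = a # \<alpha>" using subset_composition_Cons by blast
  show ?case
  proof (cases "m \<in> S")
    case True
    then have "S \<inter> {..<Suc m} = insert m (S \<inter> {..<m})" by auto
    with True Suc eq show ?thesis by simp
  next
    case False
    then have "S \<inter> {..<Suc m} = S \<inter> {..<m}" by (auto simp: less_Suc_eq)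
    with False Suc eq show ?thesis by simp
  qed
qed simp

lemma inj_on_subset_composition: "inj_on (subset_composition m) (Pow {..<m})"
proof -
  have "S \<inter> {..<m} = T \<inter> {..<m}" if "subset_composition m S = subset_composition m T" for S T
    using that
  proof (induction m)
    case (Suc m)
    obtain a \<alpha> b \<beta> where eq: "subset_composition m S = a # \<alpha>" "subset_composition m T = b # \<beta>" "a > 0" "b > 0"
      using subset_composition_Cons by metis
    have "(m \<in> S \<longleftrightarrow> m \<in> T) \<and> subset_composition m S = subset_composition m T"
      using Suc.prems eq by (auto simp: Let_def split: if_splits)
    with Suc.IH show ?case by (auto simp: set_eq_iff less_Suc_eq)
  qed simp
  then show ?thesis by (intro inj_onI) (metis Int_absorb2 PowD)
qed

lemma subset_composition_surj: "\<alpha> \<in> compositions (Suc m) \<Longrightarrow> \<exists>S\<subseteq>{..<m}. subset_composition m S = \<alpha>"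
proof (induction m arbitrary: \<alpha>)
  case 0
  then obtain a \<beta> where a: "\<alpha> = a # \<beta>" "a > 0" "a + sum_list \<beta> = 1" "\<forall>b\<in>set \<beta>. b > 0"
    by (cases \<alpha>) (auto simp: compositions_def)
  have "a = 1" using a(2,3) by simp
  moreover from this have "sum_list \<beta> = 0" using a(3) by simp
  moreover have "\<beta> = []" using \<open>sum_list \<beta> = 0\<close> a(4) by (cases \<beta>) auto
  ultimately show ?case using a by simp
next
  case (Suc m)
  then obtain a \<beta> where a: "\<alpha> = a # \<beta>" "a > 0" "a + sum_list \<beta> = Suc (Suc m)" "\<forall>b\<in>set \<beta>. b > 0"
    by (cases \<alpha>) (auto simp: compositions_def)
  show ?case
  proof (cases "a = 1")
    case True
    then have "\<beta> \<in> compositions (Suc m)" using a by (auto simp: compositions_def)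
    then obtain S where S: "S \<subseteq> {..<m}" "subset_composition m S = \<beta>" using Suc.IH by blast
    have "subset_composition m (insert m S) = \<beta>"
      unfolding S(2)[symmetric] by (rule subset_composition_cong) auto
    then show ?thesis using S True a by (intro exI[of _ "insert m S"]) auto
  next
    case False
    then have "(a - 1) # \<beta> \<in> compositions (Suc m)" using a by (auto simp: compositions_def)
    then obtain S where S: "S \<subseteq> {..<m}" "subset_composition m S = (a - 1) # \<beta>" using Suc.IH by blast
    moreover have "m \<notin> S" using S(1) by blast
    ultimately show ?thesis using False a by (intro exI[of _ S]) auto
  qed
qed

lemma bij_subset_composition:
  "bij_betw (subset_composition m) {S. S \<subseteq> {..<m} \<and> card S = k} {\<alpha> \<in> compositions (Suc m). length \<alpha> = Suc k}"
  unfolding bij_betw_def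
proof (intro conjI equalityI subsetI)
  show "inj_on (subset_composition m) {S. S \<subseteq> {..<m} \<and> card S = k}"
    by (rule inj_on_subset[OF inj_on_subset_composition]) auto
next
  fix \<alpha> assume "\<alpha> \<in> subset_composition m ` {S. S \<subseteq> {..<m} \<and> card S = k}"
  then show "\<alpha> \<in> {\<alpha> \<in> compositions (Suc m). length \<alpha> = Suc k}"
    using subset_composition_compositions by (auto simp: length_subset_composition Int_absorb2)
next
  fix \<alpha> assume \<alpha>: "\<alpha> \<in> {\<alpha> \<in> compositions (Suc m). length \<alpha> = Suc k}"
  then obtain S where "S \<subseteq> {..<m}" "subset_composition m S = \<alpha>" using subset_composition_surj by blast
  then show "\<alpha> \<in> subset_composition m ` {S. S \<subseteq> {..<m} \<and> card S = k}"
    using \<alpha> length_subset_composition[of m S] by (auto simp: Int_absorb2)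
qed

text \<open>At the step that reaches \<open>x\<close>, the new cut separates one unit from the head;
  all later steps prepend a part or enlarge the head, in the same way for both lists.\<close>

lemma subset_composition_insert:
  assumes "x < m" and "x \<notin> S"
  shows "\<exists>L a b R. subset_composition m S = L @ (a + b) # R \<and> subset_composition m (insert x S) = L @ a # b # R \<and> a > 0 \<and> b > 0"
  using \<open>x < m\<close>
proof (induction m)
  case (Suc m)
  show ?case
  proof (cases "x = m")
    case True
    obtain a \<alpha> where eq: "subset_composition m S = a # \<alpha>" "a > 0" using subset_composition_Cons by blast
    have "subset_composition m (insert x S) = subset_composition m S"
      unfolding True by (rule subset_composition_cong) auto
    then show ?thesis using True eq assms(2)
      by (intro exI[of _ "[]"] exI[of _ 1] exI[of _ a] exI[of _ \<alpha>]) auto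
  next
    case False
    with Suc obtain L a b R where *: "subset_composition m S = L @ (a + b) # R"
      "subset_composition m (insert x S) = L @ a # b # R" "a > 0" "b > 0" by auto
    show ?thesis
    proof (cases "m \<in> S")
      case True
      then show ?thesis using *
        by (intro exI[of _ "1 # L"] exI[of _ a] exI[of _ b] exI[of _ R]) auto
    next
      case mS: False
      show ?thesis
      proof (cases L)
        \<comment> \<open>The split part is still at the head: the new unit enlarges it, and in the
          refined list it goes to the first piece.\<close>
        case Nil
        then show ?thesis using * mS \<open>x \<noteq> m\<close>
          by (intro exI[of _ "[]"] exI[of _ "Suc a"] exI[of _ b] exI[of _ R]) auto
      next
        case (Cons l L')
        then show ?thesis using * mS \<open>x \<noteq> m\<close>
          by (intro exI[of _ "Suc l # L'"] exI[of _ a] exI[of _ b] exI[of _ R]) auto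
      qed
    qed
  qed
qed simp

section \<open>Symmetric chains of subsets\<close>

text \<open>The successor of a set in the symmetric chain decomposition of the subsets of
  \<open>{..<m}\<close>: a chain \<open>c\<^sub>0, \<dots>, c\<^sub>r\<close> for \<open>m\<close> gives the chains \<open>c\<^sub>0, \<dots>, c\<^sub>r, insert m c\<^sub>r\<close>
  and \<open>insert m c\<^sub>0, \<dots>, insert m c\<^sub>r\<^sub>-\<^sub>1\<close> for \<open>Suc m\<close>.\<close>

primrec chain_succ :: "nat \<Rightarrow> nat set \<Rightarrow> nat set option" where
  "chain_succ 0 S = None"
| "chain_succ (Suc m) S =
     (if m \<in> S then
        (case chain_succ m (S - {m}) of
           None \<Rightarrow> None
         | Some T \<Rightarrow> if chain_succ m T = None then None else Some (insert m T))
      else (case chain_succ m S of None \<Rightarrow> Some (insert m S) | Some T \<Rightarrow> Some T))"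

lemma chain_succ_step:
  "S \<subseteq> {..<m} \<Longrightarrow> chain_succ m S = Some T \<Longrightarrow> T \<subseteq> {..<m} \<and> S \<subseteq> T \<and> card T = Suc (card S)"
proof (induction m arbitrary: S T)
  case (Suc m)
  show ?case
  proof (cases "m \<in> S")
    case True
    with Suc.prems(2) obtain U where U: "chain_succ m (S - {m}) = Some U" "T = insert m U"
      by (auto split: option.splits if_splits)
    have "S - {m} \<subseteq> {..<m}" using Suc.prems(1) by (auto simp: less_Suc_eq)
    from Suc.IH[OF this U(1)] have IH: "U \<subseteq> {..<m}" "S - {m} \<subseteq> U" "card U = Suc (card (S - {m}))" by auto
    have "finite U" "m \<notin> U" using IH(1) finite_subset by auto
    moreover have "card S = Suc (card (S - {m}))"
      using True Suc.prems(1) finite_subset by (subst card_Suc_Diff1) auto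
    ultimately show ?thesis using IH U(2) True by auto
  next
    case False
    then have S: "S \<subseteq> {..<m}" using Suc.prems(1) by (auto simp: less_Suc_eq)
    show ?thesis
    proof (cases "chain_succ m S")
      case None
      then have "T = insert m S" using False Suc.prems(2) by simp
      moreover have "finite S" using S finite_subset by auto
      ultimately show ?thesis using False S by auto
    next
      case (Some U)
      then have "U = T" using False Suc.prems(2) by simp
      then show ?thesis using Suc.IH[OF S Some] by auto
    qed
  qed
qed simp

text \<open>A set \<open>T\<close> that contains \<open>m\<close> has a predecessor either in a
  copied chain with \<open>m\<close> adjoined (\<open>good\<close>) or, at the end of an extended
  chain, as \<open>T - {m}\<close>. The two exclude each other, because the end of the old chain is
  left out of the copy. For \<open>good\<close> sets uniqueness is inherited from the old
  chains.\<close>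

lemma chain_succ_inj:
  "S \<subseteq> {..<m} \<Longrightarrow> S' \<subseteq> {..<m} \<Longrightarrow> chain_succ m S = Some T \<Longrightarrow> chain_succ m S' = Some T \<Longrightarrow> S = S'"
proof (induction m arbitrary: S S' T)
  case (Suc m)
  define good where "good U \<longleftrightarrow> m \<in> U \<and> U - {m} \<subseteq> {..<m} \<and> chain_succ m (U - {m}) = Some (T - {m}) \<and> chain_succ m (T - {m}) \<noteq> None" for U
  have cases': "if m \<in> T then good U \<or> U = T - {m} \<and> chain_succ m U = None
      else U \<subseteq> {..<m} \<and> chain_succ m U = Some T"
    if U: "U \<subseteq> {..<Suc m}" "chain_succ (Suc m) U = Some T" for U
  proof (cases "m \<in> U")
    case True
    with U(2) obtain V where V: "chain_succ m (U - {m}) = Some V" "chain_succ m V \<noteq> None" "T = insert m V"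
      by (auto split: option.splits if_splits)
    have U': "U - {m} \<subseteq> {..<m}" using U(1) by (auto simp: less_Suc_eq)
    have "V \<subseteq> {..<m}" using chain_succ_step[OF U' V(1)] by simp
    then have "T - {m} = V" using V(3) by auto
    then show ?thesis using True U' V by (simp add: good_def)
  next
    case False
    then have U': "U \<subseteq> {..<m}" using U(1) by (auto simp: less_Suc_eq)
    show ?thesis
    proof (cases "chain_succ m U")
      case None
      then have "T = insert m U" using False U(2) by simp
      then show ?thesis using None False by simp
    next
      case (Some V)
      then have "V = T" using False U(2) by simp
      moreover have "m \<notin> T" using chain_succ_step[OF U' Some] \<open>V = T\<close> by auto
      ultimately show ?thesis using U' Some by simp
    qed
  qed
  note S = cases'[OF Suc.prems(1,3)] and S' = cases'[OF Suc.prems(2,4)]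
  show ?case
  proof (cases "m \<in> T")
    case False
    then show ?thesis using S S' Suc.IH[of S S' T] by simp
  next
    case True
    then have "good S \<or> S = T - {m} \<and> chain_succ m S = None" "good S' \<or> S' = T - {m} \<and> chain_succ m S' = None"
      using S S' by simp_all
    then show ?thesis
    proof (elim disjE conjE)
      assume "good S" "good S'"
      then have "S - {m} = S' - {m}" "m \<in> S" "m \<in> S'"
        using Suc.IH[of "S - {m}" "S' - {m}" "T - {m}"] by (simp_all add: good_def)
      then show "S = S'" by blast
    qed (simp_all add: good_def)
  qed
qed simp

section \<open>Length of the chains\<close>

primrec chain_iter :: "nat \<Rightarrow> nat \<Rightarrow> nat set \<Rightarrow> nat set option" where
  "chain_iter m 0 S = Some S"
| "chain_iter m (Suc t) S = Option.bind (chain_iter m t S) (chain_succ m)"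

lemma chain_iter_step:
  "S \<subseteq> {..<m} \<Longrightarrow> chain_iter m t S = Some T \<Longrightarrow> T \<subseteq> {..<m} \<and> S \<subseteq> T \<and> card T = card S + t"
proof (induction t arbitrary: T)
  case (Suc t)
  then obtain U where U: "chain_iter m t S = Some U" "chain_succ m U = Some T"
    by (auto simp: bind_eq_Some_conv)
  with Suc chain_succ_step[of U m T] show ?case by fastforce
qed simp

lemma chain_iter_inj:
  "S \<subseteq> {..<m} \<Longrightarrow> S' \<subseteq> {..<m} \<Longrightarrow> chain_iter m t S = Some T \<Longrightarrow> chain_iter m t S' = Some T \<Longrightarrow> S = S'"
proof (induction t arbitrary: T)
  case (Suc t)
  then obtain U U' where "chain_iter m t S = Some U" "chain_succ m U = Some T"
    "chain_iter m t S' = Some U'" "chain_succ m U' = Some T"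
    by (auto simp: bind_eq_Some_conv)
  with Suc chain_succ_inj[of U m U' T] chain_iter_step show ?case by metis
qed simp

lemma chain_iter_Suc_same:
  "S \<subseteq> {..<m} \<Longrightarrow> chain_iter m t S = Some T \<Longrightarrow> chain_iter (Suc m) t S = Some T"
proof (induction t arbitrary: T)
  case (Suc t)
  then obtain U where U: "chain_iter m t S = Some U" "chain_succ m U = Some T"
    by (auto simp: bind_eq_Some_conv)
  then have "m \<notin> U" using chain_iter_step[OF Suc.prems(1)] by blast
  then show ?case using U Suc by simp
qed simp

text \<open>The copy with \<open>m\<close> adjoined lacks the last set of the old chain, hence the
  condition that \<open>T\<close> has a successor.\<close>

lemma chain_iter_Suc_insert:
  "S \<subseteq> {..<m} \<Longrightarrow> chain_iter m t S = Some T \<Longrightarrow> chain_succ m T \<noteq> None \<Longrightarrow>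
     chain_iter (Suc m) t (insert m S) = Some (insert m T)"
proof (induction t arbitrary: T)
  case (Suc t)
  then obtain U where U: "chain_iter m t S = Some U" "chain_succ m U = Some T"
    by (auto simp: bind_eq_Some_conv)
  then have "insert m U - {m} = U" using chain_iter_step[OF Suc.prems(1)] by blast
  then show ?case using U Suc by auto
qed simp

text \<open>Symmetry of the chains: for k at most half of m, the chain through a set of size k
  reaches at least size m - k. If the new element is in \<open>S\<close>, removing it leaves one
  spare step, which shows that the shortened copy is long enough. Otherwise one step beyond the old
  chain is provided by adjoining the new element.\<close>

lemma chain_iter_defined:
  "S \<subseteq> {..<m} \<Longrightarrow> 2 * card S + t \<le> m \<Longrightarrow> chain_iter m t S \<noteq> None"
proof (induction m arbitrary: S t)
  case (Suc m)
  show ?case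
  proof (cases "m \<in> S")
    case True
    define S' where "S' = S - {m}"
    have S': "S' \<subseteq> {..<m}" using Suc.prems(1) by (auto simp: S'_def less_Suc_eq)
    have "card S = Suc (card S')"
      unfolding S'_def using True Suc.prems(1) finite_subset by (subst card_Suc_Diff1) auto
    then have "chain_iter m (Suc t) S' \<noteq> None" using Suc.prems S' by (intro Suc.IH) auto
    then obtain T where "chain_iter m t S' = Some T" "chain_succ m T \<noteq> None"
      by (cases "chain_iter m t S'") auto
    from chain_iter_Suc_insert[OF S' this] show ?thesis using True by (simp add: S'_def insert_absorb)
  next
    case False
    then have S: "S \<subseteq> {..<m}" using Suc.prems(1) by (auto simp: less_Suc_eq)
    show ?thesis
    proof (cases "2 * card S + t \<le> m")
      case True
      then show ?thesis using Suc.IH[OF S] chain_iter_Suc_same[OF S] by fastforce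
    next
      case notle: False
      show ?thesis
      proof (cases t)
        case (Suc t')
        then have "chain_iter m t' S \<noteq> None" using Suc.prems S notle \<open>\<And>t S. S \<subseteq> {..<m} \<Longrightarrow> 2 * card S + t \<le> m \<Longrightarrow> chain_iter m t S \<noteq> None\<close> by simp
        then obtain T where T: "chain_iter m t' S = Some T" by auto
        then have "m \<notin> T" using chain_iter_step[OF S] by blast
        then show ?thesis using chain_iter_Suc_same[OF S T] Suc by (auto split: option.splits)
      qed simp
    qed
  qed
qed simp

text \<open>The map makes \<open>l - k\<close> steps along the chains. They are defined because
  \<open>2 * k + (l - k)\<close> equals \<open>k + l\<close>, and injective because a set has at
  most one predecessor.\<close>

lemma subset_level_injection:
  assumes "k \<le> l" and "k + l \<le> m"
  obtains \<psi> where "inj_on \<psi> {S. S \<subseteq> {..<m} \<and> card S = k}"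
    and "\<forall>S. S \<subseteq> {..<m} \<and> card S = k \<longrightarrow> \<psi> S \<subseteq> {..<m} \<and> S \<subseteq> \<psi> S \<and> card (\<psi> S) = l"
proof -
  define \<psi> where "\<psi> S = the (chain_iter m (l - k) S)" for S
  have \<psi>: "chain_iter m (l - k) S = Some (\<psi> S)" if "S \<subseteq> {..<m}" "card S = k" for S
    using chain_iter_defined[of S m "l - k"] that assms by (auto simp: \<psi>_def)
  show thesis
  proof (rule that[of \<psi>])
    show "inj_on \<psi> {S. S \<subseteq> {..<m} \<and> card S = k}"
    proof (rule inj_onI)
      fix S S' assume S: "S \<in> {S. S \<subseteq> {..<m} \<and> card S = k}" "S' \<in> {S. S \<subseteq> {..<m} \<and> card S = k}"
        and eq: "\<psi> S = \<psi> S'"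
      then show "S = S'" using \<psi>[of S] \<psi>[of S'] chain_iter_inj[of S m S' "l - k" "\<psi> S"] by simp
    qed
  next
    show "\<forall>S. S \<subseteq> {..<m} \<and> card S = k \<longrightarrow> \<psi> S \<subseteq> {..<m} \<and> S \<subseteq> \<psi> S \<and> card (\<psi> S) = l"
    proof (intro allI impI)
      fix S assume "S \<subseteq> {..<m} \<and> card S = k"
      then show "\<psi> S \<subseteq> {..<m} \<and> S \<subseteq> \<psi> S \<and> card (\<psi> S) = l"
        using \<psi>[of S] chain_iter_step[of S m "l - k" "\<psi> S"] assms by simp
    qed
  qed
qed

section \<open>Families increasing under refinement\<close>

text \<open>The common features of effective characters and of nonnegative reals, the latter as
  functions on a one-point type.\<close>

locale effective_cone =
  fixes E :: "('i \<Rightarrow> 'r :: comm_ring_1) \<Rightarrow> bool"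
  assumes E_zero: "E (\<lambda>_. 0)"
    and E_add: "E x \<Longrightarrow> E y \<Longrightarrow> E (\<lambda>i. x i + y i)"
begin

definition le :: "('i \<Rightarrow> 'r) \<Rightarrow> ('i \<Rightarrow> 'r) \<Rightarrow> bool" where
  "le x y \<longleftrightarrow> E (\<lambda>i. y i - x i)"

lemma le_refl: "le x x"
  by (simp add: le_def E_zero)

lemma le_trans: "le x y \<Longrightarrow> le y z \<Longrightarrow> le x z"
  using E_add[of "\<lambda>i. z i - y i" "\<lambda>i. y i - x i"] by (simp add: le_def)

lemma E_sum: "(\<And>a. a \<in> A \<Longrightarrow> E (x a)) \<Longrightarrow> E (\<lambda>i. \<Sum>a\<in>A. x a i)"
  by (induction A rule: infinite_finite_induct) (auto simp: E_zero intro: E_add)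

lemma le_sum:
  assumes "\<And>a. a \<in> A \<Longrightarrow> le (x a) (y a)"
  shows "le (\<lambda>i. \<Sum>a\<in>A. x a i) (\<lambda>i. \<Sum>a\<in>A. y a i)"
  using E_sum[of A "\<lambda>a i. y a i - x a i"] assms by (simp add: le_def sum_subtractf)

end

text \<open>Only the split of a single part is assumed, since this is what merging two adjacent
  blocks yields.\<close>

locale increasing_family = effective_cone E
  for E :: "('i \<Rightarrow> 'r :: comm_ring_1) \<Rightarrow> bool" +
  fixes n :: nat and c :: "nat list \<Rightarrow> 'i \<Rightarrow> 'r"
  assumes E_c: "\<alpha> \<in> compositions n \<Longrightarrow> E (c \<alpha>)"
    and c_split: "L @ (a + b) # R \<in> compositions n \<Longrightarrow> a > 0 \<Longrightarrow> b > 0 \<Longrightarrow>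
      le (c (L @ (a + b) # R)) (c (L @ a # b # R))"
begin

text \<open>Entries of \<gamma> are split off one at a time; the sum of those that remain is
  positive, so every intermediate list is again a composition.\<close>

lemma c_split_part:
  "\<gamma> \<noteq> [] \<Longrightarrow> \<forall>x\<in>set \<gamma>. x > 0 \<Longrightarrow> L @ sum_list \<gamma> # R \<in> compositions n \<Longrightarrow>
     le (c (L @ sum_list \<gamma> # R)) (c (L @ \<gamma> @ R))"
proof (induction \<gamma> arbitrary: L)
  case (Cons a \<gamma>)
  show ?case
  proof (cases \<gamma>)
    case Nil
    then show ?thesis by (simp add: le_refl)
  next
    case (Cons b \<gamma>')
    then have pos: "a > 0" "sum_list \<gamma> > 0" using Cons.prems by auto
    have "le (c (L @ (a + sum_list \<gamma>) # R)) (c (L @ a # sum_list \<gamma> # R))"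
      using Cons.prems pos by (intro c_split) auto
    moreover have "le (c ((L @ [a]) @ sum_list \<gamma> # R)) (c ((L @ [a]) @ \<gamma> @ R))"
      using Cons.prems pos \<open>\<gamma> = b # \<gamma>'\<close> by (intro Cons.IH) (auto simp: compositions_def)
    ultimately show ?thesis using le_trans by simp
  qed
qed simp

text \<open>\<open>L\<close> holds the parts that have been refined already.\<close>

lemma c_refine_parts:
  "\<forall>\<gamma>\<in>set \<gamma>s. \<forall>x\<in>set \<gamma>. x > 0 \<Longrightarrow> L @ map sum_list \<gamma>s \<in> compositions n \<Longrightarrow>
     le (c (L @ map sum_list \<gamma>s)) (c (L @ concat \<gamma>s))"
proof (induction \<gamma>s arbitrary: L)
  case (Cons \<gamma> \<gamma>s)
  have "sum_list \<gamma> > 0" using Cons.prems(2) by (auto simp: compositions_def)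
  then have "\<gamma> \<noteq> []" by auto
  then have "le (c (L @ sum_list \<gamma> # map sum_list \<gamma>s)) (c (L @ \<gamma> @ map sum_list \<gamma>s))"
    using Cons.prems by (intro c_split_part) auto
  moreover have "le (c ((L @ \<gamma>) @ map sum_list \<gamma>s)) (c ((L @ \<gamma>) @ concat \<gamma>s))"
    using Cons.prems by (intro Cons.IH) (auto simp: compositions_def)
  ultimately show ?case using le_trans by simp
qed (simp add: le_refl)

lemma c_refine:
  assumes "refined_by \<alpha> \<beta>" and "\<alpha> \<in> compositions n" and "\<beta> \<in> compositions n"
  shows "le (c \<alpha>) (c \<beta>)"
proof -
  obtain \<gamma>s where "concat \<gamma>s = \<beta>" "map sum_list \<gamma>s = \<alpha>" using assms(1) by (auto simp: refined_by_def)
  then show ?thesis using c_refine_parts[of \<gamma>s "[]"] assms(2,3) by (auto simp: compositions_def)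
qed

text \<open>For the coefficients of an expansion into \<open>M\<^sub>\<alpha>\<close> this is the
  \<open>i\<close>-th entry of the f-vector, because the binomial weight of \<alpha> depends only on
  its number of parts.\<close>

definition level :: "nat \<Rightarrow> 'i \<Rightarrow> 'r" where
  "level i x = (\<Sum>\<alpha> | \<alpha> \<in> compositions n \<and> length \<alpha> = i. c \<alpha> x)"

lemma E_level: "E (level i)"
proof -
  have "E (\<lambda>x. \<Sum>\<alpha> | \<alpha> \<in> compositions n \<and> length \<alpha> = i. c \<alpha> x)" by (rule E_sum) (simp add: E_c)
  then show ?thesis by (simp add: level_def[abs_def])
qed

lemma level_zero_fun: "n \<noteq> 0 \<Longrightarrow> level 0 = (\<lambda>_. 0)"
  by (auto simp: level_def fun_eq_iff compositions_def intro!: sum.neutral)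

lemma length_composition_le: "\<alpha> \<in> compositions n \<Longrightarrow> length \<alpha> \<le> n"
proof -
  assume "\<alpha> \<in> compositions n"
  then have "\<forall>a\<in>set \<alpha>. a > 0" "sum_list \<alpha> = n" by (auto simp: compositions_def)
  moreover have "\<forall>a\<in>set \<alpha>. a > 0 \<Longrightarrow> length \<alpha> \<le> sum_list \<alpha>" for \<alpha> :: "nat list" by (induction \<alpha>) auto
  ultimately show ?thesis by auto
qed

lemma level_gt: "i > n \<Longrightarrow> level i = (\<lambda>_. 0)"
  using length_composition_le by (fastforce simp: level_def fun_eq_iff intro!: sum.neutral)

lemma level_subsets:
  assumes "n = Suc m"
  shows "level (Suc k) x = (\<Sum>S | S \<subseteq> {..<m} \<and> card S = k. c (subset_composition m S) x)"
  unfolding level_def unfolding assms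
  using sum.reindex_bij_betw[OF bij_subset_composition[of m k], of "\<lambda>\<alpha>. c \<alpha> x"] by simp

lemma c_insert:
  assumes "n = Suc m" and "x < m" and "x \<notin> S"
  shows "le (c (subset_composition m S)) (c (subset_composition m (insert x S)))"
proof -
  obtain L a b R where "subset_composition m S = L @ (a + b) # R"
    "subset_composition m (insert x S) = L @ a # b # R" "a > 0" "b > 0"
    using subset_composition_insert[OF assms(2,3)] by blast
  then show ?thesis using c_split subset_composition_compositions[of m S] assms(1) by metis
qed

lemma c_subset:
  assumes n: "n = Suc m" and "S \<subseteq> T" and "T \<subseteq> {..<m}"
  shows "le (c (subset_composition m S)) (c (subset_composition m T))"
proof -
  have "finite (T - S)" using assms(3) finite_subset by blast
  then have "(T - S) \<inter> S = {} \<Longrightarrow> T - S \<subseteq> {..<m} \<Longrightarrow> le (c (subset_composition m S)) (c (subset_composition m (S \<union> (T - S))))"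
  proof (induction "T - S" arbitrary: T rule: finite_induct)
    case empty
    then have "S \<union> (T - S) = S" by blast
    then show ?case by (simp add: le_refl)
  next
    case (insert x A)
    have A: "A = (S \<union> A) - S" using insert by blast
    have "le (c (subset_composition m S)) (c (subset_composition m (S \<union> (S \<union> A - S))))"
      using insert A by (intro insert(3)) auto
    moreover have "S \<union> (S \<union> A - S) = S \<union> A" by blast
    moreover have "le (c (subset_composition m (S \<union> A))) (c (subset_composition m (insert x (S \<union> A))))"
      using insert n by (intro c_insert) auto
    moreover have "insert x (S \<union> A) = S \<union> (T - S)" using insert(4) by blast
    ultimately show ?case using le_trans by metis
  qed
  moreover have "S \<union> (T - S) = T" using assms(2) by blast
  ultimately show ?thesis using assms(3) by auto
qed

text \<open>Double counting of pairs of a set \<open>S\<close> of \<open>k\<close> cuts and a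
  further place \<open>y\<close>, where \<open>i = Suc k\<close> and \<open>n = Suc m\<close>: a set
  \<open>S\<close> leaves \<open>m - k\<close>, that is \<open>n - i\<close>, places, and a set of
  \<open>Suc k\<close> cuts arises from \<open>i\<close> pairs. The pairs are compared one by one
  through \<open>c_insert\<close>.\<close>

lemma level_step:
  "le (\<lambda>x. (of_nat n - of_nat i) * level i x) (\<lambda>x. of_nat i * level (i + 1) x)"
proof -
  \<comment> \<open>Outside the range from 1 to \<open>n\<close> both sides vanish, because a level
    or the factor in front of it does. In particular the negative factor for \<open>i > n\<close> is
    harmless.\<close>
  consider "n = 0" "i = 0" | "n \<noteq> 0" "i = 0" | "i > n" | m k where "n = Suc m" "i = Suc k" "i \<le> n"
  proof (cases "i = 0 \<or> i > n")
    case False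
    then show ?thesis using that(4)[of "n - 1" "i - 1"] by simp
  qed (use that(1-3) in blast)
  then show ?thesis
  proof cases
    case 4
    define f where "f S = c (subset_composition m S)" for S
    define B where "B k = {S. S \<subseteq> {..<m} \<and> card S = k}" for k
    have finB: "finite (B k)" for k unfolding B_def by (rule finite_subset[of _ "Pow {..<m}"]) auto
    have finS: "finite S" if "S \<in> B k" for S k using that finite_subset by (auto simp: B_def)
    have "(of_nat n - of_nat i) * level i x = (\<Sum>(S, y)\<in>Sigma (B k) (\<lambda>S. {..<m} - S). f S x)" for x
    proof -
      have "(\<Sum>(S, y)\<in>Sigma (B k) (\<lambda>S. {..<m} - S). f S x) = (\<Sum>S\<in>B k. \<Sum>y\<in>{..<m} - S. f S x)"
        using finB finS by (subst sum.Sigma) auto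
      also have "\<dots> = (\<Sum>S\<in>B k. of_nat (m - k) * f S x)"
        using finS by (intro sum.cong) (auto simp: card_Diff_subset B_def)
      also have "\<dots> = of_nat (m - k) * level i x"
        unfolding 4(2) level_subsets[OF 4(1)] B_def f_def by (simp add: sum_distrib_left)
      also have "(of_nat (m - k) :: 'r) = of_nat n - of_nat i" using 4 by (simp add: of_nat_diff)
      finally show ?thesis by simp
    qed
    moreover have "of_nat i * level (i + 1) x = (\<Sum>(S, y)\<in>Sigma (B k) (\<lambda>S. {..<m} - S). f (insert y S) x)" for x
    proof -
      have "of_nat i * level (i + 1) x = (\<Sum>T\<in>B (Suc k). of_nat (Suc k) * f T x)"
        using 4 level_subsets[OF 4(1), of "Suc k"] by (simp add: B_def f_def sum_distrib_left)
      also have "\<dots> = (\<Sum>T\<in>B (Suc k). \<Sum>y\<in>T. f T x)"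
        by (intro sum.cong) (auto simp: B_def)
      also have "\<dots> = (\<Sum>(T, y)\<in>Sigma (B (Suc k)) (\<lambda>T. T). f T x)"
        using finB finS by (subst sum.Sigma) auto
      also have "\<dots> = (\<Sum>(S, y)\<in>Sigma (B k) (\<lambda>S. {..<m} - S). f (insert y S) x)"
      proof (rule sum.reindex_bij_witness[of _ "\<lambda>(S, y). (insert y S, y)" "\<lambda>(T, y). (T - {y}, y)"])
        fix p assume "p \<in> Sigma (B (Suc k)) (\<lambda>T. T)"
        then obtain T y where p: "p = (T, y)" "T \<in> B (Suc k)" "y \<in> T" by auto
        then show "(case (case p of (T, y) \<Rightarrow> (T - {y}, y)) of (S, y) \<Rightarrow> (insert y S, y)) = p"
          "(case p of (T, y) \<Rightarrow> (T - {y}, y)) \<in> Sigma (B k) (\<lambda>S. {..<m} - S)"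
          "(case case p of (T, y) \<Rightarrow> (T - {y}, y) of (S, y) \<Rightarrow> f (insert y S) x) = (case p of (T, y) \<Rightarrow> f T x)"
          using finS[OF p(2)] by (auto simp: B_def insert_absorb)
      next
        fix p assume "p \<in> Sigma (B k) (\<lambda>S. {..<m} - S)"
        then obtain S y where p: "p = (S, y)" "S \<in> B k" "y \<in> {..<m} - S" by auto
        then show "(case (case p of (S, y) \<Rightarrow> (insert y S, y)) of (T, y) \<Rightarrow> (T - {y}, y)) = p"
          "(case p of (S, y) \<Rightarrow> (insert y S, y)) \<in> Sigma (B (Suc k)) (\<lambda>T. T)"
          using finS[OF p(2)] by (auto simp: B_def)
      qed
      finally show ?thesis .
    qed
    moreover have "le (\<lambda>x. \<Sum>p\<in>Sigma (B k) (\<lambda>S. {..<m} - S). (case p of (S, y) \<Rightarrow> f S) x)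
       (\<lambda>x. \<Sum>p\<in>Sigma (B k) (\<lambda>S. {..<m} - S). (case p of (S, y) \<Rightarrow> f (insert y S)) x)"
    proof (rule le_sum)
      fix p assume "p \<in> Sigma (B k) (\<lambda>S. {..<m} - S)"
      then obtain S y where "p = (S, y)" "y < m" "y \<notin> S" by auto
      then show "le (case p of (S, y) \<Rightarrow> f S) (case p of (S, y) \<Rightarrow> f (insert y S))"
        using c_insert[OF 4(1)] by (simp add: f_def)
    qed
    ultimately show ?thesis by (simp add: case_prod_unfold)
  qed (auto simp: level_gt level_zero_fun le_refl)
qed

text \<open>With one cut fewer than parts, the bound \<open>i + j \<le> n + 1\<close> reads
  \<open>k + l \<le> m\<close>. Each term of level \<open>i\<close> is matched with a larger one of
  level \<open>j\<close>, and the terms that are not hit are effective. For \<open>n = 0\<close>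
  level 0 would hold the empty composition while level 1 is empty.\<close>

lemma level_le:
  assumes n: "n \<noteq> 0" and "i \<le> j" and "i + j \<le> n + 1"
  shows "le (level i) (level j)"
proof (cases i)
  case 0
  then show ?thesis using n E_level[of j] by (simp add: level_zero_fun le_def)
next
  case (Suc k)
  obtain m where m: "n = Suc m" using n by (cases n) auto
  obtain l where l: "j = Suc l" using Suc assms(2) by (cases j) auto
  define f where "f S = c (subset_composition m S)" for S
  define B where "B k = {S. S \<subseteq> {..<m} \<and> card S = k}" for k
  have finB: "finite (B k)" for k unfolding B_def by (rule finite_subset[of _ "Pow {..<m}"]) auto
  have "k \<le> l" "k + l \<le> m" using assms(2,3) Suc l m by auto
  then obtain \<psi> where inj: "inj_on \<psi> (B k)"
    and \<psi>: "\<forall>S. S \<subseteq> {..<m} \<and> card S = k \<longrightarrow> \<psi> S \<subseteq> {..<m} \<and> S \<subseteq> \<psi> S \<and> card (\<psi> S) = l"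
    unfolding B_def by (rule subset_level_injection)
  have le1: "le (\<lambda>x. \<Sum>S\<in>B k. f S x) (\<lambda>x. \<Sum>S\<in>B k. f (\<psi> S) x)"
    unfolding f_def using \<psi> by (intro le_sum c_subset[OF m]) (simp_all add: B_def)
  have le2: "le (\<lambda>x. \<Sum>S\<in>B k. f (\<psi> S) x) (\<lambda>x. \<Sum>T\<in>B l. f T x)"
  proof -
    have sub: "\<psi> ` B k \<subseteq> B l" using \<psi> by (auto simp: B_def)
    have "(\<Sum>T\<in>B l. f T x) - (\<Sum>S\<in>B k. f (\<psi> S) x) = (\<Sum>T\<in>B l - \<psi> ` B k. f T x)" for x
      unfolding sum_diff[OF finB sub] sum.reindex[OF inj] by (simp add: comp_def)
    moreover have "E (\<lambda>x. \<Sum>T\<in>B l - \<psi> ` B k. f T x)"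
      unfolding f_def m[symmetric]
      by (intro E_sum E_c) (simp add: m subset_composition_compositions)
    ultimately show ?thesis by (simp add: le_def)
  qed
  have "level i = (\<lambda>x. \<Sum>S\<in>B k. f S x)" "level j = (\<lambda>x. \<Sum>T\<in>B l. f T x)"
    unfolding Suc l B_def f_def by (rule ext, rule level_subsets[OF m])+
  with le_trans[OF le1 le2] show ?thesis by simp
qed

end

section \<open>Proper set compositions\<close>

text \<open>The rest of the list composes \<open>N - B\<close>, in the same recursion as the
  iterated coproduct.\<close>

fun set_composition :: "'a set \<Rightarrow> 'a set list \<Rightarrow> bool" where
  "set_composition N [] \<longleftrightarrow> N = {}"
| "set_composition N (B # C) \<longleftrightarrow> B \<noteq> {} \<and> B \<subseteq> N \<and> set_composition (N - B) C"

lemma set_composition_iff: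
  "set_composition N C \<longleftrightarrow> {} \<notin> set C \<and> \<Union>(set C) = N \<and> sorted_wrt (\<lambda>A B. A \<inter> B = {}) C"
proof (induction C arbitrary: N)
  case (Cons B C)
  have "B \<subseteq> N \<and> \<Union>(set C) = N - B \<longleftrightarrow> B \<union> \<Union>(set C) = N \<and> (\<forall>A\<in>set C. B \<inter> A = {})" by blast
  then show ?case using Cons[of "N - B"] by auto
qed auto

lemma set_composition_image:
  "inj_on \<sigma> N \<Longrightarrow> set_composition N C \<Longrightarrow> set_composition (\<sigma> ` N) (map ((`) \<sigma>) C)"
proof (induction C arbitrary: N)
  case (Cons B C)
  then have B: "B \<subseteq> N" by simp
  then have "\<sigma> ` N - \<sigma> ` B = \<sigma> ` (N - B)" using Cons.prems(1) by (auto simp: inj_on_def)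
  moreover have "inj_on \<sigma> (N - B)" using Cons.prems(1) by (rule inj_on_subset) auto
  ultimately show ?case using Cons by auto
qed simp

lemma set_composition_split_block:
  "set_composition N (L @ B # R) \<Longrightarrow> S \<subseteq> B \<Longrightarrow> S \<noteq> {} \<Longrightarrow> S \<noteq> B \<Longrightarrow>
     set_composition N (L @ S # (B - S) # R)"
proof (induction L arbitrary: N)
  case Nil
  then have "N - S - (B - S) = N - B" by auto
  with Nil show ?case by auto
qed auto

fun proper_composition ::
  "('a set \<Rightarrow> 'a set \<Rightarrow> 'h \<Rightarrow> ('h \<times> 'h) option) \<Rightarrow> ('a set \<Rightarrow> 'h \<Rightarrow> nat)
     \<Rightarrow> 'a set \<Rightarrow> 'a set list \<Rightarrow> 'h \<Rightarrow> bool"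
where
  "proper_composition \<Delta> \<phi> N [] h \<longleftrightarrow> True"
| "proper_composition \<Delta> \<phi> N [B] h \<longleftrightarrow> \<phi> B h = 1"
| "proper_composition \<Delta> \<phi> N (B # B' # C) h \<longleftrightarrow>
     (case \<Delta> B (N - B) h of
        None \<Rightarrow> False
      | Some (x, y) \<Rightarrow> \<phi> B x = 1 \<and> proper_composition \<Delta> \<phi> (N - B) (B' # C) y)"

lemma proper_composition_Cons:
  "C \<noteq> [] \<Longrightarrow> proper_composition \<Delta> \<phi> N (B # C) h \<longleftrightarrow>
     (\<exists>x y. \<Delta> B (N - B) h = Some (x, y) \<and> \<phi> B x = 1 \<and> proper_composition \<Delta> \<phi> (N - B) C y)"
  by (cases C) (auto split: option.splits)

text \<open>A product of natural numbers is 1 only if all factors are, so the condition can be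
  tested block by block.\<close>

lemma composition_character_eq_1_iff:
  "composition_character \<Delta> \<phi> N C h = 1 \<longleftrightarrow> proper_composition \<Delta> \<phi> N C h"
proof (induction \<Delta> N C h rule: iterated_coproduct.induct)
  case (3 \<Delta> N B B' C h)
  show ?case
  proof (cases "\<Delta> B (N - B) h")
    case None
    then show ?thesis by (simp add: composition_character_def)
  next
    case (Some p)
    obtain x y where p: "p = (x, y)" by (cases p)
    have "composition_character \<Delta> \<phi> N (B # B' # C) h
        = \<phi> B x * composition_character \<Delta> \<phi> (N - B) (B' # C) y"
    proof (cases "iterated_coproduct \<Delta> (N - B) (B' # C) y")
      case (Some hs)
      have "(\<Prod>i<length (B # B' # C). \<phi> ((B # B' # C) ! i) ((x # hs) ! i))
          = \<phi> B x * (\<Prod>i<length (B' # C). \<phi> ((B' # C) ! i) (hs ! i))"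
        by (simp only: length_Cons prod.lessThan_Suc_shift) simp
      then show ?thesis using Some \<open>\<Delta> B (N - B) h = Some p\<close> p
        by (simp add: composition_character_def del: prod.lessThan_Suc)
    qed (use Some p in \<open>simp add: composition_character_def\<close>)
    then show ?thesis using Some p 3[OF Some p[symmetric]] by simp
  qed
qed (simp_all add: composition_character_def)

section \<open>Coassociativity and naturality for nested label sets\<close>

context linearized_combinatorial_hopf_monoid
begin

lemma coproduct_parts:
  assumes "finite N" and "h \<in> H N" and "A \<subseteq> N" and "\<Delta> A (N - A) h = Some (x, y)"
  shows "x \<in> H A" and "y \<in> H (N - A)"
proof -
  have "A \<union> (N - A) = N" using assms(3) by blast
  then show "x \<in> H A" "y \<in> H (N - A)"
    using coproduct_closed[of A "N - A" h x y] assms finite_subset by auto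
qed

lemma coassociative_subsets:
  assumes "finite N" and "h \<in> H N" and "A \<subseteq> B" and "B \<subseteq> N"
  shows "Option.bind (\<Delta> B (N - B) h) (\<lambda>(u, z). map_option (\<lambda>(x, y). (x, y, z)) (\<Delta> A (B - A) u))
       = Option.bind (\<Delta> A (N - A) h) (\<lambda>(x, v). map_option (\<lambda>(y, z). (x, y, z)) (\<Delta> (B - A) (N - B) v))"
proof -
  have "A \<union> (B - A) = B" "(B - A) \<union> (N - B) = N - A" "A \<union> (B - A) \<union> (N - B) = N"
    using assms by auto
  moreover have "finite B" using assms finite_subset by blast
  moreover have "finite A" using \<open>finite B\<close> assms(3) by (rule rev_finite_subset)
  moreover have "A \<inter> (B - A) = {}" "A \<inter> (N - B) = {}" "(B - A) \<inter> (N - B) = {}" using assms(3) by auto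
  ultimately show ?thesis
    using coassociative[of A "B - A" "N - B" h] assms(1,2) by simp
qed

text \<open>Coassociativity along \<open>A \<subseteq> B \<subseteq> N\<close>: cutting the
  restriction to \<open>B\<close> at \<open>A\<close> amounts to cutting \<open>h\<close> at
  \<open>A\<close> and then the contraction at \<open>B - A\<close>. The cut of \<open>h\<close> at
  \<open>A\<close> is thereby nonzero.\<close>

lemma restrict_then_contract:
  assumes "finite N" and "h \<in> H N" and "A \<subseteq> B" and "B \<subseteq> N"
    and "\<Delta> B (N - B) h = Some (u, z)" and "\<Delta> A (B - A) u = Some (x, y)"
  shows "\<exists>v. \<Delta> A (N - A) h = Some (x, v) \<and> \<Delta> (B - A) (N - B) v = Some (y, z)"
proof -
  have "Option.bind (\<Delta> A (N - A) h)
      (\<lambda>(x, v). map_option (\<lambda>(y, z). (x, y, z)) (\<Delta> (B - A) (N - B) v)) = Some (x, y, z)"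
    unfolding coassociative_subsets[OF assms(1-4), symmetric] by (simp add: assms(5,6))
  then show ?thesis by (auto simp: bind_eq_Some_conv)
qed

text \<open>The converse direction: a cut of the contraction by \<open>A\<close> produces a nonzero
  cut of \<open>h\<close> at the larger set \<open>B\<close>.\<close>

lemma contract_then_restrict:
  assumes "finite N" and "h \<in> H N" and "A \<subseteq> B" and "B \<subseteq> N"
    and "\<Delta> A (N - A) h = Some (x, v)" and "\<Delta> (B - A) (N - B) v = Some (y, z)"
  shows "\<exists>u. \<Delta> B (N - B) h = Some (u, z) \<and> \<Delta> A (B - A) u = Some (x, y)"
proof -
  have "Option.bind (\<Delta> B (N - B) h)
      (\<lambda>(u, z). map_option (\<lambda>(x, y). (x, y, z)) (\<Delta> A (B - A) u)) = Some (x, y, z)"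
    unfolding coassociative_subsets[OF assms(1-4)] by (simp add: assms(5,6))
  then show ?thesis by (auto simp: bind_eq_Some_conv)
qed

text \<open>Naturality, applied block by block. For an automorphism of \<open>h\<close> the
  relabelled structure is \<open>h\<close> itself, so automorphisms permute the proper
  compositions.\<close>

lemma proper_composition_image:
  assumes "finite N" and "h \<in> H N" and "inj_on \<sigma> N" and "set_composition N C"
    and "proper_composition \<Delta> \<phi> N C h"
  shows "proper_composition \<Delta> \<phi> (\<sigma> ` N) (map ((`) \<sigma>) C) (relabel N \<sigma> h)"
  using assms
proof (induction C arbitrary: N h)
  case (Cons B C)
  then have B: "B \<subseteq> N" by simp
  show ?case
  proof (cases "C = []")
    case True
    then have "B = N" using Cons.prems(4) by auto
    then show ?thesis using True Cons.prems character_natural by simp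
  next
    case False
    obtain x y where xy: "\<Delta> B (N - B) h = Some (x, y)" "\<phi> B x = 1" "proper_composition \<Delta> \<phi> (N - B) C y"
      using Cons.prems(5) False by (auto simp: proper_composition_Cons)
    have mem: "x \<in> H B" "y \<in> H (N - B)" using coproduct_parts[OF Cons.prems(1,2) B xy(1)] by auto
    have fin: "finite B" using B Cons.prems(1) finite_subset by blast
    have inj: "inj_on \<sigma> B" "inj_on \<sigma> (N - B)" using Cons.prems(3) B inj_on_subset by blast+
    have diff: "\<sigma> ` N - \<sigma> ` B = \<sigma> ` (N - B)" using Cons.prems(3) B by (auto simp: inj_on_def)
    have un: "B \<union> (N - B) = N" using B by blast
    have "\<Delta> (\<sigma> ` B) (\<sigma> ` (N - B)) (relabel N \<sigma> h) = Some (relabel B \<sigma> x, relabel (N - B) \<sigma> y)"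
      using coproduct_natural[of B "N - B" \<sigma> h] Cons.prems fin un xy(1) by simp
    moreover have "\<phi> (\<sigma> ` B) (relabel B \<sigma> x) = 1" using character_natural[OF fin inj(1) mem(1)] xy(2) by simp
    moreover have "proper_composition \<Delta> \<phi> (\<sigma> ` (N - B)) (map ((`) \<sigma>) C) (relabel (N - B) \<sigma> y)"
      using Cons.prems mem inj xy(3) by (intro Cons.IH) auto
    ultimately show ?thesis using False diff by (simp add: proper_composition_Cons)
  qed
qed simp

end

section \<open>Cuts of prescribed size\<close>

context balanced_convex_character
begin

text \<open>Balancedness gives a cut at some \<open>T\<close>. If \<open>s\<close> is at most
  \<open>card T\<close>, cut the restriction to \<open>T\<close>; otherwise cut the contraction at
  size \<open>s - card T\<close> and adjoin \<open>T\<close>. Coassociativity turns either into a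
  cut of \<open>h\<close>. The sizes 0 and \<open>card N\<close> come from the counit.\<close>

lemma coproduct_of_size:
  "finite N \<Longrightarrow> h \<in> H N \<Longrightarrow> s \<le> card N \<Longrightarrow> \<exists>S\<subseteq>N. card S = s \<and> \<Delta> S (N - S) h \<noteq> None"
proof (induction "card N" arbitrary: N h s rule: less_induct)
  case less
  obtain e where e: "e \<in> H {}" using connected by (metis card_1_singletonE singletonI)
  consider "s = 0" | "s = card N" | "0 < s" "s < card N" using less.prems(3) by linarith
  then show ?case
  proof cases
    case 1
    then show ?thesis using left_counit[OF less.prems(1) e less.prems(2)] by (intro exI[of _ "{}"]) simp
  next
    case 2
    then show ?thesis using right_counit[OF less.prems(1) e less.prems(2)] by (intro exI[of _ N]) simp
  next
    case 3
    then obtain T where T: "T \<noteq> {}" "T \<subset> N" "\<Delta> T (N - T) h \<noteq> None"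
      using balanced[OF less.prems(1,2)] by auto
    then obtain x y where xy: "\<Delta> T (N - T) h = Some (x, y)" by auto
    have TN: "T \<subseteq> N" using T by blast
    have finT: "finite T" using TN less.prems(1) finite_subset by blast
    note mem = coproduct_parts[OF less.prems(1,2) TN xy]
    have cards: "card T < card N" "card (N - T) < card N" "card (N - T) = card N - card T"
    proof -
      show "card T < card N" using less.prems(1) T(2) by (rule psubset_card_mono)
      have "N - T \<subset> N" using T(1) TN by blast
      with less.prems(1) show "card (N - T) < card N" by (rule psubset_card_mono)
      show "card (N - T) = card N - card T" using finT TN by (rule card_Diff_subset)
    qed
    show ?thesis
    proof (cases "s \<le> card T")
      case True
      have "\<exists>S\<subseteq>T. card S = s \<and> \<Delta> S (T - S) x \<noteq> None"
        by (rule less.hyps[OF cards(1) finT mem(1) True])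
      then obtain S a b where S: "S \<subseteq> T" "card S = s" "\<Delta> S (T - S) x = Some (a, b)" by auto
      obtain v where "\<Delta> S (N - S) h = Some (a, v)"
        using restrict_then_contract[OF less.prems(1,2) S(1) TN xy S(3)] by (elim exE conjE)
      then show ?thesis using S(1,2) TN by (intro exI[of _ S]) auto
    next
      case False
      have fin: "finite (N - T)" using less.prems(1) by simp
      have "s - card T \<le> card (N - T)" using 3 cards by simp
      then have "\<exists>S\<subseteq>N - T. card S = s - card T \<and> \<Delta> S (N - T - S) y \<noteq> None"
        by (rule less.hyps[OF cards(2) fin mem(2)])
      then obtain S a b where S: "S \<subseteq> N - T" "card S = s - card T" "\<Delta> S (N - T - S) y = Some (a, b)"
        by auto
      have eq: "T \<union> S - T = S" "N - (T \<union> S) = N - T - S" using S(1) by auto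
      have sub: "T \<subseteq> T \<union> S" "T \<union> S \<subseteq> N" using S(1) TN by auto
      have "\<Delta> (T \<union> S - T) (N - (T \<union> S)) y = Some (a, b)" unfolding eq by (rule S(3))
      from contract_then_restrict[OF less.prems(1,2) sub xy this]
      obtain u where "\<Delta> (T \<union> S) (N - (T \<union> S)) h = Some (u, b)" by (elim exE conjE)
      then have "\<Delta> (T \<union> S) (N - (T \<union> S)) h \<noteq> None" by simp
      moreover have "card (T \<union> S) = s"
        using S False finT finite_subset[OF S(1)] less.prems(1) by (subst card_Un_disjoint) auto
      ultimately show ?thesis using S(1) TN by (intro exI[of _ "T \<union> S"]) auto
    qed
  qed
qed

text \<open>Cutting the structure on \<open>B\<close> at size \<open>s\<close> keeps both characters
  1 by convexity, and coassociativity makes the result a refinement of the iterated coproduct of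
  \<open>h\<close>. Blocks before \<open>B\<close> are passed by induction on \<open>L\<close>.
  Empty pieces are allowed here.\<close>

lemma proper_composition_split_block:
  "finite N \<Longrightarrow> h \<in> H N \<Longrightarrow> set_composition N (L @ B # R) \<Longrightarrow> proper_composition \<Delta> \<phi> N (L @ B # R) h \<Longrightarrow>
     s \<le> card B \<Longrightarrow> \<exists>S\<subseteq>B. card S = s \<and> proper_composition \<Delta> \<phi> N (L @ S # (B - S) # R) h"
proof (induction L arbitrary: N h)
  case Nil
  then have BN: "B \<subseteq> N" by simp
  then have finB: "finite B" using Nil.prems(1) finite_subset by blast
  show ?case
  proof (cases "R = []")
    \<comment> \<open>A last block carries all of \<open>h\<close>; no coproduct separates it from
      further blocks.\<close>
    case True
    then have "B = N" using Nil.prems(3) by auto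
    obtain S where S: "S \<subseteq> B" "card S = s" "\<Delta> S (B - S) h \<noteq> None"
      using coproduct_of_size[OF finB _ Nil.prems(5), of h] Nil.prems(2) \<open>B = N\<close> by blast
    then obtain x y where xy: "\<Delta> S (B - S) h = Some (x, y)" by auto
    then have "\<phi> S x = 1 \<and> \<phi> (B - S) y = 1"
      using convex[OF finB _ _ S(1) xy] Nil.prems(2,4) True \<open>B = N\<close> by simp
    then show ?thesis using S(1,2) xy True \<open>B = N\<close> by (intro exI[of _ S]) simp
  next
    case False
    obtain u z where uz: "\<Delta> B (N - B) h = Some (u, z)" "\<phi> B u = 1" "proper_composition \<Delta> \<phi> (N - B) R z"
      using Nil.prems(4) False by (auto simp: proper_composition_Cons)
    have u: "u \<in> H B" using coproduct_parts[OF Nil.prems(1,2) BN uz(1)] by simp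
    obtain S where S: "S \<subseteq> B" "card S = s" "\<Delta> S (B - S) u \<noteq> None"
      using coproduct_of_size[OF finB u Nil.prems(5)] by blast
    then obtain x y where xy: "\<Delta> S (B - S) u = Some (x, y)" by auto
    have \<phi>: "\<phi> S x = 1 \<and> \<phi> (B - S) y = 1" using convex[OF finB u uz(2) S(1) xy] .
    obtain v where v: "\<Delta> S (N - S) h = Some (x, v)" "\<Delta> (B - S) (N - B) v = Some (y, z)"
      using restrict_then_contract[OF Nil.prems(1,2) S(1) BN uz(1) xy] by blast
    have "N - S - (B - S) = N - B" using S(1) BN by blast
    then show ?thesis using S(1,2) v \<phi> uz(3) False
      by (intro exI[of _ S]) (simp add: proper_composition_Cons)
  qed
next
  case (Cons A L)
  then have AN: "A \<subseteq> N" by simp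
  obtain x y where xy: "\<Delta> A (N - A) h = Some (x, y)" "\<phi> A x = 1" "proper_composition \<Delta> \<phi> (N - A) (L @ B # R) y"
    using Cons.prems(4) by (auto simp: proper_composition_Cons)
  have y: "y \<in> H (N - A)" using coproduct_parts[OF Cons.prems(1,2) AN xy(1)] by simp
  obtain S where "S \<subseteq> B" "card S = s" "proper_composition \<Delta> \<phi> (N - A) (L @ S # (B - S) # R) y"
    using Cons.IH[OF _ y _ xy(3) Cons.prems(5)] Cons.prems(1,3) by auto
  then show ?case using xy by (intro exI[of _ S]) (simp add: proper_composition_Cons)
qed

text \<open>One element is cut off at a time, and the character is always 1 on singletons. The
  resulting composition makes the top entry of the f-vector nonzero, so that the degree is
  \<open>card N\<close>.\<close>

lemma proper_flag_exists:
  "finite N \<Longrightarrow> h \<in> H N \<Longrightarrow>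
     \<exists>C. set_composition N C \<and> proper_composition \<Delta> \<phi> N C h \<and> map card C = replicate (card N) 1"
proof (induction "card N" arbitrary: N h)
  case 0
  then have "N = {}" by simp
  then show ?case by (intro exI[of _ "[]"]) simp
next
  case (Suc n)
  show ?case
  proof (cases "n = 0")
    case True
    then have "card N = 1" "N \<noteq> {}" using Suc(2) by auto
    then show ?thesis using singleton[OF Suc.prems] by (intro exI[of _ "[N]"]) simp
  next
    case False
    obtain S where S: "S \<subseteq> N" "card S = 1" "\<Delta> S (N - S) h \<noteq> None"
      using coproduct_of_size[OF Suc.prems, of 1] Suc(2) by auto
    then obtain x y where xy: "\<Delta> S (N - S) h = Some (x, y)" by auto
    note mem = coproduct_parts[OF Suc.prems S(1) xy]
    have finS: "finite S" using S(1) Suc.prems(1) finite_subset by blast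
    have card: "n = card (N - S)" using S Suc(2) finS by (simp add: card_Diff_subset)
    obtain C where C: "set_composition (N - S) C" "proper_composition \<Delta> \<phi> (N - S) C y"
      "map card C = replicate (card (N - S)) 1"
      using Suc(1)[OF card _ mem(2)] Suc.prems(1) by auto
    have "C \<noteq> []" using C(3) card False by auto
    moreover have "S \<noteq> {}" using S(2) by auto
    moreover have "\<phi> S x = 1" by (rule singleton[OF finS mem(1) S(2)])
    moreover have "card N = Suc (card (N - S))" using card Suc(2) by simp
    ultimately show ?thesis using C S xy by (intro exI[of _ "S # C"]) (simp add: proper_composition_Cons)
  qed
qed

end

section \<open>Orbits\<close>

lemma orbit_eq_image: "orbit G act x = (\<lambda>g. act g x) ` carrier G"
  by (auto simp: orbit_def)

lemma orbit_equivariant: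
  assumes "\<And>g. g \<in> carrier G \<Longrightarrow> p (act g y) = act' g (p y)"
  shows "orbit G act' (p y) = p ` orbit G act y"
  unfolding orbit_eq_image image_image using assms by (intro image_cong) simp_all

lemma orbits_eq_image: "orbits G E act = orbit G act ` E"
  by (auto simp: orbits_def)

lemma orbits_equivariant:
  assumes "p ` Y = X" and "\<And>g y. g \<in> carrier G \<Longrightarrow> y \<in> Y \<Longrightarrow> p (act g y) = act' g (p y)"
  shows "orbits G X act' = (`) p ` orbits G Y act"
proof -
  have "orbit G act' (p y) = p ` orbit G act y" if "y \<in> Y" for y
    using assms(2) that by (intro orbit_equivariant)
  then show ?thesis unfolding orbits_eq_image assms(1)[symmetric] image_image by (intro image_cong) simp_all
qed

text \<open>The counterpart for orbits of the comparison of permutation characters: \<open>p\<close>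
  sends orbits onto orbits, and orbits of points of \<open>Y\<close> are orbits in
  \<open>Z\<close>.\<close>

lemma card_orbits_le:
  assumes "finite Z" and "Y \<subseteq> Z" and "p ` Y = X"
    and "\<And>g y. g \<in> carrier G \<Longrightarrow> y \<in> Y \<Longrightarrow> p (act g y) = act' g (p y)"
  shows "card (orbits G X act') \<le> card (orbits G Z act)"
proof -
  have fin: "finite (orbits G Z act)" using assms(1) by (simp add: orbits_eq_image)
  have sub: "orbits G Y act \<subseteq> orbits G Z act" using assms(2) by (auto simp: orbits_eq_image)
  have eq: "orbits G X act' = (`) p ` orbits G Y act"
    by (rule orbits_equivariant) (use assms(3,4) in auto)
  have "card (orbits G X act') \<le> card (orbits G Y act)"
    unfolding eq by (rule card_image_le[OF finite_subset[OF sub fin]])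
  also have "\<dots> \<le> card (orbits G Z act)" using fin sub by (rule card_mono)
  finally show ?thesis .
qed

lemma card_orbits_bij:
  assumes bij: "bij_betw p Y X" and closed: "\<And>g y. g \<in> carrier G \<Longrightarrow> y \<in> Y \<Longrightarrow> act g y \<in> Y"
    and equiv: "\<And>g y. g \<in> carrier G \<Longrightarrow> y \<in> Y \<Longrightarrow> p (act g y) = act' g (p y)"
  shows "card (orbits G X act') = card (orbits G Y act)"
proof -
  have "orbits G Y act \<subseteq> Pow Y" using closed by (auto simp: orbits_eq_image orbit_def)
  moreover have "inj_on ((`) p) (Pow Y)"
    using bij_betw_imp_inj_on[OF bij] by (rule inj_on_image_Pow)
  ultimately have "inj_on ((`) p) (orbits G Y act)" by (rule inj_on_subset[rotated])
  moreover have "orbits G X act' = (`) p ` orbits G Y act"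
    by (rule orbits_equivariant) (use bij_betw_imp_surj_on[OF bij] equiv in auto)
  ultimately show ?thesis by (simp add: card_image)
qed

section \<open>Functions and their level compositions\<close>

lemma set_mset_function_monomial: "finite N \<Longrightarrow> set_mset (function_monomial N f) = f ` N"
  by (simp add: function_monomial_def)

lemma size_function_monomial: "size (function_monomial N f) = card N"
  by (simp add: function_monomial_def)

lemma monomial_type_function_monomial:
  assumes "finite N"
  shows "monomial_type (function_monomial N f) = map card (level_composition N f)"
proof -
  have "count (function_monomial N f) i = card {v \<in> N. f v = i}" for i
  proof -
    have "count (function_monomial N f) i = (\<Sum>v | v \<in> N \<and> i = f v. count (mset_set N) v)"
      using assms by (simp add: function_monomial_def count_image_mset')
    also have "\<dots> = (\<Sum>v | v \<in> N \<and> f v = i. 1)"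
      using assms by (intro sum.cong) auto
    finally show ?thesis by simp
  qed
  then show ?thesis
    using assms by (simp add: monomial_type_def level_composition_def set_mset_function_monomial comp_def)
qed

lemma set_composition_level_composition:
  assumes "finite N"
  shows "set_composition N (level_composition N f)"
proof -
  let ?is = "sorted_list_of_set (f ` N)"
  have "sorted_wrt (\<lambda>i j. {v \<in> N. f v = i} \<inter> {v \<in> N. f v = j} = {}) ?is"
    by (rule sorted_wrt_mono_rel[of _ "(<)"]) auto
  then show ?thesis
    using assms by (auto simp: set_composition_iff level_composition_def sorted_wrt_map)
qed

text \<open>The list of level sets records only the order of the values, hence the condition on the
  images.\<close>

lemma level_composition_inj:
  assumes fin: "finite N" and f: "f \<in> N \<rightarrow>\<^sub>E UNIV" "f' \<in> N \<rightarrow>\<^sub>E UNIV"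
    and im: "f ` N = f' ` N" and eq: "level_composition N f = level_composition N f'"
  shows "f = f'"
proof
  fix v
  show "f v = f' v"
  proof (cases "v \<in> N")
    case True
    then have "f v \<in> set (sorted_list_of_set (f ` N))" using fin by simp
    moreover have "\<forall>i\<in>set (sorted_list_of_set (f ` N)). {w \<in> N. f w = i} = {w \<in> N. f' w = i}"
      using eq by (simp add: level_composition_def im)
    ultimately have same: "{w \<in> N. f w = f v} = {w \<in> N. f' w = f v}" by blast
    have "v \<in> {w \<in> N. f w = f v}" using True by simp
    then have "v \<in> {w \<in> N. f' w = f v}" by (simp only: same)
    then show ?thesis by simp
  next
    case False
    then show ?thesis using f by (auto simp: PiE_def extensional_def)
  qed
qed

lemma level_composition_surj:
  assumes fin: "finite N" and C: "set_composition N C" and "finite I" and "card I = length C"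
  obtains f where "f \<in> N \<rightarrow>\<^sub>E UNIV" "f ` N = I" "level_composition N f = C"
proof -
  let ?is = "sorted_list_of_set I"
  have len: "length ?is = length C" using assms(4) by simp
  from C have ne: "{} \<notin> set C" and un: "\<Union>(set C) = N" and disj: "sorted_wrt (\<lambda>A B. A \<inter> B = {}) C"
    by (auto simp: set_composition_iff)
  have disj': "i = j" if "i < length C" "j < length C" "v \<in> C ! i" "v \<in> C ! j" for i j v
    using sorted_wrt_nth_less[OF disj, of i j] sorted_wrt_nth_less[OF disj, of j i] that
    by (cases i j rule: linorder_cases) auto
  have ex: "\<exists>i<length C. v \<in> C ! i" if "v \<in> N" for v
    using that un by (auto simp: in_set_conv_nth)
  \<comment> \<open>The index of the block that contains \<open>v\<close>, unique by disjointness;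
    the function will send \<open>v\<close> to the element of \<open>I\<close> with this
    rank.\<close>
  define pos where "pos v = (SOME i. i < length C \<and> v \<in> C ! i)" for v
  have pos: "pos v < length C" "v \<in> C ! pos v" if "v \<in> N" for v
    using someI_ex[OF ex[OF that, unfolded Bex_def]] by (simp_all add: pos_def)
  have posI: "pos v = i" if "i < length C" "v \<in> C ! i" for v i
  proof -
    have "v \<in> N" using that nth_mem[OF that(1)] un by blast
    then show ?thesis using pos disj' that by blast
  qed
  define f where "f = (\<lambda>v\<in>N. ?is ! pos v)"
  have block: "{v \<in> N. f v = ?is ! i} = C ! i" if i: "i < length C" for i
  proof -
    have "f v = ?is ! i \<longleftrightarrow> v \<in> C ! i" if v: "v \<in> N" for v
    proof -
      have "f v = ?is ! i \<longleftrightarrow> pos v = i"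
        using v i pos(1)[OF v] len by (simp add: f_def nth_eq_iff_index_eq)
      then show ?thesis using posI[OF i] pos(2)[OF v] by blast
    qed
    moreover have "C ! i \<subseteq> N" using nth_mem[OF i] un by blast
    ultimately show ?thesis by blast
  qed
  have im: "f ` N = I"
  proof
    show "f ` N \<subseteq> I"
    proof
      fix k assume "k \<in> f ` N"
      then obtain v where "v \<in> N" "k = ?is ! pos v" by (auto simp: f_def)
      then have "k \<in> set ?is" using pos(1) len by simp
      then show "k \<in> I" using assms(3) by simp
    qed
    show "I \<subseteq> f ` N"
    proof
      fix k assume "k \<in> I"
      then have "k \<in> set ?is" using assms(3) by simp
      then obtain i where i: "i < length C" "k = ?is ! i" using len by (metis in_set_conv_nth)
      have "C ! i \<noteq> {}" using ne i(1) nth_mem by metis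
      then obtain v where "v \<in> N" "f v = k" using block[OF i(1)] i(2) by blast
      then show "k \<in> f ` N" by blast
    qed
  qed
  have "level_composition N f = C"
    unfolding level_composition_def im using len block by (intro nth_equalityI) auto
  then show thesis using that[of f] im by (simp add: f_def)
qed

definition proper_compositions ::
  "('a set \<Rightarrow> 'a set \<Rightarrow> 'h \<Rightarrow> ('h \<times> 'h) option) \<Rightarrow> ('a set \<Rightarrow> 'h \<Rightarrow> nat)
     \<Rightarrow> 'a set \<Rightarrow> 'h \<Rightarrow> nat list \<Rightarrow> 'a set list set"
where
  "proper_compositions \<Delta> \<phi> N h \<alpha> =
     {C. set_composition N C \<and> proper_composition \<Delta> \<phi> N C h \<and> map card C = \<alpha>}"

lemma proper_functions_iff:
  "f \<in> proper_functions \<Delta> \<phi> N h \<longleftrightarrow>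
     f \<in> N \<rightarrow>\<^sub>E UNIV \<and> proper_composition \<Delta> \<phi> N (level_composition N f) h"
  by (simp only: proper_functions_def mem_Collect_eq composition_character_eq_1_iff)

text \<open>The monomial prescribes the set of values and how often each is taken; what remains free
  is the list of level sets.\<close>

lemma bij_level_composition:
  assumes fin: "finite N"
  shows "bij_betw (level_composition N) {f \<in> proper_functions \<Delta> \<phi> N h. function_monomial N f = m}
           (proper_compositions \<Delta> \<phi> N h (monomial_type m))"
  unfolding bij_betw_def
proof (intro conjI inj_onI equalityI subsetI)
  fix f f' assume "f \<in> {f \<in> proper_functions \<Delta> \<phi> N h. function_monomial N f = m}"
    "f' \<in> {f \<in> proper_functions \<Delta> \<phi> N h. function_monomial N f = m}"
    "level_composition N f = level_composition N f'"
  then show "f = f'"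
    using set_mset_function_monomial[OF fin, of f] set_mset_function_monomial[OF fin, of f']
    by (intro level_composition_inj[OF fin]) (auto simp: proper_functions_iff)
next
  fix C assume "C \<in> level_composition N ` {f \<in> proper_functions \<Delta> \<phi> N h. function_monomial N f = m}"
  then show "C \<in> proper_compositions \<Delta> \<phi> N h (monomial_type m)"
    using fin by (auto simp: proper_compositions_def proper_functions_iff
        set_composition_level_composition monomial_type_function_monomial)
next
  fix C assume C: "C \<in> proper_compositions \<Delta> \<phi> N h (monomial_type m)"
  have "card (set_mset m) = length (monomial_type m)" by (simp add: monomial_type_def)
  also have "monomial_type m = map card C" using C by (simp add: proper_compositions_def)
  finally have "card (set_mset m) = length C" by simp
  then obtain f where f: "f \<in> N \<rightarrow>\<^sub>E UNIV" "f ` N = set_mset m" "level_composition N f = C"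
    using level_composition_surj[OF fin _ finite_set_mset] C unfolding proper_compositions_def by blast
  have "function_monomial N f = m"
    using C f by (intro monomial_determined)
      (simp_all add: fin set_mset_function_monomial monomial_type_function_monomial proper_compositions_def)
  then show "C \<in> level_composition N ` {f \<in> proper_functions \<Delta> \<phi> N h. function_monomial N f = m}"
    using C f by (intro image_eqI[of _ _ f])
      (auto simp: proper_functions_iff proper_compositions_def)
qed

text \<open>The two blocks are chosen by position, which the action on blocks does not change;
  merging is therefore equivariant.\<close>

definition merge_blocks :: "nat \<Rightarrow> 'a set list \<Rightarrow> 'a set list" where
  "merge_blocks p C = take p C @ (C ! p \<union> C ! Suc p) # drop (Suc (Suc p)) C"

lemma map_image_merge_blocks:
  "Suc p < length C \<Longrightarrow> map ((`) g) (merge_blocks p C) = merge_blocks p (map ((`) g) C)"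
  by (simp add: merge_blocks_def take_map drop_map image_Un)

section \<open>Symmetries\<close>

text \<open>The action of \<open>k\<close> carries the fixed points of \<open>g\<close> onto those
  of its conjugate by \<open>k\<close>.\<close>

lemma (in finite_action) class_function_fixed_points:
  "class_function G (\<lambda>g. of_nat (card {z \<in> Z. act g z = z}))"
  unfolding class_function_def
proof (intro ballI)
  fix g k assume g: "g \<in> carrier G" and k: "k \<in> carrier G"
  have "bij_betw (act k) {z \<in> Z. act g z = z} {z \<in> Z. act (k \<otimes> g \<otimes> inv k) z = z}"
  proof (rule bij_betw_byWitness[where f' = "act (inv k)"])
    show "act k ` {z \<in> Z. act g z = z} \<subseteq> {z \<in> Z. act (k \<otimes> g \<otimes> inv k) z = z}"
      using g k by (auto simp: act_closed act_mult act_inv_act)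
    show "act (inv k) ` {z \<in> Z. act (k \<otimes> g \<otimes> inv k) z = z} \<subseteq> {z \<in> Z. act g z = z}"
    proof
      fix w assume "w \<in> act (inv k) ` {z \<in> Z. act (k \<otimes> g \<otimes> inv k) z = z}"
      then obtain z where z: "z \<in> Z" "act (k \<otimes> g \<otimes> inv k) z = z" "w = act (inv k) z" by auto
      have w: "w \<in> Z" using z k by (simp add: act_closed)
      have "act k (act g w) = z" using z g k by (simp add: act_mult act_closed)
      then have "act g w = w" using z(3) act_inv_act[OF k, of "act g w"] g w by (simp add: act_closed)
      then show "w \<in> {z \<in> Z. act g z = z}" using w by simp
    qed
  qed (use k in \<open>auto simp: act_inv_act act_act_inv\<close>)
  then show "of_nat (card {z \<in> Z. act (k \<otimes> g \<otimes> inv k) z = z}) = of_nat (card {z \<in> Z. act g z = z})"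
    by (simp add: bij_betw_same_card)
qed

definition block_action :: "('a \<Rightarrow> 'a) \<Rightarrow> 'a set list \<Rightarrow> 'a set list" where
  "block_action g = map ((`) g)"

locale hopf_symmetry = balanced_convex_character H relabel \<mu> \<Delta> \<phi>
  for H :: "'a set \<Rightarrow> 'h set"
    and relabel :: "'a set \<Rightarrow> ('a \<Rightarrow> 'a) \<Rightarrow> 'h \<Rightarrow> 'h"
    and \<mu> :: "'a set \<Rightarrow> 'a set \<Rightarrow> 'h \<Rightarrow> 'h \<Rightarrow> 'h"
    and \<Delta> :: "'a set \<Rightarrow> 'a set \<Rightarrow> 'h \<Rightarrow> ('h \<times> 'h) option"
    and \<phi> :: "'a set \<Rightarrow> 'h \<Rightarrow> nat" +
  fixes N :: "'a set" and h :: 'h and K :: "('a \<Rightarrow> 'a) set"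
  assumes finite_N: "finite N" and h_mem: "h \<in> H N"
    and K_subgroup: "subgroup K (BijGroup N)" and K_Aut: "K \<subseteq> Aut relabel N h"
begin

abbreviation G :: "('a \<Rightarrow> 'a) monoid" where "G \<equiv> (BijGroup N)\<lparr>carrier := K\<rparr>"
abbreviation F :: "('a \<Rightarrow> nat) set" where "F \<equiv> proper_functions \<Delta> \<phi> N h"
abbreviation X :: "nat list \<Rightarrow> 'a set list set" where "X \<equiv> proper_compositions \<Delta> \<phi> N h"
abbreviation F_monomial :: "nat multiset \<Rightarrow> ('a \<Rightarrow> nat) set" where
  "F_monomial m \<equiv> {f \<in> F. function_monomial N f = m}"

lemma group_G: "group G"
  using subgroup.subgroup_is_group[OF K_subgroup group_BijGroup] .

lemma K_Bij: "g \<in> K \<Longrightarrow> g \<in> Bij N"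
  using subgroup.subset[OF K_subgroup] by (auto simp: BijGroup_def)

lemma K_image: "g \<in> K \<Longrightarrow> g ` N = N" and K_inj: "g \<in> K \<Longrightarrow> inj_on g N"
  using K_Bij by (auto simp: Bij_def bij_betw_def)

lemma K_relabel: "g \<in> K \<Longrightarrow> relabel N g h = h"
  using K_Aut by (auto simp: Aut_def stabilizer_def)

text \<open>Elements of \<open>Bij N\<close> are \<open>undefined\<close> outside \<open>N\<close>,
  so they are determined by their values on a finite set.\<close>

lemma finite_K: "finite K"
proof (rule finite_subset)
  show "K \<subseteq> N \<rightarrow>\<^sub>E N" using K_Bij by (auto simp: Bij_def PiE_def bij_betw_def)
  show "finite (N \<rightarrow>\<^sub>E N)" using finite_N by (simp add: finite_PiE)
qed

lemma mult_G: "g \<in> K \<Longrightarrow> k \<in> K \<Longrightarrow> g \<otimes>\<^bsub>G\<^esub> k = compose N g k"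
  using K_Bij by (simp add: BijGroup_def)

lemma one_G: "\<one>\<^bsub>G\<^esub> = (\<lambda>v\<in>N. v)"
  by (simp add: BijGroup_def)

lemma one_mem: "(\<lambda>v\<in>N. v) \<in> K"
  using group.is_monoid[OF group_G] monoid.one_closed[of G] by (simp add: BijGroup_def)

lemma inv_mem: "g \<in> K \<Longrightarrow> inv\<^bsub>BijGroup N\<^esub> g \<in> K"
  using subgroup.m_inv_closed[OF K_subgroup] .

lemma inv_apply:
  assumes g: "g \<in> K" and v: "v \<in> N"
  shows "(inv\<^bsub>BijGroup N\<^esub> g) (g v) = v" and "g ((inv\<^bsub>BijGroup N\<^esub> g) v) = v"
    and "(inv\<^bsub>BijGroup N\<^esub> g) v \<in> N" and "g v \<in> N"
proof -
  let ?g = "inv\<^bsub>BijGroup N\<^esub> g"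
  have carr: "g \<in> carrier (BijGroup N)" using subgroup.subset[OF K_subgroup] g by blast
  have "?g \<otimes>\<^bsub>BijGroup N\<^esub> g = \<one>\<^bsub>BijGroup N\<^esub>" "g \<otimes>\<^bsub>BijGroup N\<^esub> ?g = \<one>\<^bsub>BijGroup N\<^esub>"
    using group.l_inv[OF group_BijGroup carr] group.r_inv[OF group_BijGroup carr] .
  then have "compose N ?g g = (\<lambda>v\<in>N. v)" "compose N g ?g = (\<lambda>v\<in>N. v)"
    using K_Bij[OF g] K_Bij[OF inv_mem[OF g]] by (simp_all add: BijGroup_def)
  then show "?g (g v) = v" "g (?g v) = v"
    using v by (auto simp: compose_def dest: fun_cong[of _ _ v])
  show "?g v \<in> N" "g v \<in> N" using K_image[OF inv_mem[OF g]] K_image[OF g] v by auto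
qed

lemma X_blocks: "C \<in> X \<alpha> \<Longrightarrow> B \<in> set C \<Longrightarrow> B \<subseteq> N"
  by (auto simp: proper_compositions_def set_composition_iff)

lemma finite_X: "finite (X \<alpha>)"
proof (rule finite_subset)
  show "X \<alpha> \<subseteq> {C. set C \<subseteq> Pow N \<and> length C = length \<alpha>}"
    using X_blocks by (auto simp: proper_compositions_def)
  show "finite {C. set C \<subseteq> Pow N \<and> length C = length \<alpha>}"
    using finite_N by (intro finite_lists_length_eq) simp
qed

lemma map_card_block_action:
  assumes g: "g \<in> K" and C: "\<And>B. B \<in> set C \<Longrightarrow> B \<subseteq> N"
  shows "map card (block_action g C) = map card C"
proof -
  have "card (g ` B) = card B" if "B \<in> set C" for B
    using C[OF that] K_inj[OF g] by (intro card_image) (rule inj_on_subset)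
  then show ?thesis by (simp add: block_action_def)
qed

lemma block_action_closed:
  assumes g: "g \<in> K" and C: "C \<in> X \<alpha>"
  shows "block_action g C \<in> X \<alpha>"
proof -
  have "map card (block_action g C) = map card C"
    using g X_blocks[OF C] by (intro map_card_block_action)
  also have "map card C = \<alpha>" using C by (simp add: proper_compositions_def)
  finally have "map card (block_action g C) = \<alpha>" .
  moreover have "set_composition N (block_action g C)"
    using set_composition_image[OF K_inj[OF g], of C] C
    by (simp add: block_action_def proper_compositions_def K_image[OF g])
  moreover have "proper_composition \<Delta> \<phi> N (block_action g C) h"
    using proper_composition_image[OF finite_N h_mem K_inj[OF g], of C] C
    by (simp add: block_action_def proper_compositions_def K_image[OF g] K_relabel[OF g])
  ultimately show ?thesis by (simp add: proper_compositions_def)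
qed

lemma finite_action_X: "finite_action G (X \<alpha>) block_action"
proof -
  interpret group G by (rule group_G)
  show ?thesis
  proof unfold_locales
    show "finite (carrier G)" using finite_K by simp
    show "finite (X \<alpha>)" by (rule finite_X)
    show "block_action g C \<in> X \<alpha>" if "g \<in> carrier G" "C \<in> X \<alpha>" for g C
      using block_action_closed that by simp
    show "block_action \<one>\<^bsub>G\<^esub> C = C" if "C \<in> X \<alpha>" for C
      unfolding one_G block_action_def using X_blocks[OF that] by (intro map_idI) force
    show "block_action (g \<otimes>\<^bsub>G\<^esub> k) C = block_action g (block_action k C)"
      if "g \<in> carrier G" "k \<in> carrier G" "C \<in> X \<alpha>" for g k C
    proof -
      have gk: "g \<in> K" "k \<in> K" using that by simp_all
      show ?thesis unfolding mult_G[OF gk] block_action_def map_map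
      proof (rule map_cong[OF refl])
        fix B assume "B \<in> set C"
        then have "B \<subseteq> N" using X_blocks that(3) by blast
        then show "compose N g k ` B = ((`) g \<circ> (`) k) B" by (force simp: compose_def)
      qed
    qed
  qed
qed

text \<open>A preimage of \<open>D\<close> is obtained by cutting its block of size
  \<open>a + b\<close> at size \<open>a\<close>; positivity of \<open>a\<close> and \<open>b\<close>
  makes both pieces nonempty, as a set composition demands.\<close>

lemma X_split:
  fixes L R :: "nat list" and a b :: nat
  assumes ab: "a > 0" "b > 0"
  defines "\<alpha> \<equiv> L @ (a + b) # R" and "\<beta> \<equiv> L @ a # b # R"
  defines "p \<equiv> merge_blocks (length L)"
  defines "Y \<equiv> {C \<in> X \<beta>. p C \<in> X \<alpha>}"
  shows "Y \<subseteq> X \<beta>" and "p ` Y = X \<alpha>"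
    and "\<And>g C. g \<in> K \<Longrightarrow> C \<in> Y \<Longrightarrow> block_action g C \<in> Y"
    and "\<And>g C. g \<in> K \<Longrightarrow> C \<in> Y \<Longrightarrow> p (block_action g C) = block_action g (p C)"
proof -
  show "Y \<subseteq> X \<beta>" by (auto simp: Y_def)
  show equiv: "p (block_action g C) = block_action g (p C)" if "g \<in> K" "C \<in> Y" for g C
  proof -
    have "length C = length \<beta>" using that by (auto simp: Y_def proper_compositions_def)
    then show ?thesis by (simp add: p_def block_action_def map_image_merge_blocks \<beta>_def)
  qed
  show "block_action g C \<in> Y" if "g \<in> K" "C \<in> Y" for g C
    using that equiv[OF that] block_action_closed by (auto simp: Y_def)
  show "p ` Y = X \<alpha>"
  proof
    show "p ` Y \<subseteq> X \<alpha>" by (auto simp: Y_def)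
    show "X \<alpha> \<subseteq> p ` Y"
    proof
      fix D assume D: "D \<in> X \<alpha>"
      then have "map card D = L @ (a + b) # R" by (simp add: proper_compositions_def \<alpha>_def)
      then obtain L' B R' where LBR: "D = L' @ B # R'" "map card L' = L" "card B = a + b" "map card R' = R"
        by (auto simp: map_eq_append_conv map_eq_Cons_conv)
      have D': "set_composition N (L' @ B # R')" "proper_composition \<Delta> \<phi> N (L' @ B # R') h"
        using D LBR(1) by (auto simp: proper_compositions_def)
      obtain S where S: "S \<subseteq> B" "card S = a" "proper_composition \<Delta> \<phi> N (L' @ S # (B - S) # R') h"
        using proper_composition_split_block[OF finite_N h_mem D', of a] LBR(3) by auto
      have finB: "finite B" using LBR(3) ab by (intro card_ge_0_finite) simp
      have cardS: "card (B - S) = b" using S LBR(3) finite_subset[OF S(1) finB] by (simp add: card_Diff_subset)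
      have "S \<noteq> {}" "S \<noteq> B" using S(2) LBR(3) ab by auto
      then have "set_composition N (L' @ S # (B - S) # R')"
        using set_composition_split_block[OF D'(1) S(1)] by simp
      then have C: "L' @ S # (B - S) # R' \<in> X \<beta>"
        using S cardS LBR by (simp add: proper_compositions_def \<beta>_def)
      have "length L' = length L" using LBR(2) by auto
      moreover have "S \<union> (B - S) = B" using S(1) by blast
      ultimately have "p (L' @ S # (B - S) # R') = D"
        by (simp add: p_def merge_blocks_def LBR(1) nth_append)
      then show "D \<in> p ` Y" using C D by (intro image_eqI[of _ _ "L' @ S # (B - S) # R'"]) (simp_all add: Y_def)
    qed
  qed
qed

definition char_coeff :: "nat list \<Rightarrow> ('a \<Rightarrow> 'a) \<Rightarrow> complex" where
  "char_coeff \<alpha> g = of_nat (card {C \<in> X \<alpha>. block_action g C = C})"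

text \<open>The dummy argument of type \<open>unit\<close> makes orbit counts an instance of
  \<open>increasing_family\<close>, whose members are functions.\<close>

definition orbit_coeff :: "nat list \<Rightarrow> unit \<Rightarrow> real" where
  "orbit_coeff \<alpha> u = of_nat (card (orbits G (X \<alpha>) block_action))"

lemma increasing_char_coeff: "increasing_family (effective_character G) (card N) char_coeff"
proof -
  interpret E: effective_cone "effective_character G"
    by unfold_locales (auto intro: effective_character_zero effective_character_add)
  show ?thesis
  proof unfold_locales
    fix \<alpha>
    interpret finite_action G "X \<alpha>" block_action by (rule finite_action_X)
    show "effective_character G (char_coeff \<alpha>)"
      using permutation_character_effective by (simp add: char_coeff_def[abs_def])
  next
    fix L a b R assume "(a :: nat) > 0" "(b :: nat) > 0"
    note split = X_split[OF this, where L = L and R = R]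
    interpret finite_action G "X (L @ a # b # R)" block_action by (rule finite_action_X)
    have "character_le G (\<lambda>g. of_nat (card {C \<in> X (L @ (a + b) # R). block_action g C = C}))
        (\<lambda>g. of_nat (card {C \<in> X (L @ a # b # R). block_action g C = C}))"
      by (rule permutation_character_le[OF split(1) _ split(2)]) (use split(3,4) in auto)
    then show "E.le (char_coeff (L @ (a + b) # R)) (char_coeff (L @ a # b # R))"
      by (simp add: E.le_def character_le_def char_coeff_def)
  qed
qed

lemma increasing_orbit_coeff: "increasing_family (\<lambda>x. x () \<ge> (0 :: real)) (card N) orbit_coeff"
proof -
  interpret E: effective_cone "\<lambda>x. x () \<ge> (0 :: real)"
    by unfold_locales auto
  show ?thesis
  proof unfold_locales
    fix L a b R assume "(a :: nat) > 0" "(b :: nat) > 0"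
    note split = X_split[OF this, where L = L and R = R]
    have "card (orbits G (X (L @ (a + b) # R)) block_action) \<le> card (orbits G (X (L @ a # b # R)) block_action)"
      by (rule card_orbits_le[OF finite_X split(1,2)]) (use split(4) in auto)
    then show "E.le (orbit_coeff (L @ (a + b) # R)) (orbit_coeff (L @ a # b # R))"
      by (simp add: E.le_def orbit_coeff_def)
  qed (simp add: orbit_coeff_def)
qed

end

lemma sum_list_card_set_composition:
  "finite N \<Longrightarrow> set_composition N C \<Longrightarrow> sum_list (map card C) = card N"
proof (induction C arbitrary: N)
  case (Cons B C)
  then have "B \<subseteq> N" "finite B" using finite_subset by auto
  then have "card N = card B + card (N - B)" using Cons.prems(1) by (simp add: card_Diff_subset card_mono)
  then show ?case using Cons by simp
qed simp

section \<open>From proper functions to proper set compositions\<close>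

context hopf_symmetry
begin

lemma function_action_apply:
  "g \<in> K \<Longrightarrow> v \<in> N \<Longrightarrow> function_action N g f v = f ((inv\<^bsub>BijGroup N\<^esub> g) v)"
  by (simp add: function_action_def compose_def)

lemma function_action_image: "g \<in> K \<Longrightarrow> function_action N g f ` N = f ` N"
proof -
  assume g: "g \<in> K"
  have "function_action N g f ` N = f ` ((inv\<^bsub>BijGroup N\<^esub> g) ` N)"
    unfolding image_image by (intro image_cong) (simp_all add: function_action_apply[OF g])
  then show ?thesis by (simp add: K_image[OF inv_mem[OF g]])
qed

text \<open>The inverse in the action on functions makes \<open>g\<close> move the level sets
  forward.\<close>

lemma level_composition_function_action:
  assumes g: "g \<in> K"
  shows "level_composition N (function_action N g f) = block_action g (level_composition N f)"
proof -
  have "{v \<in> N. function_action N g f v = i} = g ` {v \<in> N. f v = i}" for i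
  proof
    show "{v \<in> N. function_action N g f v = i} \<subseteq> g ` {v \<in> N. f v = i}"
    proof
      fix v assume "v \<in> {v \<in> N. function_action N g f v = i}"
      then have "v \<in> N" "f ((inv\<^bsub>BijGroup N\<^esub> g) v) = i" by (auto simp: function_action_apply[OF g])
      then show "v \<in> g ` {v \<in> N. f v = i}"
        using inv_apply[OF g, of v]
        by (intro image_eqI[of _ _ "(inv\<^bsub>BijGroup N\<^esub> g) v"]) simp_all
    qed
    show "g ` {v \<in> N. f v = i} \<subseteq> {v \<in> N. function_action N g f v = i}"
      using inv_apply[OF g] by (auto simp: function_action_apply[OF g])
  qed
  then show ?thesis
    by (simp add: level_composition_def block_action_def function_action_image[OF g])
qed

lemma level_composition_blocks: "B \<in> set (level_composition N f) \<Longrightarrow> B \<subseteq> N"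
  using set_composition_level_composition[OF finite_N, of f] by (auto simp: set_composition_iff)

lemma function_monomial_function_action:
  "g \<in> K \<Longrightarrow> function_monomial N (function_action N g f) = function_monomial N f"
  by (intro monomial_determined)
    (simp_all add: set_mset_function_monomial finite_N function_action_image monomial_type_function_monomial
      level_composition_function_action map_card_block_action level_composition_blocks)

lemma function_action_closed:
  assumes g: "g \<in> K" and f: "f \<in> F_monomial m"
  shows "function_action N g f \<in> F_monomial m"
proof -
  have "level_composition N f \<in> X (monomial_type m)"
    using bij_betw_apply[OF bij_level_composition[OF finite_N] f] .
  then have "level_composition N (function_action N g f) \<in> X (monomial_type m)"
    using block_action_closed[OF g] by (simp add: level_composition_function_action[OF g])
  moreover have "function_action N g f \<in> N \<rightarrow>\<^sub>E UNIV"
    by (simp add: function_action_def PiE_def)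
  ultimately show ?thesis
    using f function_monomial_function_action[OF g] by (simp add: proper_functions_iff proper_compositions_def)
qed

lemma finite_F_monomial: "finite (F_monomial m)"
  using bij_betw_finite[OF bij_level_composition[OF finite_N, of \<Delta> \<phi> h m]] finite_X by simp

text \<open>The bijection with set compositions is equivariant, so it restricts to fixed
  points.\<close>

lemma card_fixed_functions:
  assumes g: "g \<in> K"
  shows "card {f \<in> F_monomial m. function_action N g f = f}
       = card {C \<in> X (monomial_type m). block_action g C = C}"
proof (rule bij_betw_same_card[of "level_composition N"])
  note bij = bij_level_composition[OF finite_N, of \<Delta> \<phi> h m]
  have fixed: "function_action N g f = f \<longleftrightarrow> block_action g (level_composition N f) = level_composition N f"
    if "f \<in> F_monomial m" for f
    using inj_on_eq_iff[OF bij_betw_imp_inj_on[OF bij] function_action_closed[OF g that] that]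
    by (simp add: level_composition_function_action[OF g])
  show "bij_betw (level_composition N) {f \<in> F_monomial m. function_action N g f = f}
      {C \<in> X (monomial_type m). block_action g C = C}"
  proof (rule bij_betw_subset[OF bij])
    show "level_composition N ` {f \<in> F_monomial m. function_action N g f = f}
        = {C \<in> X (monomial_type m). block_action g C = C}"
      unfolding bij_betw_imp_surj_on[OF bij, symmetric] using fixed by blast
  qed blast
qed

lemma card_orbits_functions:
  "card (orbits G (X (monomial_type m)) block_action) = card (orbits G (F_monomial m) (function_action N))"
proof (rule card_orbits_bij[OF bij_level_composition[OF finite_N]])
  fix g f assume "g \<in> carrier G" "f \<in> F_monomial m"
  then show "function_action N g f \<in> F_monomial m" using function_action_closed by simp
next
  fix g f assume "g \<in> carrier G" "f \<in> F_monomial m"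
  then show "level_composition N (function_action N g f) = block_action g (level_composition N f)"
    by (simp add: level_composition_function_action)
qed

lemma Psi_qsym_eq:
  assumes "g \<in> K"
  shows "Psi_qsym N F g m = char_coeff (monomial_type m) g"
proof -
  have "{f \<in> invariants F (function_action N) g. function_monomial N f = m}
      = {f \<in> F_monomial m. function_action N g f = f}"
    by (auto simp: invariants_def)
  then show ?thesis by (simp only: Psi_qsym_def char_coeff_def card_fixed_functions[OF assms])
qed

lemma orbit_monomial:
  assumes "f' \<in> orbit G (function_action N) f"
  shows "function_monomial N f' = function_monomial N f"
  using assms function_monomial_function_action by (auto simp: orbit_def)

lemma orbit_nonempty: "orbit G (function_action N) f \<noteq> {}"
  using one_mem by (auto simp: orbit_def)

text \<open>Orbits are nonempty and carry one monomial, so asking for some function with monomial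
  \<open>m\<close> selects exactly the orbits inside \<open>F_monomial m\<close>.\<close>

lemma orbit_Psi_qsym_eq: "orbit_Psi_qsym G N F m = orbit_coeff (monomial_type m) ()"
proof -
  have "(\<exists>f'\<in>orbit G (function_action N) f. function_monomial N f' = m) \<longleftrightarrow> function_monomial N f = m" for f
  proof -
    obtain f' where "f' \<in> orbit G (function_action N) f" using orbit_nonempty by blast
    then show ?thesis using orbit_monomial by metis
  qed
  then have "{Ob \<in> orbits G F (function_action N). \<exists>f\<in>Ob. function_monomial N f = m}
      = orbits G (F_monomial m) (function_action N)"
    unfolding orbits_eq_image by blast
  then show ?thesis by (simp add: orbit_Psi_qsym_def orbit_coeff_def card_orbits_functions)
qed

lemma functions_into_eq_UN:
  "{f \<in> F. f ` N \<subseteq> {1..x}} = (\<Union>m\<in>{m. size m = card N \<and> set_mset m \<subseteq> {1..x}}. F_monomial m)"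
  using set_mset_function_monomial[OF finite_N] size_function_monomial by auto

lemma Psi_count_eq:
  assumes g: "g \<in> K"
  shows "of_nat (Psi_count N F g x) = (\<Sum>\<alpha>\<in>compositions (card N). of_nat (x choose length \<alpha>) * char_coeff \<alpha> g)"
proof -
  let ?M = "{m. size m = card N \<and> set_mset m \<subseteq> {1..x}}"
  have "{f \<in> invariants F (function_action N) g. f ` N \<subseteq> {1..x}}
      = {f \<in> {f \<in> F. f ` N \<subseteq> {1..x}}. function_action N g f = f}"
    by (auto simp: invariants_def)
  also have "\<dots> = (\<Union>m\<in>?M. {f \<in> F_monomial m. function_action N g f = f})"
    unfolding functions_into_eq_UN by blast
  finally have "Psi_count N F g x = card (\<Union>m\<in>?M. {f \<in> F_monomial m. function_action N g f = f})"
    by (simp only: Psi_count_def)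
  also have "\<dots> = (\<Sum>m\<in>?M. card {f \<in> F_monomial m. function_action N g f = f})"
  proof (rule card_UN_disjoint)
    show "finite ?M" by (rule finite_monomials)
    show "\<forall>m\<in>?M. finite {f \<in> F_monomial m. function_action N g f = f}"
      using finite_F_monomial finite_subset[of "{f \<in> F_monomial m. function_action N g f = f}" "F_monomial m" for m]
      by blast
  qed blast
  finally have "of_nat (Psi_count N F g x) = (\<Sum>m\<in>?M. char_coeff (monomial_type m) g)"
    by (simp only: char_coeff_def card_fixed_functions[OF g] of_nat_sum)
  also have "\<dots> = (\<Sum>\<alpha>\<in>compositions (card N). of_nat (x choose length \<alpha>) * char_coeff \<alpha> g)"
    by (rule sum_over_monomials)
  finally show ?thesis .
qed

lemma orbit_Psi_count_eq:
  "of_nat (orbit_Psi_count G N F x) = (\<Sum>\<alpha>\<in>compositions (card N). of_nat (x choose length \<alpha>) * orbit_coeff \<alpha> ())"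
proof -
  let ?M = "{m. size m = card N \<and> set_mset m \<subseteq> {1..x}}"
  have "orbits G {f \<in> F. f ` N \<subseteq> {1..x}} (function_action N)
      = (\<Union>m\<in>?M. orbits G (F_monomial m) (function_action N))"
    unfolding functions_into_eq_UN orbits_eq_image by blast
  then have "orbit_Psi_count G N F x = card (\<Union>m\<in>?M. orbits G (F_monomial m) (function_action N))"
    by (simp only: orbit_Psi_count_def)
  also have "\<dots> = (\<Sum>m\<in>?M. card (orbits G (F_monomial m) (function_action N)))"
  proof (rule card_UN_disjoint)
    show "finite ?M" by (rule finite_monomials)
    show "\<forall>m\<in>?M. finite (orbits G (F_monomial m) (function_action N))"
      using finite_F_monomial by (simp add: orbits_eq_image)
    \<comment> \<open>An orbit shared by two monomial classes would contain a function with both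
      monomials.\<close>
    show "\<forall>m\<in>?M. \<forall>m'\<in>?M. m \<noteq> m' \<longrightarrow>
        orbits G (F_monomial m) (function_action N) \<inter> orbits G (F_monomial m') (function_action N) = {}"
    proof (intro ballI impI)
      fix m m' :: "nat multiset" assume ne: "m \<noteq> m'"
      show "orbits G (F_monomial m) (function_action N) \<inter> orbits G (F_monomial m') (function_action N) = {}"
      proof (rule equals0I, elim IntE)
        fix Ob assume "Ob \<in> orbits G (F_monomial m) (function_action N)"
          "Ob \<in> orbits G (F_monomial m') (function_action N)"
        then obtain f f' where Ob: "Ob = orbit G (function_action N) f" "Ob = orbit G (function_action N) f'"
          and f: "function_monomial N f = m" "function_monomial N f' = m'"
          by (auto simp only: orbits_eq_image mem_Collect_eq image_iff Bex_def)
        obtain f'' where "f'' \<in> Ob" using orbit_nonempty Ob(1) by blast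
        then have "m = m'" using orbit_monomial[of f'' f] orbit_monomial[of f'' f'] Ob f by simp
        then show False using ne by simp
      qed
    qed
  qed
  finally have "of_nat (orbit_Psi_count G N F x) = (\<Sum>m\<in>?M. orbit_coeff (monomial_type m) ())"
    by (simp only: orbit_coeff_def card_orbits_functions of_nat_sum)
  also have "\<dots> = (\<Sum>\<alpha>\<in>compositions (card N). of_nat (x choose length \<alpha>) * orbit_coeff \<alpha> ())"
    by (rule sum_over_monomials)
  finally show ?thesis .
qed

lemma X_empty: "\<alpha> \<in> compositions n \<Longrightarrow> n \<noteq> card N \<Longrightarrow> X \<alpha> = {}"
  using sum_list_card_set_composition[OF finite_N] by (auto simp: proper_compositions_def compositions_def)

lemma X_flag: "X (replicate (card N) 1) \<noteq> {}"
  using proper_flag_exists[OF finite_N h_mem] by (auto simp: proper_compositions_def)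

lemma replicate_compositions: "replicate n 1 \<in> compositions n"
  by (simp add: compositions_def sum_list_replicate)

sublocale char: increasing_family "effective_character G" "card N" char_coeff
  by (rule increasing_char_coeff)

sublocale orb: increasing_family "\<lambda>x. x () \<ge> (0 :: real)" "card N" orbit_coeff
  by (rule increasing_orbit_coeff)

lemma char_le_iff: "char.le x y \<longleftrightarrow> character_le G x y"
  by (simp add: char.le_def character_le_def)

lemma orb_le_iff: "orb.le x y \<longleftrightarrow> x () \<le> y ()"
  by (simp add: orb.le_def)

lemma class_function_char_coeff: "class_function G (char_coeff \<alpha>)"
  using finite_action.class_function_fixed_points[OF finite_action_X, of \<alpha>]
  by (simp add: char_coeff_def[abs_def])

lemma M_increasing_class_Psi: "M_increasing_class G (Psi_qsym N F)"
  unfolding M_increasing_class_def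
proof (intro exI[of _ char_coeff] conjI ballI allI impI)
  fix g assume "g \<in> carrier G"
  then show "qsym_expansion (Psi_qsym N F g) (\<lambda>\<alpha>. char_coeff \<alpha> g)"
    by (simp add: qsym_expansion_iff Psi_qsym_eq)
next
  fix n \<alpha> \<beta> assume ab: "\<alpha> \<in> compositions n" "\<beta> \<in> compositions n" "refined_by \<alpha> \<beta>"
  show "character_le G (char_coeff \<alpha>) (char_coeff \<beta>)"
  proof (cases "n = card N")
    case True
    then show ?thesis using char.c_refine[OF ab(3)] ab by (simp add: char_le_iff)
  next
    case False
    \<comment> \<open>Block sizes add up to \<open>card N\<close>, so in all other degrees both
      coefficients vanish.\<close>
    then have "char_coeff \<alpha> = (\<lambda>_. 0)" "char_coeff \<beta> = (\<lambda>_. 0)"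
      using X_empty ab by (auto simp: char_coeff_def[abs_def])
    then show ?thesis by (simp add: character_le_def effective_character_zero)
  qed
qed (rule class_function_char_coeff)

lemma M_increasing_orbit_Psi: "M_increasing (orbit_Psi_qsym G N F)"
  unfolding M_increasing_def
proof (intro exI[of _ "\<lambda>\<alpha>. orbit_coeff \<alpha> ()"] conjI ballI allI impI)
  show "qsym_expansion (orbit_Psi_qsym G N F) (\<lambda>\<alpha>. orbit_coeff \<alpha> ())"
    by (simp add: qsym_expansion_iff orbit_Psi_qsym_eq)
next
  fix n \<alpha> \<beta> assume ab: "\<alpha> \<in> compositions n" "\<beta> \<in> compositions n" "refined_by \<alpha> \<beta>"
  show "orbit_coeff \<alpha> () \<le> orbit_coeff \<beta> ()"
  proof (cases "n = card N")
    case True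
    then show ?thesis using orb.c_refine[OF ab(3)] ab by (simp add: orb_le_iff)
  next
    case False
    then show ?thesis using X_empty ab by (simp add: orbit_coeff_def)
  qed
qed

section \<open>The counting polynomials and their f-vectors\<close>

definition char_poly :: "('a \<Rightarrow> 'a) \<Rightarrow> complex poly" where
  "char_poly g = newton_poly (card N) (\<lambda>i. char.level i g)"

definition orbit_poly :: "real poly" where
  "orbit_poly = newton_poly (card N) (\<lambda>i. orb.level i ())"

lemma poly_char_poly: "g \<in> K \<Longrightarrow> poly (char_poly g) (of_nat x) = of_nat (Psi_count N F g x)"
  unfolding char_poly_def char.level_def
  by (subst poly_newton_poly_by_length) (simp_all add: char.length_composition_le finite_compositions Psi_count_eq)

lemma poly_orbit_poly: "poly orbit_poly (of_nat x) = of_nat (orbit_Psi_count G N F x)"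
  unfolding orbit_poly_def orb.level_def
  by (subst poly_newton_poly_by_length) (simp_all add: orb.length_composition_le finite_compositions orbit_Psi_count_eq)

text \<open>The Newton expansion has the bound \<open>card N\<close> for every \<open>g\<close>, so
  the entries are read off uniformly even where the degree of \<open>char_poly g\<close> is
  smaller.\<close>

lemma f_vector_char_poly: "f_vector (char_poly g) i = char.level i g"
  unfolding char_poly_def by (subst f_vector_newton_poly) (simp_all add: char.level_gt)

lemma f_vector_orbit_poly: "f_vector orbit_poly i = orb.level i ()"
  unfolding orbit_poly_def by (subst f_vector_newton_poly) (simp_all add: orb.level_gt)

text \<open>At the identity every composition is fixed, so the top entry counts the proper
  compositions into singletons, of which there is at least one. At other elements the degree may be
  smaller, and \<open>class_degree\<close> takes the maximum.\<close>

lemma degree_char_poly_one: "degree (char_poly (\<lambda>v\<in>N. v)) = card N"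
proof -
  let ?A = "{\<alpha> \<in> compositions (card N). length \<alpha> = card N}"
  let ?one = "\<lambda>v\<in>N. v"
  have one: "{C \<in> X \<alpha>. block_action ?one C = C} = X \<alpha>" for \<alpha>
    using finite_action.act_one[OF finite_action_X, of _ \<alpha>] by (auto simp: one_G)
  have fin: "finite ?A" using finite_compositions by simp
  define s where "s = (\<Sum>\<alpha>\<in>?A. card (X \<alpha>))"
  have "card (X (replicate (card N) 1)) \<le> s"
    unfolding s_def using fin replicate_compositions by (intro member_le_sum) auto
  moreover have "card (X (replicate (card N) 1)) > 0" using X_flag finite_X by (simp add: card_gt_0_iff)
  moreover have "char.level (card N) ?one = of_nat s"
    by (simp add: char.level_def char_coeff_def one s_def)
  ultimately have "char.level (card N) ?one \<noteq> 0" by simp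
  then show ?thesis unfolding char_poly_def by (rule degree_newton_poly)
qed

lemma degree_orbit_poly: "degree orbit_poly = card N"
proof -
  let ?A = "{\<alpha> \<in> compositions (card N). length \<alpha> = card N}"
  have fin: "finite ?A" using finite_compositions by simp
  have "orbit_coeff (replicate (card N) 1) () \<le> (\<Sum>\<alpha>\<in>?A. orbit_coeff \<alpha> ())"
    using fin replicate_compositions by (intro member_le_sum) (auto simp: orbit_coeff_def)
  moreover have "orbit_coeff (replicate (card N) 1) () > 0"
    using X_flag finite_X by (simp add: orbit_coeff_def orbits_eq_image card_gt_0_iff)
  ultimately have "orb.level (card N) () \<noteq> 0" by (simp add: orb.level_def)
  then show ?thesis unfolding orbit_poly_def by (rule degree_newton_poly)
qed

lemma class_degree_char_poly: "class_degree G char_poly = card N"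
  unfolding class_degree_def
proof (rule Max_eqI)
  show "finite ((\<lambda>g. degree (char_poly g)) ` carrier G)" using finite_K by simp
  show "y \<le> card N" if "y \<in> (\<lambda>g. degree (char_poly g)) ` carrier G" for y
    using that degree_newton_poly_le by (auto simp: char_poly_def)
  show "card N \<in> (\<lambda>g. degree (char_poly g)) ` carrier G"
    using degree_char_poly_one one_mem by (intro image_eqI[of _ _ "\<lambda>v\<in>N. v"]) simp_all
qed

lemma class_function_char_poly: "class_function G char_poly"
  using class_function_char_coeff
  unfolding class_function_def char_poly_def char.level_def by simp

text \<open>Over the naturals the two bounds read \<open>2 * i + 1 \<le> card N\<close> and
  \<open>2 * i \<le> card N\<close>; in both cases the two indices are ordered and their sum is at
  most \<open>card N + 1\<close>.\<close>

lemma level_flawless: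
  shows char_level_Suc: "real i \<le> (real (card N) - 1) / 2 \<Longrightarrow> char.le (char.level i) (char.level (i + 1))"
    and char_level_flip: "real i \<le> real (card N) / 2 \<Longrightarrow> char.le (char.level i) (char.level (card N - i))"
    and orb_level_Suc: "real i \<le> (real (card N) - 1) / 2 \<Longrightarrow> orb.le (orb.level i) (orb.level (i + 1))"
    and orb_level_flip: "real i \<le> real (card N) / 2 \<Longrightarrow> orb.le (orb.level i) (orb.level (card N - i))"
proof -
  show "char.le (char.level i) (char.level (i + 1))" if "real i \<le> (real (card N) - 1) / 2"
  proof -
    have "2 * real i + 1 \<le> real (card N)" using that by simp
    then have "2 * i + 1 \<le> card N" by linarith
    then show ?thesis by (intro char.level_le) auto
  qed
  show "orb.le (orb.level i) (orb.level (i + 1))" if "real i \<le> (real (card N) - 1) / 2"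
  proof -
    have "2 * real i + 1 \<le> real (card N)" using that by simp
    then have "2 * i + 1 \<le> card N" by linarith
    then show ?thesis by (intro orb.level_le) auto
  qed
  show "char.le (char.level i) (char.level (card N - i))" if "real i \<le> real (card N) / 2"
  \<comment> \<open>\<open>level_le\<close> excludes the empty label set; there the bound makes
    \<open>i\<close> and \<open>card N - i\<close> both 0.\<close>
  proof (cases "card N = 0")
    case True
    then show ?thesis using that by (simp add: char.le_refl)
  next
    case False
    have "2 * i \<le> card N" using that by linarith
    then show ?thesis using False by (intro char.level_le) linarith+
  qed
  show "orb.le (orb.level i) (orb.level (card N - i))" if "real i \<le> real (card N) / 2"
  proof (cases "card N = 0")
    case True
    then show ?thesis using that by (simp add: orb.le_refl)
  next
    case False
    have "2 * i \<le> card N" using that by linarith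
    then show ?thesis using False by (intro orb.level_le) linarith+
  qed
qed

lemma effectively_flawless_char_poly: "effectively_flawless G char_poly"
  unfolding effectively_flawless_def class_degree_char_poly f_vector_char_poly
  using class_function_char_poly char_level_Suc char_level_flip by (simp add: char_le_iff)

lemma strongly_flawless_orbit_poly: "strongly_flawless orbit_poly"
  unfolding strongly_flawless_def degree_orbit_poly f_vector_orbit_poly
  using orb_level_Suc orb_level_flip by (simp add: orb_le_iff)

lemma char_f_vector_step:
  "character_le G (\<lambda>g. (of_nat (card N) - of_nat i) * f_vector (char_poly g) i)
     (\<lambda>g. of_nat i * f_vector (char_poly g) (i + 1))"
  unfolding f_vector_char_poly using char.level_step[of i] by (simp only: char_le_iff)

lemma orbit_f_vector_step:
  "(of_nat (card N) - of_nat i) * f_vector orbit_poly i \<le> of_nat i * f_vector orbit_poly (i + 1)"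
  unfolding f_vector_orbit_poly using orb.level_step[of i] by (simp only: orb_le_iff)

end

theorem theorem6:
  fixes H :: "'a set \<Rightarrow> 'h set"
    and relabel :: "'a set \<Rightarrow> ('a \<Rightarrow> 'a) \<Rightarrow> 'h \<Rightarrow> 'h"
    and \<mu> :: "'a set \<Rightarrow> 'a set \<Rightarrow> 'h \<Rightarrow> 'h \<Rightarrow> 'h"
    and \<Delta> :: "'a set \<Rightarrow> 'a set \<Rightarrow> 'h \<Rightarrow> ('h \<times> 'h) option"
    and \<phi> :: "'a set \<Rightarrow> 'h \<Rightarrow> nat"
    and N :: "'a set" and h :: 'h and K :: "('a \<Rightarrow> 'a) set"
  defines "G \<equiv> (BijGroup N)\<lparr>carrier := K\<rparr>"
    and "F \<equiv> proper_functions \<Delta> \<phi> N h"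
  assumes "balanced_convex_character H relabel \<mu> \<Delta> \<phi>"
    and "finite N" and "h \<in> H N"
    and "subgroup K (BijGroup N)" and "K \<subseteq> Aut relabel N h"
  shows
    "(M_increasing_class G (Psi_qsym N F) \<and> M_increasing (orbit_Psi_qsym G N F)) \<and>
     (\<exists>P :: ('a \<Rightarrow> 'a) \<Rightarrow> complex poly.
        (\<forall>g\<in>K. \<forall>x. poly (P g) (of_nat x) = of_nat (Psi_count N F g x)) \<and>
        effectively_flawless G P \<and>
        (\<forall>i. character_le G (\<lambda>g. (of_nat (card N) - of_nat i) * f_vector (P g) i)
                            (\<lambda>g. of_nat i * f_vector (P g) (i + 1)))) \<and>
     (\<exists>p :: real poly.
        (\<forall>x. poly p (of_nat x) = of_nat (orbit_Psi_count G N F x)) \<and>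
        strongly_flawless p \<and>
        (\<forall>i. (of_nat (card N) - of_nat i) * f_vector p i \<le> of_nat i * f_vector p (i + 1)))"
proof -
  interpret balanced_convex_character H relabel \<mu> \<Delta> \<phi> by fact
  interpret S: hopf_symmetry H relabel \<mu> \<Delta> \<phi> N h K
    by (intro hopf_symmetry.intro hopf_symmetry_axioms.intro assms)
  show ?thesis
    unfolding G_def F_def
    using S.M_increasing_class_Psi S.M_increasing_orbit_Psi S.poly_char_poly S.poly_orbit_poly
      S.effectively_flawless_char_poly S.strongly_flawless_orbit_poly
      S.char_f_vector_step S.orbit_f_vector_step
    by (intro conjI exI[of _ S.char_poly] exI[of _ S.orbit_poly]) blast+
qed

end
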